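(* Let $A$ be a Dedekind domain with quotient field $K$. Let $L/K$ be a finite separable extension of fields. Assume that $L$ is the compositum $K_1K_2$ of two subfields $K_1$ and $K_2$ with $K\subseteq K_1,K_2\subseteq L$. Denote by $B$, $B_1$ and $B_2$ the integral closures of $A$ in $L$, $K_1$ and $K_2$ respectively. Let $\mathfrak p$ be a nonzero maximal ideal of $A$ whose residue field $A/\mathfrak p$ is perfect, of characteristic $p$ (which may be $0$). Let $\mathfrak q$ be a maximal ideal of $B$ lying over $\mathfrak p$ and let $\mathfrak p_i=\mathfrak q\cap B_i$ for $i=1,2$. If at least one of the extensions $K_i/K$ is tamely ramified in $\mathfrak p_i$ (that is, if at least one of the integers $e(\mathfrak p_1/\mathfrak p)$, $e(\mathfrak p_2/\mathfrak p)$ is not divisible by $p$), then $$e(\mathfrak q/\mathfrak p)=\mathrm{lcm}\,\{\,e(\mathfrak p_1/\mathfrak p),\,e(\mathfrak p_2/\mathfrak p)\,\}.$$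
   Context: For a finite separable extension $E/K$, with $C$ the integral closure of $A$ in $E$ and $\mathfrak r$ a maximal ideal of $C$ lying over $\mathfrak p$, $e(\mathfrak r/\mathfrak p)$ denotes the ramification index of $\mathfrak r$ over $\mathfrak p$, i.e. the exponent of $\mathfrak r$ in the prime factorization of $\mathfrak pC$. If $p=0$, the condition "not divisible by $p$" holds automatically, since ramification indices are positive integers (so the ramification is always tame in that case). *)

theory Defs
  imports
    "HOL-Algebra.Finite_Extensions"
    "HOL-Algebra.Generated_Fields"
    "HOL-Algebra.Ideal_Product"
begin

text \<open>
  All rings and fields of an extension live inside one ambient field \<open>R\<close>: they are subsets of
  \<^term>\<open>carrier R\<close>, and a subset \<open>A\<close> is turned into a ring by \<open>R\<lparr>carrier := A\<rparr>\<close>.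
  Polynomials are the lists of \<^theory>\<open>HOL-Algebra.Polynomials\<close>, leading coefficient first,
  with \<open>[]\<close> as the zero polynomial.
\<close>

definition fraction_field :: "('a, 'b) ring_scheme \<Rightarrow> 'a set \<Rightarrow> 'a set" where
  "fraction_field R A = {a \<otimes>\<^bsub>R\<^esub> inv\<^bsub>R\<^esub> b | a b. a \<in> A \<and> b \<in> A \<and> b \<noteq> \<zero>\<^bsub>R\<^esub>}"

definition integral_closure :: "('a, 'b) ring_scheme \<Rightarrow> 'a set \<Rightarrow> 'a set \<Rightarrow> 'a set" where
  "integral_closure R A E =
     {x \<in> E. \<exists>f \<in> carrier (A[X]\<^bsub>R\<^esub>). f \<noteq> [] \<and> lead_coeff f = \<one>\<^bsub>R\<^esub> \<and> ring.eval R f x = \<zero>\<^bsub>R\<^esub>}"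

text \<open>Fields are not excluded; a nonzero maximal ideal exists only if the ring is not a field.\<close>

definition dedekind_domain :: "('a, 'b) ring_scheme \<Rightarrow> 'a set \<Rightarrow> bool" where
  "dedekind_domain R A \<longleftrightarrow>
     subring A R \<and>
     noetherian_domain (R\<lparr>carrier := A\<rparr>) \<and>
     integral_closure R A (fraction_field R A) = A \<and>
     (\<forall>P. primeideal P (R\<lparr>carrier := A\<rparr>) \<and> P \<noteq> {\<zero>\<^bsub>R\<^esub>} \<longrightarrow> maximalideal P (R\<lparr>carrier := A\<rparr>))"

text \<open>The coefficient of \<open>X\<close> to the power \<open>i\<close> in the derivative is \<open>i + 1\<close> times the one at
  \<open>i + 1\<close>; leading zeros, which occur in positive characteristic, are dropped.\<close>

definition formal_derivative :: "('a, 'b) ring_scheme \<Rightarrow> 'a list \<Rightarrow> 'a list" where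
  "formal_derivative R f =
     ring.normalize R
       (map (\<lambda>i. add_pow R (Suc i) (ring.coeff R f (Suc i))) (rev [0..<degree f]))"

definition separable_polynomial :: "('a, 'b) ring_scheme \<Rightarrow> 'a set \<Rightarrow> 'a list \<Rightarrow> bool" where
  "separable_polynomial R K f \<longleftrightarrow>
     (\<forall>d \<in> carrier (K[X]\<^bsub>R\<^esub>).
        d divides\<^bsub>K[X]\<^bsub>R\<^esub>\<^esub> f \<and> d divides\<^bsub>K[X]\<^bsub>R\<^esub>\<^esub> formal_derivative R f \<longrightarrow>
        d \<in> Units (K[X]\<^bsub>R\<^esub>))"

definition separable_extension :: "('a, 'b) ring_scheme \<Rightarrow> 'a set \<Rightarrow> 'a set \<Rightarrow> bool" where
  "separable_extension R K E \<longleftrightarrow>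
     (\<forall>x \<in> E. (ring.algebraic R over K) x \<and> separable_polynomial R K (ring.Irr R K x))"

definition perfect_field :: "('a, 'b) ring_scheme \<Rightarrow> bool" where
  "perfect_field F \<longleftrightarrow>
     field F \<and>
     (\<forall>f \<in> carrier (poly_ring F).
        pirreducible\<^bsub>F\<^esub> (carrier F) f \<longrightarrow> separable_polynomial F (carrier F) f)"

definition ring_characteristic :: "('a, 'b) ring_scheme \<Rightarrow> nat" where
  "ring_characteristic R =
     (if \<exists>n::nat. n > 0 \<and> add_pow R n \<one>\<^bsub>R\<^esub> = \<zero>\<^bsub>R\<^esub>
      then LEAST n::nat. n > 0 \<and> add_pow R n \<one>\<^bsub>R\<^esub> = \<zero>\<^bsub>R\<^esub>
      else 0)"

text \<open>
  \<open>f\<close> is the exponent function of the factorization of the ideal \<open>I\<close> into prime ideals of \<open>C\<close>;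
  product and powers are taken in the multiplicative monoid of ideals. For a nonzero ideal of a
  Dedekind domain there is exactly one such \<open>f\<close>.
\<close>

definition prime_ideal_factorization ::
  "('a, 'b) ring_scheme \<Rightarrow> 'a set \<Rightarrow> ('a set \<Rightarrow> nat) \<Rightarrow> bool" where
  "prime_ideal_factorization C I f \<longleftrightarrow>
     finite {P. f P \<noteq> 0} \<and>
     (\<forall>P. f P \<noteq> 0 \<longrightarrow> primeideal P C) \<and>
     I = (\<Otimes>\<^bsub>ideals_set C\<^esub>P \<in> {P. f P \<noteq> 0}. P [^]\<^bsub>ideals_set C\<^esub> f P)"

text \<open>\<open>ramification_index C \<rr> \<pp>\<close> is \<open>e(\<rr>/\<pp>)\<close>: the exponent of \<open>\<rr>\<close> in the factorization of
  the ideal of \<open>C\<close> generated by \<open>\<pp>\<close>.\<close>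

definition ramification_index :: "('a, 'b) ring_scheme \<Rightarrow> 'a set \<Rightarrow> 'a set \<Rightarrow> nat" where
  "ramification_index C \<rr> \<pp> =
     (THE e. \<exists>f. prime_ideal_factorization C (Idl\<^bsub>C\<^esub> \<pp>) f \<and> f \<rr> = e)"

end

theory Submission
  imports Defs "HOL-Algebra.Generated_Rings"
begin

text \<open>
  Ramification indices are read off valuations. Let \<open>w\<close> be the normalized valuation of \<open>L\<close> at
  \<open>\<qq>\<close> and \<open>\<pi>\<close> an element of \<open>\<pp>\<close> that generates the maximal ideal of the localization of \<open>A\<close> at
  \<open>\<pp>\<close>. For a field \<open>E\<close> between \<open>K\<close> and \<open>L\<close>, the exponent of \<open>\<qq> \<inter> E\<close> in the ideal
  generated by \<open>\<pp>\<close> is the value of \<open>\<pi>\<close> under the normalized valuation of \<open>E\<close> (theorem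
  \<open>ramification_index_eq\<close>), and \<open>w\<close> restricted to \<open>E\<close> is this valuation times the value under
  \<open>w\<close> of a uniformizer of \<open>E\<close> (\<open>restricted_valuation\<close>). With uniformizers \<open>\<rho>1\<close>, \<open>\<rho>2\<close> of
  \<open>K1\<close>, \<open>K2\<close> this gives \<open>e = w \<pi> = e1 * w \<rho>1 = e2 * w \<rho>2\<close>, and \<open>e = lcm e1 e2\<close> as soon as
  \<open>w \<rho>1\<close> and \<open>w \<rho>2\<close> are coprime. Since \<open>w\<close> takes the value \<open>1\<close>, it suffices that
  \<open>g = gcd (w \<rho>1) (w \<rho>2)\<close> divides all values of \<open>w\<close>: theorem \<open>value_group_compositum\<close>.

  Here tameness enters; say \<open>K2\<close> is tame. Over completions one would write \<open>L\<close> as an unramified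
  extension of \<open>K1\<close> followed by the adjunction of a tame root. The proof carries this out modulo
  \<open>w \<ge> N\<close> for a large \<open>N\<close>, inside \<open>L\<close> itself. As the residue field is perfect, every
  \<open>w\<close>-integral \<open>c\<close> is modulo the maximal ideal a simple root of a monic polynomial over \<open>A\<close>
  (\<open>simple_root_mod_maximal_ideal\<close>), and Newton's method moves \<open>c\<close> within \<open>K2\<close> to a root up to
  precision \<open>N\<close> (\<open>newton_approximation\<close>). Adjoining such roots to the valuation ring of \<open>K1\<close>
  yields rings \<open>S\<close> in which every element of positive value is, up to precision \<open>N\<close>, a multiple of
  \<open>\<rho>1\<close>; all values below \<open>N\<close> on \<open>S\<close> are then multiples of \<open>w \<rho>1\<close> (\<open>adjoin_simple_root\<close>,
  \<open>unramified_value\<close>). Because \<open>e2\<close> is a unit at \<open>\<qq>\<close>, there is a uniformizer \<open>\<theta>\<close> of \<open>K2\<close>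
  whose \<open>e2\<close>-th power is \<open>\<pi>\<close> times such a root (\<open>tame_uniformizer\<close>). With
  \<open>k = w \<rho>1 / g\<close>, the power \<open>\<theta>\<^sup>k\<close> is a power of \<open>\<rho>1\<close> times a unit, and this unit can also
  be adjoined to \<open>S\<close>. Every polynomial in \<open>\<theta>\<close> over \<open>S\<close> thus reduces to one of degree below \<open>k\<close>,
  whose terms have values that are distinct modulo \<open>w \<rho>1\<close>; its value is that of a single term
  and divisible by \<open>g\<close> (\<open>distinct_values\<close>, \<open>value_of_approximable\<close>). These polynomials
  approximate all of the ring generated by the valuation rings of \<open>K1\<close> and \<open>K2\<close>, whose fraction
  field is \<open>L\<close>.

  The valuations come from the following facts on an integral closure \<open>C\<close> of \<open>A\<close> in a field of
  degree at most \<open>n\<close> over \<open>K\<close>. Every element satisfies a polynomial equation over \<open>A\<close> with a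
  coefficient outside \<open>\<pp>\<close>; evaluating an initial part of this polynomial gives integral elements
  (\<open>integral_prefix\<close>), from which the local ring of \<open>C\<close> at a prime over \<open>\<pp>\<close> is seen to be a
  valuation ring. Two terms of the equation must have the same value, so that some power with exponent
  at most \<open>n\<close> of each element is a unit times an element of \<open>K\<close>; hence the value group is discrete
  (\<open>power_of_coefficient_times_unit\<close>, \<open>discrete_valuation\<close>). Powers of a prime \<open>P\<close> over \<open>\<pp>\<close>
  are cut out by the valuation at \<open>P\<close> (\<open>power_eq\<close>), there are finitely many such \<open>P\<close>
  (\<open>finite_over\<close>), and the product of the powers \<open>P ^ v\<^sub>P \<pi>\<close>, which is their
  intersection by comaximality, is the ideal generated by \<open>\<pp>\<close>.
\<close>

section \<open>Fields with an integer valuation\<close>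

context field
begin

lemma inv_nz [simp]:
  assumes "x \<in> carrier R" "x \<noteq> \<zero>"
  shows "inv x \<in> carrier R" "inv x \<noteq> \<zero>" "x \<otimes> inv x = \<one>" "inv x \<otimes> x = \<one>"
proof -
  have u: "x \<in> Units R" using assms field_Units by blast
  show "inv x \<in> carrier R" "x \<otimes> inv x = \<one>" "inv x \<otimes> x = \<one>" using u by auto
  show "inv x \<noteq> \<zero>" using Units_r_inv[OF u] assms by force
qed

lemma mult_nz [simp]: "x \<in> carrier R \<Longrightarrow> y \<in> carrier R \<Longrightarrow> x \<otimes> y = \<zero> \<longleftrightarrow> x = \<zero> \<or> y = \<zero>"
  using integral_iff by blast

lemma pow_nz [simp]: "x \<in> carrier R \<Longrightarrow> x \<noteq> \<zero> \<Longrightarrow> x [^] (n::nat) \<noteq> \<zero>"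
  by (induct n) auto

lemma mult_inv_cancel [simp]:
  assumes "x \<in> carrier R" "y \<in> carrier R" "y \<noteq> \<zero>"
  shows "x \<otimes> inv y \<otimes> y = x" "x \<otimes> y \<otimes> inv y = x" "y \<otimes> (inv y \<otimes> x) = x" "inv y \<otimes> (y \<otimes> x) = x"
    "y \<otimes> (x \<otimes> inv y) = x"
proof -
  note i = inv_nz[OF assms(2,3)]
  show "x \<otimes> inv y \<otimes> y = x" "x \<otimes> y \<otimes> inv y = x"
    using assms i by (simp_all add: m_assoc)
  show "y \<otimes> (inv y \<otimes> x) = x" "inv y \<otimes> (y \<otimes> x) = x"
    using assms i by (simp_all add: m_assoc[symmetric])
  show "y \<otimes> (x \<otimes> inv y) = x"
    using assms i by (simp add: m_lcomm)
qed

lemma inv_mult: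
  assumes "x \<in> carrier R" "y \<in> carrier R" "x \<noteq> \<zero>" "y \<noteq> \<zero>"
  shows "inv (x \<otimes> y) = inv x \<otimes> inv y"
proof (rule comm_inv_char)
  note i = inv_nz[OF assms(1,3)] inv_nz[OF assms(2,4)]
  show "x \<otimes> y \<otimes> (inv x \<otimes> inv y) = \<one>"
    using assms i by (simp add: m_ac(2) m_lcomm[of y "inv x"] m_assoc)
qed (use assms in auto)

lemma inv_inv_nz [simp]: "x \<in> carrier R \<Longrightarrow> x \<noteq> \<zero> \<Longrightarrow> inv (inv x) = x"
  using field_Units Units_inv_inv by blast

end

text \<open>
  The value of zero is arbitrary, and the value group may be any subgroup of the integers: a valuation
  of \<open>L\<close> is also used, without rescaling, on subfields.
\<close>

locale valued_field = field R for R (structure) +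
  fixes v :: "'a \<Rightarrow> int"
  assumes v_mult: "\<lbrakk>x \<in> carrier R; y \<in> carrier R; x \<noteq> \<zero>; y \<noteq> \<zero>\<rbrakk> \<Longrightarrow> v (x \<otimes> y) = v x + v y"
    and v_add: "\<lbrakk>x \<in> carrier R; y \<in> carrier R; x \<noteq> \<zero>; y \<noteq> \<zero>; x \<oplus> y \<noteq> \<zero>\<rbrakk> \<Longrightarrow> min (v x) (v y) \<le> v (x \<oplus> y)"
begin

text \<open>
  The fractional ideals of a valuation. \<open>B 0\<close> is the valuation ring, \<open>B 1\<close> its maximal
  ideal, and \<open>x \<ominus> y \<in> B n\<close> says that \<open>x\<close> and \<open>y\<close> agree up to precision \<open>n\<close>.
\<close>

definition B :: "int \<Rightarrow> 'a set" where
  "B n = {x \<in> carrier R. x = \<zero> \<or> n \<le> v x}"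

lemma v_one [simp]: "v \<one> = 0"
  using v_mult[of \<one> \<one>] by simp

lemma v_minus_one [simp]: "v (\<ominus> \<one>) = 0"
proof -
  have "\<ominus> \<one> \<otimes> \<ominus> \<one> = \<one>" by algebra
  moreover have "\<ominus> \<one> \<noteq> \<zero>" by simp
  ultimately show ?thesis using v_mult[of "\<ominus> \<one>" "\<ominus> \<one>"] by simp
qed

lemma v_uminus [simp]: "x \<in> carrier R \<Longrightarrow> v (\<ominus> x) = v x"
proof (cases "x = \<zero>")
  case False
  assume x: "x \<in> carrier R"
  have "\<ominus> x = \<ominus> \<one> \<otimes> x" using x by algebra
  moreover have "\<ominus> \<one> \<noteq> \<zero>" by simp
  ultimately show ?thesis using v_mult[of "\<ominus> \<one>" x] False x by simp
qed simp

lemma v_inv [simp]: "x \<in> carrier R \<Longrightarrow> x \<noteq> \<zero> \<Longrightarrow> v (inv x) = - v x"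
  using v_mult[of x "inv x"] by auto

lemma v_pow [simp]: "x \<in> carrier R \<Longrightarrow> x \<noteq> \<zero> \<Longrightarrow> v (x [^] (n::nat)) = int n * v x"
  by (induct n) (simp_all add: v_mult distrib_right)

lemma B_carrier: "B n \<subseteq> carrier R" unfolding B_def by auto
lemma B_carr [dest]: "x \<in> B n \<Longrightarrow> x \<in> carrier R" unfolding B_def by auto
lemma B_zero [simp, intro]: "\<zero> \<in> B n" unfolding B_def by auto
lemma B_one [simp, intro]: "\<one> \<in> B 0" unfolding B_def by auto
lemma B_one_notin [simp]: "\<one> \<notin> B 1" unfolding B_def by auto

lemma B_mono: "m \<le> n \<Longrightarrow> x \<in> B n \<Longrightarrow> x \<in> B m"
  unfolding B_def by auto

lemma B_add [intro]: "x \<in> B n \<Longrightarrow> y \<in> B n \<Longrightarrow> x \<oplus> y \<in> B n"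
  using v_add[of x y] unfolding B_def
  by (cases "x = \<zero>"; cases "y = \<zero>"; cases "x \<oplus> y = \<zero>") (simp_all add: min_le_iff_disj, linarith)

lemma B_uminus [intro]: "x \<in> B n \<Longrightarrow> \<ominus> x \<in> B n"
  unfolding B_def by auto

lemma B_minus [intro]: "x \<in> B n \<Longrightarrow> y \<in> B n \<Longrightarrow> x \<ominus> y \<in> B n"
  unfolding a_minus_def by auto

lemma B_mult: "x \<in> B m \<Longrightarrow> y \<in> B n \<Longrightarrow> x \<otimes> y \<in> B (m + n)"
  using v_mult[of x y] unfolding B_def
  by (cases "x = \<zero>"; cases "y = \<zero>") simp_all

lemma B_mult0 [intro]: "x \<in> B 0 \<Longrightarrow> y \<in> B n \<Longrightarrow> x \<otimes> y \<in> B n"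
  "x \<in> B n \<Longrightarrow> y \<in> B 0 \<Longrightarrow> x \<otimes> y \<in> B n"
  using B_mult[of x 0 y n] B_mult[of x n y 0] by auto

lemma B_iff: "x \<in> carrier R \<Longrightarrow> x \<noteq> \<zero> \<Longrightarrow> x \<in> B n \<longleftrightarrow> n \<le> v x"
  unfolding B_def by auto

lemma notin_B: "x \<in> carrier R \<Longrightarrow> x \<notin> B n \<longleftrightarrow> x \<noteq> \<zero> \<and> v x < n"
  unfolding B_def by auto

lemma B_pow [intro]: "x \<in> B 0 \<Longrightarrow> x [^] (n::nat) \<in> B 0"
  by (induct n) auto

lemma B_subring: "subring (B 0) R"
  by (rule subringI) (auto simp: B_carrier)

lemma v_unit_iff: "x \<in> B 0 \<Longrightarrow> x \<notin> B 1 \<longleftrightarrow> x \<noteq> \<zero> \<and> v x = 0"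
  unfolding B_def by auto

lemma unit_inv: assumes "x \<in> B 0" "x \<notin> B 1" shows "inv x \<in> B 0" "inv x \<notin> B 1" "x \<noteq> \<zero>" "v x = 0"
proof -
  show *: "x \<noteq> \<zero>" "v x = 0" using assms v_unit_iff by auto
  show "inv x \<in> B 0" "inv x \<notin> B 1" using * assms B_iff[of "inv x"] by auto
qed

lemma unit_mult: "x \<in> B 0 \<Longrightarrow> x \<notin> B 1 \<Longrightarrow> y \<in> B 0 \<Longrightarrow> y \<notin> B 1 \<Longrightarrow> x \<otimes> y \<notin> B 1"
  using v_unit_iff[of x] v_unit_iff[of y] B_carr[of x 0] B_carr[of y 0] by (simp add: notin_B v_mult)

lemma B_add_cancel: "y \<in> B n \<Longrightarrow> x \<in> carrier R \<Longrightarrow> x \<oplus> y \<in> B n \<longleftrightarrow> x \<in> B n"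
proof
  assume y: "y \<in> B n" and x: "x \<in> carrier R" and "x \<oplus> y \<in> B n"
  hence "x \<oplus> y \<ominus> y \<in> B n" by blast
  moreover have "x \<oplus> y \<ominus> y = x" using x y B_carr[OF y] by algebra
  ultimately show "x \<in> B n" by simp
qed auto

lemma B_minus_cancel: "x \<ominus> y \<in> B n \<Longrightarrow> x \<in> carrier R \<Longrightarrow> y \<in> carrier R \<Longrightarrow> x \<in> B n \<longleftrightarrow> y \<in> B n"
proof -
  assume "x \<ominus> y \<in> B n" and x: "x \<in> carrier R" and y: "y \<in> carrier R"
  moreover have "x = y \<oplus> (x \<ominus> y)" using x y by algebra
  ultimately show ?thesis using B_add_cancel[of "x \<ominus> y" n y] by simp
qed

lemma B_minus_sym:
  assumes "x \<ominus> y \<in> B n" "x \<in> carrier R" "y \<in> carrier R"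
  shows "y \<ominus> x \<in> B n"
proof -
  have "y \<ominus> x = \<ominus> (x \<ominus> y)" using assms(2-3) by algebra
  thus ?thesis using assms by auto
qed

lemma v_add_eq:
  assumes "x \<in> carrier R" "x \<noteq> \<zero>" "y \<in> B n" "v x < n"
  shows "x \<oplus> y \<noteq> \<zero>" "v (x \<oplus> y) = v x"
proof -
  have x1: "x \<notin> B (v x + 1)" "x \<in> B (v x)" using assms B_iff by auto
  have y: "y \<in> B (v x + 1)" using assms B_mono[of "v x + 1" n y] by auto
  have "x \<oplus> y \<notin> B (v x + 1)" using B_add_cancel[OF y assms(1)] x1 by simp
  moreover have "x \<oplus> y \<in> B (v x)" using x1(2) y B_mono[of "v x" "v x + 1" y] by auto
  ultimately show "x \<oplus> y \<noteq> \<zero>" "v (x \<oplus> y) = v x"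
    using notin_B[of "x \<oplus> y"] B_iff[of "x \<oplus> y" "v x"] assms(1) y by auto
qed

text \<open>
  This is how approximations are used: an element whose value is below the precision has the same value
  as everything that agrees with it.
\<close>

lemma v_cong:
  assumes "x \<in> carrier R" "y \<in> carrier R" "y \<ominus> x \<in> B n" "x \<notin> B n"
  shows "y \<noteq> \<zero>" "v y = v x" "x \<noteq> \<zero>" "y \<notin> B n"
proof -
  have e: "y = x \<oplus> (y \<ominus> x)" using assms(1-2) by algebra
  have x: "x \<noteq> \<zero>" "v x < n" using assms notin_B by auto
  show "y \<noteq> \<zero>" "v y = v x" using v_add_eq[OF assms(1) x(1) assms(3) x(2)] e by auto
  thus "x \<noteq> \<zero>" "y \<notin> B n" using x assms(2) notin_B by auto
qed

end

section \<open>Polynomials as coefficient lists: derivatives and division\<close>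

context ring begin

lemma combine_smult:
  assumes "set as \<subseteq> carrier R" "set us \<subseteq> carrier R" "c \<in> carrier R"
  shows "combine (map (\<lambda>a. c \<otimes> a) as) us = c \<otimes> combine as us"
  using assms(1,2)
proof (induct as us rule: combine.induct)
  case (1 a as u us)
  have "combine as us \<in> carrier R" using 1 by (intro combine_in_carrier) auto
  thus ?case using 1 assms(3) by (simp add: r_distr m_assoc)
qed (use assms(3) in auto)

lemma add_pow_in_subring:
  assumes "subring S R" "a \<in> S" shows "[(n::nat)] \<cdot> a \<in> S"
  using assms by (induct n) (auto simp: subringE)

text \<open>
  Unlike the derivative of polynomials in normal form, this keeps leading zeros. It is therefore compatible
  with ring homomorphisms, and its length is known in every characteristic.
\<close>

primrec deriv_list :: "'a list \<Rightarrow> 'a list" where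
  "deriv_list [] = []"
| "deriv_list (a # p) = (if p = [] then [] else [length p] \<cdot> a # deriv_list p)"

lemma length_deriv_list [simp]: "length (deriv_list p) = length p - 1"
  by (induct p) (auto simp: Suc_diff_Suc)

lemma set_deriv_list: "subring S R \<Longrightarrow> set p \<subseteq> S \<Longrightarrow> set (deriv_list p) \<subseteq> S"
  by (induct p) (auto simp: add_pow_in_subring)

lemma eval_in_subring:
  assumes "subring S R" "set p \<subseteq> S" "x \<in> S" shows "eval p x \<in> S"
  using assms(2)
proof (induct p)
  case (Cons a p)
  have "x [^] n \<in> S" for n :: nat using assms(3) by (induct n) (auto simp: subringE[OF assms(1)])
  thus ?case using Cons by (simp add: subringE[OF assms(1)])
qed (use subringE[OF assms(1)] in auto)

end

context cring begin

lemma eval_deriv_append: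
  assumes "set p \<subseteq> carrier R" "c \<in> carrier R" "x \<in> carrier R"
  shows "eval (deriv_list (p @ [c])) x = eval (deriv_list p) x \<otimes> x \<oplus> eval p x"
  using assms(1)
proof (induct p)
  case Nil thus ?case using assms by simp
next
  case (Cons a q)
  hence q: "set q \<subseteq> carrier R" and a: "a \<in> carrier R" by auto
  have dq: "set (deriv_list q) \<subseteq> carrier R" using set_deriv_list[OF carrier_is_subring q] .
  have [simp]: "eval q x \<in> carrier R" "eval (deriv_list q) x \<in> carrier R"
    using eval_in_carrier q dq assms(3) by auto
  show ?case
  proof (cases "q = []")
    case True thus ?thesis using a assms by simp
  next
    case False
    then obtain n where n: "length q = Suc n" by (cases q) auto
    have "a \<otimes> (x [^] n \<otimes> x) \<in> carrier R" "[n] \<cdot> (a \<otimes> (x [^] n \<otimes> x)) \<in> carrier R" using a assms by auto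
    thus ?thesis using Cons(1)[OF q] False a assms(3) n
      by (simp add: l_distr add_pow_ldistr m_assoc) (simp add: a_ac)
  qed
qed

text \<open>
  Taylor expansion to second order, by induction on Horner's scheme, with a remainder that stays in the
  subring containing the coefficients and both points.
\<close>

lemma eval_taylor:
  assumes "subring S R" "set p \<subseteq> S" "x \<in> S" "y \<in> S"
  shows "\<exists>w\<in>S. eval p (x \<oplus> y) = eval p x \<oplus> y \<otimes> eval (deriv_list p) x \<oplus> y \<otimes> y \<otimes> w"
  using assms(2)
proof (induct p rule: rev_induct)
  case Nil thus ?case using assms subringE[OF assms(1)] by (intro bexI[of _ \<zero>]) auto
next
  case (snoc c p)
  note S = subringE[OF assms(1)]
  then obtain w where w: "w \<in> S" "eval p (x \<oplus> y) = eval p x \<oplus> y \<otimes> eval (deriv_list p) x \<oplus> y \<otimes> y \<otimes> w"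
    using snoc by auto
  let ?D = "eval (deriv_list p) x"
  have D: "?D \<in> S" "eval p x \<in> S"
    using eval_in_subring[OF assms(1) _ assms(3)] set_deriv_list[OF assms(1)] snoc(2) by auto
  have c: "c \<in> S" using snoc by auto
  have car: "x \<in> carrier R" "y \<in> carrier R" "w \<in> carrier R" "c \<in> carrier R" "?D \<in> carrier R"
    "eval p x \<in> carrier R" "set p \<subseteq> carrier R"
    using S(1) assms D w c snoc(2) by auto
  show ?case
  proof
    show "?D \<oplus> w \<otimes> (x \<oplus> y) \<in> S" using D w assms S by auto
    show "eval (p @ [c]) (x \<oplus> y) = eval (p @ [c]) x \<oplus> y \<otimes> eval (deriv_list (p @ [c])) x
       \<oplus> y \<otimes> y \<otimes> (?D \<oplus> w \<otimes> (x \<oplus> y))"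
      using car by (simp add: eval_append_aux eval_deriv_append w(2)) algebra
  qed
qed

lemma eval_map2_minus:
  assumes "length p = length q" "set p \<subseteq> carrier R" "set q \<subseteq> carrier R" "e \<in> carrier R" "x \<in> carrier R"
  shows "eval (map2 (\<lambda>a b. a \<ominus> e \<otimes> b) p q) x = eval p x \<ominus> e \<otimes> eval q x"
  using assms(1-3)
proof (induct p q rule: list_induct2)
  case Nil thus ?case using assms by simp algebra
next
  case (Cons a p b q)
  hence "eval p x \<in> carrier R" "eval q x \<in> carrier R" "a \<in> carrier R" "b \<in> carrier R"
    using eval_in_carrier assms by auto
  moreover have x: "x [^] length q \<in> carrier R" using assms by simp
  ultimately show ?case using Cons assms(4,5) by simp (use x in algebra)
qed

lemma eval_smult:
  assumes "set p \<subseteq> carrier R" "b \<in> carrier R" "x \<in> carrier R"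
  shows "eval (map (\<lambda>a. b \<otimes> a) p) x = b \<otimes> eval p x"
  using assms(1)
proof (induct p)
  case (Cons a p)
  hence "eval p x \<in> carrier R" "a \<in> carrier R" using eval_in_carrier assms by auto
  moreover have x: "x [^] length p \<in> carrier R" using assms by simp
  ultimately show ?case using Cons assms(2,3) by simp (use x in algebra)
qed (use assms in auto)

text \<open>
  Division by a monic polynomial stays inside the coefficient ring. The statement speaks of values
  instead of coefficients, and \<open>E\<close> may have leading zeros: only the bound on its length matters.
\<close>

lemma monic_division:
  assumes S: "subring S R" and hs: "set hs \<subseteq> S" and "set P \<subseteq> S"
  shows "\<exists>Q E. set Q \<subseteq> S \<and> set E \<subseteq> S \<and> length E \<le> length hs \<and>
    (\<forall>x\<in>carrier R. eval P x = eval Q x \<otimes> eval (\<one> # hs) x \<oplus> eval E x)"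
  using assms(3)
proof (induct P rule: rev_induct)
  case Nil
  have "\<forall>x\<in>carrier R. eval [] x = eval [] x \<otimes> eval (\<one> # hs) x \<oplus> eval [] x"
    using eval_in_carrier[of hs] hs subringE(1)[OF S] by auto
  thus ?case by (intro exI[of _ "[]"] conjI) auto
next
  case (snoc c P)
  note S' = subringE[OF S]
  obtain Q E where QE: "set Q \<subseteq> S" "set E \<subseteq> S" "length E \<le> length hs"
    "\<And>x. x \<in> carrier R \<Longrightarrow> eval P x = eval Q x \<otimes> eval (\<one> # hs) x \<oplus> eval E x"
    using snoc by auto
  have sets: "set Q \<subseteq> carrier R" "set E \<subseteq> carrier R" "set P \<subseteq> carrier R" "set hs \<subseteq> carrier R" "c \<in> carrier R" "c \<in> S"
    using QE snoc S' hs by auto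
  have ec: "x \<in> carrier R \<Longrightarrow> eval Q x \<in> carrier R" "x \<in> carrier R \<Longrightarrow> eval E x \<in> carrier R"
    "x \<in> carrier R \<Longrightarrow> eval hs x \<in> carrier R" for x
    using eval_in_carrier sets by auto
  show ?case
  proof (cases "length (E @ [c]) \<le> length hs")
    case True
    have "\<forall>x\<in>carrier R. eval (P @ [c]) x = eval (Q @ [\<zero>]) x \<otimes> eval (\<one> # hs) x \<oplus> eval (E @ [c]) x"
    proof
      fix x assume x: "x \<in> carrier R"
      have p: "x [^] length hs \<in> carrier R" using x by simp
      thus "eval (P @ [c]) x = eval (Q @ [\<zero>]) x \<otimes> eval (\<one> # hs) x \<oplus> eval (E @ [c]) x"
        using x sets ec[OF x] QE(4)[OF x] by (simp add: eval_append_aux) (use p in algebra)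
    qed
    thus ?thesis using True QE sets S' by (intro exI[of _ "Q @ [\<zero>]"] exI[of _ "E @ [c]"]) auto
  next
    case False
    then have len: "length (E @ [c]) = Suc (length hs)" using QE(3) by simp
    then obtain e E' where E': "E @ [c] = e # E'" by (cases "E @ [c]") auto
    have len': "length E' = length hs" using len E' by simp
    have "set (e # E') \<subseteq> S" unfolding E'[symmetric] using QE sets by auto
    hence eE: "e \<in> S" "set E' \<subseteq> S" by auto
    hence eE': "e \<in> carrier R" "set E' \<subseteq> carrier R" using S' by auto
    let ?E = "map2 (\<lambda>a b. a \<ominus> e \<otimes> b) E' hs"
    have "\<forall>x\<in>carrier R. eval (P @ [c]) x = eval (Q @ [e]) x \<otimes> eval (\<one> # hs) x \<oplus> eval ?E x"
    proof
      fix x assume x: "x \<in> carrier R"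
      have p: "x [^] length hs \<in> carrier R" using x by simp
      have E'c: "eval E' x \<in> carrier R" using eval_in_carrier eE' x by auto
      have 1: "eval E x \<otimes> x \<oplus> c = e \<otimes> x [^] length hs \<oplus> eval E' x"
        using eval_append_aux[of E c x] E' len' x sets by simp
      have "eval (P @ [c]) x = eval Q x \<otimes> x \<otimes> eval (\<one> # hs) x \<oplus> (eval E x \<otimes> x \<oplus> c)"
        using x sets ec[OF x] p QE(4)[OF x] by (simp add: eval_append_aux) (use p in algebra)
      also have "\<dots> = eval (Q @ [e]) x \<otimes> eval (\<one> # hs) x \<oplus> eval ?E x"
        unfolding 1 using x sets ec[OF x] p eE' E'c
        by (simp add: eval_append_aux eval_map2_minus[OF len'] del: map2_map_map) (use p in algebra)
      finally show "eval (P @ [c]) x = eval (Q @ [e]) x \<otimes> eval (\<one> # hs) x \<oplus> eval ?E x" .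
    qed
    moreover have "set ?E \<subseteq> S"
    proof
      fix z assume "z \<in> set ?E"
      then obtain a b where "(a, b) \<in> set (zip E' hs)" "z = a \<ominus> e \<otimes> b" by auto
      moreover then have "a \<in> S" "b \<in> S" using eE hs by (auto dest: set_zip_leftD set_zip_rightD)
      ultimately show "z \<in> S" using eE S' by (simp add: a_minus_def)
    qed
    ultimately show ?thesis using QE eE len' by (intro exI[of _ "Q @ [e]"] exI[of _ ?E]) auto
  qed
qed

end

section \<open>Unramified subrings up to a finite precision\<close>

context valued_field begin

text \<open>
  The localization of \<open>T\<close> at the elements of value zero, as a subring of the ambient field.
\<close>

definition localised :: "'a set \<Rightarrow> 'a set" where
  "localised T = {a \<otimes> inv b | a b. a \<in> T \<and> b \<in> T \<and> b \<notin> B 1}"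

lemma localisedI: "a \<in> T \<Longrightarrow> b \<in> T \<Longrightarrow> b \<notin> B 1 \<Longrightarrow> a \<otimes> inv b \<in> localised T"
  unfolding localised_def by blast

lemma localisedE:
  assumes "x \<in> localised T" "T \<subseteq> B 0"
  obtains a b where "x = a \<otimes> inv b" "a \<in> T" "b \<in> T" "b \<notin> B 1" "a \<in> B 0" "b \<in> B 0"
    "a \<in> carrier R" "b \<in> carrier R" "b \<noteq> \<zero>" "inv b \<in> B 0" "inv b \<in> carrier R" "inv b \<notin> B 1"
proof -
  obtain a b where "x = a \<otimes> inv b" "a \<in> T" "b \<in> T" "b \<notin> B 1" using assms(1) unfolding localised_def by blast
  moreover then have "a \<in> B 0" "b \<in> B 0" using assms(2) by auto
  ultimately show thesis using that unit_inv[of b] B_carr by auto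
qed

context
  fixes T assumes T: "subring T R" "T \<subseteq> B 0"
begin

lemma localised_incl: "T \<subseteq> localised T"
proof
  fix a assume a: "a \<in> T"
  have "a \<otimes> inv \<one> \<in> localised T" using localisedI[OF a subringE(3)[OF T(1)]] by simp
  thus "a \<in> localised T" using a subringE(1)[OF T(1)] by auto
qed

lemma localised_subset: "localised T \<subseteq> B 0"
  by (auto elim!: localisedE[OF _ T(2)])

lemma localised_inv:
  assumes "x \<in> localised T" "x \<notin> B 1" shows "inv x \<in> localised T"
proof -
  obtain a b where x: "x = a \<otimes> inv b" "a \<in> T" "b \<in> T" "b \<notin> B 1" "a \<in> B 0" "b \<in> B 0"
    "a \<in> carrier R" "b \<in> carrier R" "b \<noteq> \<zero>" "inv b \<in> B 0" "inv b \<in> carrier R"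
    by (rule localisedE[OF assms(1) T(2)])
  have a: "a \<notin> B 1" using x assms(2) by auto
  hence "a \<noteq> \<zero>" by auto
  hence "inv x = b \<otimes> inv a" using x inv_mult[of a "inv b"] m_comm by simp
  thus ?thesis using a x localisedI by simp
qed

lemma localised_subring: "subring (localised T) R"
proof (rule subringI)
  note S = subringE[OF T(1)]
  show "localised T \<subseteq> carrier R" using localised_subset B_carrier by blast
  show "\<one> \<in> localised T" using localised_incl S by auto
  fix x assume "x \<in> localised T"
  then obtain a b where x: "x = a \<otimes> inv b" "a \<in> T" "b \<in> T" "b \<notin> B 1" "a \<in> B 0" "b \<in> B 0"
    "a \<in> carrier R" "b \<in> carrier R" "b \<noteq> \<zero>" "inv b \<in> B 0" "inv b \<in> carrier R"
    by (rule localisedE[OF _ T(2)])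
  have "\<ominus> x = (\<ominus> a) \<otimes> inv b" using x by (simp add: l_minus)
  thus "\<ominus> x \<in> localised T" using localisedI[of "\<ominus> a" T b] x S by simp
  fix y assume "y \<in> localised T"
  then obtain c d where y: "y = c \<otimes> inv d" "c \<in> T" "d \<in> T" "d \<notin> B 1" "c \<in> B 0" "d \<in> B 0"
    "c \<in> carrier R" "d \<in> carrier R" "d \<noteq> \<zero>" "inv d \<in> B 0" "inv d \<in> carrier R"
    by (rule localisedE[OF _ T(2)])
  have bd: "b \<otimes> d \<in> T" "b \<otimes> d \<notin> B 1" "inv (b \<otimes> d) = inv b \<otimes> inv d"
    using x y S unit_mult inv_mult by auto
  have xy: "x \<otimes> y = (a \<otimes> c) \<otimes> inv (b \<otimes> d)"
    unfolding bd using x y by (simp add: m_ac)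
  show "x \<otimes> y \<in> localised T" unfolding xy using bd(1,2) x(2) y(2) S by (intro localisedI) auto
  have "(a \<otimes> d \<oplus> c \<otimes> b) \<otimes> (inv b \<otimes> inv d) = a \<otimes> inv b \<otimes> (d \<otimes> inv d) \<oplus> c \<otimes> inv d \<otimes> (b \<otimes> inv b)"
    using x(7,8,11) y(7,8,11) by algebra
  hence xy: "x \<oplus> y = (a \<otimes> d \<oplus> c \<otimes> b) \<otimes> inv (b \<otimes> d)"
    unfolding bd using x y by simp
  show "x \<oplus> y \<in> localised T" unfolding xy using bd(1,2) x(2,3) y(2,3) S by (intro localisedI) auto
qed

end

text \<open>
  A local ring whose maximal ideal is generated by \<open>\<pi>\<close> up to precision \<open>N\<close>. In place of an
  unramified extension of complete rings, only this finite part of the information is kept.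
\<close>

definition unramified_upto :: "'a \<Rightarrow> int \<Rightarrow> 'a set \<Rightarrow> bool" where
  "unramified_upto \<pi> N S \<longleftrightarrow> subring S R \<and> S \<subseteq> B 0 \<and> (\<forall>x\<in>S. x \<notin> B 1 \<longrightarrow> inv x \<in> S) \<and>
     (\<forall>x\<in>S \<inter> B 1. \<exists>x'\<in>S. x \<ominus> \<pi> \<otimes> x' \<in> B N)"

text \<open>
  Let \<open>n\<close> be at most the degree of \<open>z\<close> over the residue field of \<open>S\<close>. A relation with at most \<open>n\<close>
  coefficients that holds modulo the maximal ideal is trivial there: a leading coefficient outside the maximal ideal
  could be made \<open>1\<close>, which would give a monic relation of smaller degree.
\<close>

lemma coeffs_in_max_ideal:
  assumes S: "subring S R" "S \<subseteq> B 0"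
    and res: "\<And>a. a \<in> S \<Longrightarrow> a \<notin> B 1 \<Longrightarrow> \<exists>b\<in>S. b \<otimes> a \<ominus> \<one> \<in> B 1"
    and z: "z \<in> B 0"
    and min: "\<And>hs. set hs \<subseteq> S \<Longrightarrow> eval (\<one> # hs) z \<in> B 1 \<Longrightarrow> n \<le> length hs"
    and "set E \<subseteq> S" "length E \<le> n" "eval E z \<in> B 1"
  shows "set E \<subseteq> B 1"
  using assms(6-8)
proof (induct E)
  case (Cons c E)
  have zc: "z \<in> carrier R" using z by auto
  have c: "c \<in> S" "set E \<subseteq> S" using Cons by auto
  have car: "c \<in> carrier R" "eval E z \<in> carrier R" "z [^] length E \<in> carrier R" "set E \<subseteq> carrier R"
    using subringE(1)[OF S(1)] c zc eval_in_carrier[of E z] by auto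
  have ev: "eval (c # E) z = c \<otimes> z [^] length E \<oplus> eval E z" by simp
  have "c \<in> B 1"
  proof (rule ccontr)
    assume "c \<notin> B 1"
    then obtain b where b: "b \<in> S" "b \<otimes> c \<ominus> \<one> \<in> B 1" using res c by auto
    have bc: "b \<in> carrier R" "b \<in> B 0" using b S subringE(1) by auto
    let ?hs = "map (\<lambda>a. b \<otimes> a) E"
    have "set ?hs \<subseteq> S" using b c subringE[OF S(1)] by auto
    moreover have "eval (\<one> # ?hs) z = b \<otimes> eval (c # E) z \<ominus> (b \<otimes> c \<ominus> \<one>) \<otimes> z [^] length E"
      unfolding ev using car bc zc by (simp add: eval_smult) (use car(3) in algebra)
    moreover have "\<dots> \<in> B 1"
      using b bc z Cons(4) by blast
    ultimately have "n \<le> length E" using min[of ?hs] by simp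
    thus False using Cons by simp
  qed
  moreover have "eval E z = eval (c # E) z \<ominus> c \<otimes> z [^] length E"
    unfolding ev using car by algebra
  hence "eval E z \<in> B 1" using \<open>c \<in> B 1\<close> z Cons(4) by (metis B_minus B_mult0(2) B_pow)
  ultimately show ?case using Cons c by auto
qed simp

lemma eval_small_coeffs:
  assumes T: "subring T R" "T \<subseteq> B 0" "z \<in> T" "\<pi> \<in> carrier R"
    and "\<And>a. a \<in> set E \<Longrightarrow> \<exists>a'\<in>T. a \<ominus> \<pi> \<otimes> a' \<in> B N" "set E \<subseteq> carrier R"
  shows "\<exists>w\<in>T. eval E z \<ominus> \<pi> \<otimes> w \<in> B N"
  using assms(5-6)
proof (induct E)
  case Nil thus ?case using assms subringE[OF T(1)] by (intro bexI[of _ \<zero>]) (auto simp: a_minus_def)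
next
  case (Cons a E)
  obtain w where w: "w \<in> T" "eval E z \<ominus> \<pi> \<otimes> w \<in> B N" using Cons by auto
  obtain a' where a': "a' \<in> T" "a \<ominus> \<pi> \<otimes> a' \<in> B N" using Cons by auto
  have z: "z \<in> B 0" "z \<in> carrier R" using T by auto
  have zp: "z [^] n \<in> T" for n :: nat using T by (induct n) (auto simp: subringE[OF T(1)])
  have car: "w \<in> carrier R" "a' \<in> carrier R" "a \<in> carrier R" "eval E z \<in> carrier R" "z [^] length E \<in> carrier R"
    using w a' subringE(1)[OF T(1)] Cons(3) eval_in_carrier z by auto
  have "eval (a # E) z \<ominus> \<pi> \<otimes> (a' \<otimes> z [^] length E \<oplus> w)
      = (a \<ominus> \<pi> \<otimes> a') \<otimes> z [^] length E \<oplus> (eval E z \<ominus> \<pi> \<otimes> w)"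
    using car T(4) by simp (use car(5) in algebra)
  moreover have "\<dots> \<in> B N" using a' w z by blast
  ultimately show ?case using w a' zp subringE[OF T(1)] by (intro bexI[of _ "a' \<otimes> z [^] length E \<oplus> w"]) auto
qed

lemma eval_cong:
  assumes "set p \<subseteq> B 0" "x \<in> B 0" "y \<in> B n" "0 \<le> n"
  shows "eval p (x \<oplus> y) \<ominus> eval p x \<in> B n"
proof -
  have y: "y \<in> B 0" using assms B_mono by blast
  obtain w where w: "w \<in> B 0" "eval p (x \<oplus> y) = eval p x \<oplus> y \<otimes> eval (deriv_list p) x \<oplus> y \<otimes> y \<otimes> w"
    using eval_taylor[OF B_subring assms(1,2) y] by auto
  have D: "eval (deriv_list p) x \<in> B 0" "eval p x \<in> B 0"
    using eval_in_subring[OF B_subring _ assms(2)] set_deriv_list[OF B_subring] assms by auto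
  have car: "x \<in> carrier R" "y \<in> carrier R" "w \<in> carrier R" "eval p x \<in> carrier R" "eval (deriv_list p) x \<in> carrier R"
    using w D y assms by auto
  have "eval p (x \<oplus> y) \<ominus> eval p x = y \<otimes> (eval (deriv_list p) x \<oplus> y \<otimes> w)"
    unfolding w using car by algebra
  moreover have "\<dots> \<in> B n" using D w y assms by (intro B_mult0) auto
  ultimately show ?thesis by simp
qed

text \<open>
  If both factors vanished at \<open>z\<close> modulo the maximal ideal, their product would vanish to second order
  there, so that \<open>z\<close> would not be a simple root of \<open>F\<close>. The element \<open>t\<close> of value one serves as
  the increment: \<open>F\<close> is expanded at \<open>z\<close> and evaluated at \<open>z \<oplus> t\<close>, modulo \<open>B 2\<close>.
\<close>

lemma cofactor_unit:
  assumes t: "t \<in> carrier R" "t \<noteq> \<zero>" "v t = 1"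
    and sets: "set F \<subseteq> B 0" "set g \<subseteq> B 0" "set h \<subseteq> B 0" "set E \<subseteq> B 1"
    and z: "z \<in> B 0"
    and eq: "\<And>x. x \<in> carrier R \<Longrightarrow> eval F x = eval g x \<otimes> eval h x \<oplus> eval E x"
    and D: "eval (deriv_list F) z \<notin> B 1" and h: "eval h z \<in> B 1"
  shows "eval g z \<notin> B 1"
proof
  assume g: "eval g z \<in> B 1"
  have tB: "t \<in> B 1" "t \<in> B 0" using t B_iff by auto
  have zt: "z \<oplus> t \<in> B 0" using tB z by auto
  have E0: "set E \<subseteq> B 0" using sets(4) B_mono[of 0 1] by auto
  have e0: "eval p x \<in> B 0" if "set p \<subseteq> B 0" "x \<in> B 0" for p x
    using that eval_in_subring[OF B_subring] by auto
  have c: "eval p (z \<oplus> t) \<in> B 1" if "set p \<subseteq> B 0" "eval p z \<in> B 1" for p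
    using eval_cong[OF that(1) z tB(1)] that e0[OF that(1)] z zt B_minus_cancel[of "eval p (z \<oplus> t)" "eval p z" 1] by auto
  have small: "eval p x \<in> B 1" if "set p \<subseteq> B 1" "x \<in> B 0" for p x
    using that(1)
  proof (induct p)
    case (Cons a p)
    thus ?case using that(2) by (auto intro!: B_add B_mult0)
  qed simp
  have smalld: "set p \<subseteq> B 1 \<Longrightarrow> set (deriv_list p) \<subseteq> B 1" for p
  proof (induct p)
    case (Cons a p)
    have "[(n::nat)] \<cdot> a \<in> B 1" for n using Cons(2) by (induct n) auto
    thus ?case using Cons by auto
  qed simp
  have prod: "eval g x \<otimes> eval h x \<in> B 2" if "eval g x \<in> B 1" "eval h x \<in> B 1" for x
    using B_mult[OF that] by simp
  obtain w where w: "w \<in> B 0" "eval F (z \<oplus> t) = eval F z \<oplus> t \<otimes> eval (deriv_list F) z \<oplus> t \<otimes> t \<otimes> w"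
    using eval_taylor[OF B_subring sets(1) z tB(2)] by auto
  obtain u where u: "u \<in> B 0" "eval E (z \<oplus> t) = eval E z \<oplus> t \<otimes> eval (deriv_list E) z \<oplus> t \<otimes> t \<otimes> u"
    using eval_taylor[OF B_subring E0 z tB(2)] by auto
  let ?D = "eval (deriv_list F) z" and ?D' = "eval (deriv_list E) z"
  let ?p = "eval g z \<otimes> eval h z" and ?q = "eval g (z \<oplus> t) \<otimes> eval h (z \<oplus> t)"
  have pq: "?p \<in> B 2" "?q \<in> B 2" using prod g h c sets by auto
  have D0: "?D \<in> B 0" "?D' \<in> B 1" "eval E z \<in> B 0"
    using e0 z sets set_deriv_list[OF B_subring] small smalld E0 by auto
  have tt: "t \<otimes> t \<in> B 2" "t \<otimes> ?D' \<in> B 2" using B_mult[OF tB(1) tB(1)] B_mult[OF tB(1) D0(2)] by auto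
  have r: "t \<otimes> ?D' \<oplus> t \<otimes> t \<otimes> u \<ominus> t \<otimes> t \<otimes> w \<oplus> (?q \<ominus> ?p) \<in> B 2"
    using tt u w pq by blast
  have car: "t \<in> carrier R" "u \<in> carrier R" "w \<in> carrier R" "?D \<in> carrier R" "?D' \<in> carrier R" "eval E z \<in> carrier R"
    "?p \<in> carrier R" "?q \<in> carrier R"
    using t u w D0 pq by blast+
  have z': "z \<in> carrier R" "z \<oplus> t \<in> carrier R" using z t by auto
  have "?q \<oplus> (eval E z \<oplus> t \<otimes> ?D' \<oplus> t \<otimes> t \<otimes> u) = (?p \<oplus> eval E z) \<oplus> t \<otimes> ?D \<oplus> t \<otimes> t \<otimes> w"
    using w(2) u(2) eq[OF z'(1)] eq[OF z'(2)] by simp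
  moreover have "t \<otimes> ?D = ((?p \<oplus> eval E z) \<oplus> t \<otimes> ?D \<oplus> t \<otimes> t \<otimes> w) \<ominus> ((?p \<oplus> eval E z) \<oplus> t \<otimes> t \<otimes> w)"
    using car by algebra
  ultimately have "t \<otimes> ?D = (?q \<oplus> (eval E z \<oplus> t \<otimes> ?D' \<oplus> t \<otimes> t \<otimes> u)) \<ominus> ((?p \<oplus> eval E z) \<oplus> t \<otimes> t \<otimes> w)"
    by simp
  also have "\<dots> = t \<otimes> ?D' \<oplus> t \<otimes> t \<otimes> u \<ominus> t \<otimes> t \<otimes> w \<oplus> (?q \<ominus> ?p)"
    using car by algebra
  finally have "t \<otimes> ?D \<in> B 2" using r by simp
  moreover have "?D \<noteq> \<zero>" "v ?D = 0" using v_unit_iff D D0 by auto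
  hence "v (t \<otimes> ?D) = 1" "t \<otimes> ?D \<noteq> \<zero>" using v_mult t car by auto
  ultimately show False using B_iff[of "t \<otimes> ?D" 2] car by auto
qed

text \<open>
  Adjoining a root that is simple modulo the maximal ideal creates no ramification. Let \<open>h\<close> be a monic
  polynomial over \<open>S\<close> of least degree with \<open>h(z)\<close> in the maximal ideal. Dividing the given polynomial by \<open>h\<close>
  leaves a remainder with coefficients in the maximal ideal, which are multiples of \<open>\<pi>\<close> up to
  precision \<open>N\<close>; the cofactor is a unit at \<open>z\<close> because the root is simple, so \<open>h(z)\<close> is
  a multiple of \<open>\<pi>\<close> as well. Dividing any \<open>p(z)\<close> in the maximal ideal by \<open>h\<close> then shows
  that it is such a multiple. Localizing \<open>S[z]\<close> makes it local.
\<close>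

lemma adjoin_simple_root:
  assumes t: "t \<in> carrier R" "t \<noteq> \<zero>" "v t = 1"
    and S: "unramified_upto \<pi> N S" and \<pi>: "\<pi> \<in> carrier R" and N: "N \<ge> 1"
    and F: "set F \<subseteq> S" "eval (\<one> # F) z \<in> B N" "eval (deriv_list (\<one> # F)) z \<notin> B 1" and z: "z \<in> B 0"
  shows "\<exists>S'. unramified_upto \<pi> N S' \<and> S \<subseteq> S' \<and> z \<in> S'"
proof -
  have Sr: "subring S R" "S \<subseteq> B 0" and Sinv: "\<And>x. x \<in> S \<Longrightarrow> x \<notin> B 1 \<Longrightarrow> inv x \<in> S"
    and Su: "\<And>x. x \<in> S \<Longrightarrow> x \<in> B 1 \<Longrightarrow> \<exists>x'\<in>S. x \<ominus> \<pi> \<otimes> x' \<in> B N"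
    using S unfolding unramified_upto_def by auto
  have zc: "z \<in> carrier R" using z by auto
  define T where "T = simple_extension S z"
  have T: "subring T R" unfolding T_def by (rule simple_extension_is_subring[OF Sr(1) zc])
  have ST: "S \<subseteq> T" "z \<in> T" unfolding T_def
    using simple_extension_incl[OF subringE(1)[OF Sr(1)] zc] simple_extension_mem[OF Sr(1) zc] by auto
  have Te: "\<exists>P. set P \<subseteq> S \<and> x = eval P z" if "x \<in> T" for x
    using that simple_extension_as_eval_img[OF subringE(1)[OF Sr(1)] zc] polynomial_incl[of S]
      univ_poly_carrier[of R S] unfolding T_def by auto
  have T0: "T \<subseteq> B 0" using Te eval_in_subring[OF B_subring _ z] Sr(2) by blast
  have res: "\<exists>b\<in>S. b \<otimes> a \<ominus> \<one> \<in> B 1" if "a \<in> S" "a \<notin> B 1" for a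
  proof
    have "a \<in> B 0" using that Sr by auto
    hence "inv a \<otimes> a = \<one>" using unit_inv[of a] that by auto
    thus "inv a \<otimes> a \<ominus> \<one> \<in> B 1" by (simp add: a_minus_def r_neg)
  qed (rule Sinv[OF that])
  define P where "P n \<longleftrightarrow> (\<exists>hs. set hs \<subseteq> S \<and> eval (\<one> # hs) z \<in> B 1 \<and> length hs = n)" for n
  have "P (length F)" unfolding P_def using F B_mono[OF N] by auto
  then have Pn: "P (LEAST n. P n)" and Pmin: "\<And>n. P n \<Longrightarrow> (LEAST n. P n) \<le> n" by (auto intro: LeastI Least_le)
  then obtain hs where hs: "set hs \<subseteq> S" "eval (\<one> # hs) z \<in> B 1" "length hs = (LEAST n. P n)" unfolding P_def by auto
  have min: "length hs \<le> length hs'" if "set hs' \<subseteq> S" "eval (\<one> # hs') z \<in> B 1" for hs'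
    using Pmin[of "length hs'"] that hs(3) unfolding P_def by auto
  note small = coeffs_in_max_ideal[OF Sr res z min]
  note S' = subringE[OF Sr(1)]
  note T' = subringE[OF T]
  have h0: "set (\<one> # hs) \<subseteq> S" using hs S' by auto
  \<comment> \<open>remainder on division by h\<close>
  \<comment> \<open>Minimality of \<open>hs\<close> forces the remainder \<open>E\<close> into the maximal ideal, and its value at
    \<open>z\<close> is then a multiple of \<open>\<pi>\<close> up to precision \<open>N\<close>.\<close>
  have rem: "\<exists>Q E w. set Q \<subseteq> S \<and> set E \<subseteq> S \<inter> B 1 \<and> w \<in> T \<and> eval E z \<ominus> \<pi> \<otimes> w \<in> B N \<and>
      (\<forall>x\<in>carrier R. eval p x = eval Q x \<otimes> eval (\<one> # hs) x \<oplus> eval E x)"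
    if p: "set p \<subseteq> S" "eval p z \<in> B 1" for p
  proof -
    obtain Q E where QE: "set Q \<subseteq> S" "set E \<subseteq> S" "length E \<le> length hs"
      "\<forall>x\<in>carrier R. eval p x = eval Q x \<otimes> eval (\<one> # hs) x \<oplus> eval E x"
      using monic_division[OF Sr(1) hs(1) p(1)] by auto
    have q0: "eval Q z \<in> B 0" "eval E z \<in> B 0"
      using eval_in_subring[OF B_subring _ z] QE Sr(2) by auto
    have qh: "eval Q z \<otimes> eval (\<one> # hs) z \<in> B 1" using q0 hs(2) by blast
    have cancel: "(a \<oplus> b) \<ominus> a = b" if "a \<in> carrier R" "b \<in> carrier R" for a b
      using that by algebra
    have "eval p z = eval Q z \<otimes> eval (\<one> # hs) z \<oplus> eval E z" using QE(4) zc by blast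
    hence "eval E z = eval p z \<ominus> eval Q z \<otimes> eval (\<one> # hs) z"
      using cancel[OF B_carr[OF qh] B_carr[OF q0(2)]] by metis
    hence "eval E z \<in> B 1" using B_minus[OF p(2) qh] by simp
    hence E1: "set E \<subseteq> B 1" using small QE(2,3) by blast
    have "\<exists>w\<in>T. eval E z \<ominus> \<pi> \<otimes> w \<in> B N"
    proof (rule eval_small_coeffs[OF T T0 ST(2) \<pi>])
      fix a assume "a \<in> set E"
      hence "a \<in> S" "a \<in> B 1" using E1 QE(2) by auto
      thus "\<exists>a'\<in>T. a \<ominus> \<pi> \<otimes> a' \<in> B N" using Su ST(1) by (meson subsetD)
    qed (use QE(2) S'(1) in auto)
    then obtain w where "w \<in> T" "eval E z \<ominus> \<pi> \<otimes> w \<in> B N" by auto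
    moreover have "set E \<subseteq> S \<inter> B 1" using E1 QE(2) by auto
    ultimately show ?thesis using QE(1,4) by (intro exI[of _ Q] exI[of _ E] exI[of _ w]) auto
  qed
  have F1: "set (\<one> # F) \<subseteq> S" "eval (\<one> # F) z \<in> B 1" using F S' B_mono[OF N] by auto
  obtain g E w where g: "set g \<subseteq> S" "set E \<subseteq> S \<inter> B 1" "w \<in> T" "eval E z \<ominus> \<pi> \<otimes> w \<in> B N"
      "\<And>x. x\<in>carrier R \<Longrightarrow> eval (\<one> # F) x = eval g x \<otimes> eval (\<one> # hs) x \<oplus> eval E x"
    using rem[OF F1] by auto
  have gz: "eval g z \<notin> B 1"
  proof (rule cofactor_unit[OF t _ _ _ _ z g(5) F(3) hs(2)])
    show "set (\<one> # F) \<subseteq> B 0" using F1(1) Sr(2) by (rule subset_trans)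
    show "set g \<subseteq> B 0" using g(1) Sr(2) by (rule subset_trans)
    show "set (\<one> # hs) \<subseteq> B 0" using h0 Sr(2) by (rule subset_trans)
    show "set E \<subseteq> B 1" using g(2) by auto
  qed
  have gT: "eval g z \<in> T" using eval_in_subring[OF T _ ST(2)] g ST by auto
  have g0: "eval g z \<in> B 0" using gT T0 by auto
  note gi = unit_inv[OF g0 gz]
  let ?L = "localised T"
  note L = localised_subring[OF T T0]
  note L' = subringE[OF L]
  have TL: "T \<subseteq> ?L" by (rule localised_incl[OF T T0])
  have giL: "inv (eval g z) \<in> ?L" using localised_inv[OF T T0 _ gz] gT TL by auto
  \<comment> \<open>From \<open>F(z) = g(z) h(z) + E(z)\<close>, \<open>F(z) = 0\<close> and \<open>E(z) = \<pi> w\<close> up to precision \<open>N\<close>.\<close>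
  define k where "k = \<ominus> (inv (eval g z) \<otimes> w)"
  have kL: "k \<in> ?L" unfolding k_def using giL g(3) TL L' by auto
  have hk: "eval (\<one> # hs) z \<ominus> \<pi> \<otimes> k \<in> B N"
  proof -
    have "set E \<subseteq> carrier R" using g(2) S'(1) by auto
    hence Ec: "eval E z \<in> carrier R" using zc eval_in_carrier by auto
    have car: "eval g z \<in> carrier R" "w \<in> carrier R" "inv (eval g z) \<in> carrier R"
      "eval (\<one> # hs) z \<in> carrier R" "eval (\<one> # F) z \<in> carrier R"
      using B_carr[OF g0] B_carr[OF gi(1)] g(3) T'(1) B_carr[OF hs(2)] B_carr[OF F(2)] by auto
    define gg H where "gg = eval g z" and "H = eval (\<one> # hs) z"
    note car' = car[folded gg_def H_def] Ec
    have e: "eval (\<one> # F) z = gg \<otimes> H \<oplus> eval E z" using g(5)[OF zc] gg_def H_def by simp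
    have "inv gg \<otimes> (eval (\<one> # F) z \<ominus> (eval E z \<ominus> \<pi> \<otimes> w)) = (inv gg \<otimes> gg) \<otimes> H \<ominus> \<pi> \<otimes> \<ominus> (inv gg \<otimes> w)"
      unfolding e using car' \<pi> by algebra
    also have "inv gg \<otimes> gg = \<one>" using gi(3) car by (simp add: gg_def)
    finally have "H \<ominus> \<pi> \<otimes> k = inv gg \<otimes> (eval (\<one> # F) z \<ominus> (eval E z \<ominus> \<pi> \<otimes> w))"
      unfolding k_def gg_def[symmetric] using car' by simp
    moreover have "\<dots> \<in> B N" by (rule B_mult0(1)[OF gi(1)[folded gg_def] B_minus[OF F(2) g(4)]])
    ultimately show ?thesis unfolding H_def by simp
  qed
  have key: "\<exists>x'\<in>?L. x \<ominus> \<pi> \<otimes> x' \<in> B N" if x: "x \<in> T" "x \<in> B 1" for x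
  proof -
    obtain p where p: "set p \<subseteq> S" "x = eval p z" using Te[OF x(1)] by auto
    then obtain Q E w where q: "set Q \<subseteq> S" "set E \<subseteq> S \<inter> B 1" "w \<in> T" "eval E z \<ominus> \<pi> \<otimes> w \<in> B N"
      "\<And>x. x\<in>carrier R \<Longrightarrow> eval p x = eval Q x \<otimes> eval (\<one> # hs) x \<oplus> eval E x"
      using rem[of p] x by auto
    have QT: "eval Q z \<in> T" using eval_in_subring[OF T _ ST(2)] q ST by auto
    define H where "H = eval (\<one> # hs) z"
    have "set E \<subseteq> carrier R" using q(2) S'(1) by auto
    hence "eval E z \<in> carrier R" using zc eval_in_carrier by auto
    moreover have "eval Q z \<in> carrier R" "w \<in> carrier R" "k \<in> carrier R" "H \<in> carrier R"
      using QT q(3) T'(1) kL L'(1) B_carr[OF hs(2)] H_def by auto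
    ultimately have car: "eval Q z \<in> carrier R" "w \<in> carrier R" "k \<in> carrier R" "eval E z \<in> carrier R" "H \<in> carrier R"
      by auto
    have "x \<ominus> \<pi> \<otimes> (eval Q z \<otimes> k \<oplus> w) = eval Q z \<otimes> (H \<ominus> \<pi> \<otimes> k) \<oplus> (eval E z \<ominus> \<pi> \<otimes> w)"
      unfolding p(2) q(5)[OF zc] H_def[symmetric] using car \<pi> by algebra
    moreover have "\<dots> \<in> B N"
      by (rule B_add[OF B_mult0(1)[OF _ hk[folded H_def]] q(4)]) (use QT T0 in auto)
    moreover have "eval Q z \<otimes> k \<oplus> w \<in> ?L" using QT kL q(3) TL L'(6,7) by (meson subsetD)
    ultimately show ?thesis by (intro bexI[of _ "eval Q z \<otimes> k \<oplus> w"]) (simp_all only:)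
  qed
  have "unramified_upto \<pi> N ?L" unfolding unramified_upto_def
  proof (intro conjI ballI impI)
    fix x assume x: "x \<in> ?L \<inter> B 1"
    then have "x \<in> ?L" by auto
    then obtain a b where ab: "x = a \<otimes> inv b" "a \<in> T" "b \<in> T" "b \<notin> B 1" "a \<in> B 0" "b \<in> B 0"
      "a \<in> carrier R" "b \<in> carrier R" "b \<noteq> \<zero>" "inv b \<in> B 0" "inv b \<in> carrier R"
      by (rule localisedE[OF _ T0])
    have "x \<otimes> b \<in> B 1" using x ab by blast
    hence "a \<in> B 1" using ab by simp
    then obtain a' where a': "a' \<in> ?L" "a \<ominus> \<pi> \<otimes> a' \<in> B N" using key ab by blast
    have bL: "inv b \<in> ?L" using localised_inv[OF T T0 _ ab(4)] ab TL by auto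
    have "a' \<in> carrier R" using a' L' by auto
    hence "x \<ominus> \<pi> \<otimes> (a' \<otimes> inv b) = (a \<ominus> \<pi> \<otimes> a') \<otimes> inv b" unfolding ab(1) using ab(7,11) \<pi> by algebra
    moreover have "\<dots> \<in> B N" using a' ab by blast
    ultimately show "\<exists>x'\<in>?L. x \<ominus> \<pi> \<otimes> x' \<in> B N" using a' bL L' by (intro bexI[of _ "a' \<otimes> inv b"]) auto
  qed (use L localised_subset[OF T T0] localised_inv[OF T T0] in auto)
  thus ?thesis using ST TL by blast
qed

text \<open>
  Divide by \<open>\<pi>\<close> repeatedly until a unit is reached; each step is correct up to precision
  \<open>N\<close>, which is above the value in question.
\<close>

lemma unramified_value:
  assumes S: "unramified_upto \<pi> N S" and \<pi>: "\<pi> \<in> carrier R" "\<pi> \<noteq> \<zero>" "v \<pi> \<ge> 1"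
    and x: "x \<in> S" "x \<notin> B N"
  shows "v \<pi> dvd v x"
  using x
proof (induct "nat (v x)" arbitrary: x rule: less_induct)
  case less
  have xc: "x \<in> B 0" "x \<in> carrier R" using less(2) S unfolding unramified_upto_def by auto
  hence x0: "x \<noteq> \<zero>" "0 \<le> v x" "v x < N" using less(3) notin_B B_iff[of x 0] by auto
  show ?case
  proof (cases "v x = 0")
    case False
    hence "x \<in> B 1" using x0 xc B_iff by auto
    then obtain x' where x': "x' \<in> S" "x \<ominus> \<pi> \<otimes> x' \<in> B N" using S less(2) unfolding unramified_upto_def by (meson IntI)
    have c: "x' \<in> carrier R" "x' \<in> B 0" using x' S unfolding unramified_upto_def by auto
    have px: "\<pi> \<otimes> x' \<in> carrier R" using c \<pi> by auto
    note vc = v_cong[OF xc(2) px B_minus_sym[OF x'(2) xc(2) px] less(3)]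
    hence nz: "x' \<noteq> \<zero>" using \<pi> c by auto
    hence e: "v x = v \<pi> + v x'" using vc v_mult \<pi> c by auto
    have "v x' \<ge> 0" using c nz B_iff by auto
    hence "v \<pi> dvd v x'" using less(1)[of x'] e \<pi> x' nz c notin_B x0 by auto
    thus ?thesis using e by simp
  qed simp
qed

end

section \<open>Fraction fields inside a field\<close>

lemma (in field) fraction_field_incl:
  assumes "subring A R" shows "A \<subseteq> fraction_field R A"
proof
  fix a assume a: "a \<in> A"
  hence "a = a \<otimes> inv \<one>" using subringE(1)[OF assms] by auto
  thus "a \<in> fraction_field R A" unfolding fraction_field_def using a subringE(3)[OF assms] by force
qed

lemma (in field) fraction_field_subfield:
  assumes A: "subring A R"
  shows "subfield (fraction_field R A) R"
proof -
  note A' = subringE[OF A]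
  let ?K = "fraction_field R A"
  have KE: "\<exists>a b. x = a \<otimes> inv b \<and> a \<in> A \<and> b \<in> A \<and> b \<noteq> \<zero> \<and> a \<in> carrier R \<and> b \<in> carrier R" if "x \<in> ?K" for x
    using that A'(1) unfolding fraction_field_def by blast
  have KI: "a \<otimes> inv b \<in> ?K" if "a \<in> A" "b \<in> A" "b \<noteq> \<zero>" for a b
    using that unfolding fraction_field_def by blast
  show ?thesis
  proof (rule subfieldI')
    show "subring ?K R"
    proof (rule subringI)
      show "?K \<subseteq> carrier R" using KE by fastforce
      show "\<one> \<in> ?K" using fraction_field_incl[OF A] A' by auto
      fix x assume "x \<in> ?K"
      then obtain a b where x: "x = a \<otimes> inv b" "a \<in> A" "b \<in> A" "b \<noteq> \<zero>" "a \<in> carrier R" "b \<in> carrier R"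
        using KE by blast
      have "\<ominus> x = (\<ominus> a) \<otimes> inv b" using x by (simp add: l_minus)
      thus "\<ominus> x \<in> ?K" using KI[of "\<ominus> a" b] x A' by simp
      fix y assume "y \<in> ?K"
      then obtain c d where y: "y = c \<otimes> inv d" "c \<in> A" "d \<in> A" "d \<noteq> \<zero>" "c \<in> carrier R" "d \<in> carrier R"
        using KE by blast
      have bd: "b \<otimes> d \<in> A" "b \<otimes> d \<noteq> \<zero>" "inv (b \<otimes> d) = inv b \<otimes> inv d" using x y A' inv_mult by auto
      have ii: "inv b \<in> carrier R" "inv d \<in> carrier R" using x y by auto
      have "x \<otimes> y = (a \<otimes> c) \<otimes> inv (b \<otimes> d)" unfolding bd x y using x(5,6) y(5,6) ii by algebra
      thus "x \<otimes> y \<in> ?K" using KI[of "a \<otimes> c" "b \<otimes> d"] bd(1,2) x y A' by simp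
      have "(a \<otimes> d \<oplus> c \<otimes> b) \<otimes> (inv b \<otimes> inv d) = a \<otimes> inv b \<otimes> (d \<otimes> inv d) \<oplus> c \<otimes> inv d \<otimes> (b \<otimes> inv b)"
        using x(5,6) y(5,6) ii by algebra
      hence "x \<oplus> y = (a \<otimes> d \<oplus> c \<otimes> b) \<otimes> inv (b \<otimes> d)" unfolding bd using x y by simp
      thus "x \<oplus> y \<in> ?K" using KI[of "a \<otimes> d \<oplus> c \<otimes> b" "b \<otimes> d"] bd(1,2) x y A' by simp
    qed
  next
    fix x assume "x \<in> ?K - {\<zero>}"
    then obtain a b where x: "x = a \<otimes> inv b" "a \<in> A" "b \<in> A" "b \<noteq> \<zero>" "a \<in> carrier R" "b \<in> carrier R" "x \<noteq> \<zero>"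
      using KE by blast
    hence "a \<noteq> \<zero>" by auto
    hence "inv x = b \<otimes> inv a" using x inv_mult[of a "inv b"] m_comm by simp
    thus "inv x \<in> ?K" using KI x \<open>a \<noteq> \<zero>\<close> by simp
  qed
qed

section \<open>Approximate roots and values of polynomials in a uniformizer\<close>

context cring begin

lemma eval_power_minus:
  assumes "u \<in> carrier R" "x \<in> carrier R" "0 < m"
  shows "eval (\<one> # replicate (m - 1) \<zero> @ [\<ominus> u]) x = x [^] m \<ominus> u"
proof -
  have "eval (replicate (m - 1) \<zero> @ [\<ominus> u]) x = \<ominus> u"
    using assms by (subst eval_replicate) auto
  moreover have "eval (\<one> # p) x = \<one> \<otimes> x [^] length p \<oplus> eval p x" for p by simp
  moreover have "length (replicate (m - 1) \<zero> @ [\<ominus> u]) = m" using assms(3) by simp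
  ultimately have "eval (\<one> # replicate (m - 1) \<zero> @ [\<ominus> u]) x = \<one> \<otimes> x [^] m \<oplus> \<ominus> u" by metis
  thus ?thesis using assms by (simp add: a_minus_def)
qed

lemma eval_deriv_power_minus:
  assumes "u \<in> carrier R" "x \<in> carrier R" "0 < m"
  shows "eval (deriv_list (\<one> # replicate (m - 1) \<zero> @ [\<ominus> u])) x = [m] \<cdot> \<one> \<otimes> x [^] (m - 1)"
proof -
  have z: "eval (deriv_list (replicate n \<zero> @ [\<ominus> u])) x = \<zero>" for n
    by (induct n) (use assms in auto)
  have "deriv_list (\<one> # replicate (m - 1) \<zero> @ [\<ominus> u]) = [m] \<cdot> \<one> # deriv_list (replicate (m - 1) \<zero> @ [\<ominus> u])"
    using assms(3) by simp
  also have "eval \<dots> x = [m] \<cdot> \<one> \<otimes> x [^] length (deriv_list (replicate (m - 1) \<zero> @ [\<ominus> u]))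
      \<oplus> eval (deriv_list (replicate (m - 1) \<zero> @ [\<ominus> u])) x"
    by simp
  also have "\<dots> = [m] \<cdot> \<one> \<otimes> x [^] (m - 1)"
    unfolding z using assms by simp
  finally show ?thesis .
qed

end

context valued_field begin

text \<open>
  Newton's method, one step for each unit of precision. All iterates lie in the subfield \<open>E\<close>, which need not be
  complete.
\<close>

lemma newton_approximation:
  assumes E: "subfield E R" and F: "set F \<subseteq> E \<inter> B 0" and c: "c \<in> E" "c \<in> B 0"
    and root: "eval F c \<in> B 1" "eval (deriv_list F) c \<notin> B 1"
  shows "\<exists>z\<in>E \<inter> B 0. z \<ominus> c \<in> B 1 \<and> eval F z \<in> B (int n + 1) \<and> eval (deriv_list F) z \<notin> B 1"
proof (induct n)
  case 0
  have "c \<ominus> c \<in> B 1" using c by (auto simp: a_minus_def r_neg)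
  thus ?case using assms by auto
next
  case (Suc n)
  then obtain z where z: "z \<in> E" "z \<in> B 0" "z \<ominus> c \<in> B 1" "eval F z \<in> B (int n + 1)" "eval (deriv_list F) z \<notin> B 1" by auto
  have sr: "subring (E \<inter> B 0) R" using subring_inter[OF subfieldE(1)[OF E] B_subring] .
  have zE: "z \<in> E \<inter> B 0" using z by simp
  let ?D = "eval (deriv_list F) z"
  have D: "?D \<in> E \<inter> B 0" "eval F z \<in> E \<inter> B 0" using eval_in_subring[OF sr _ zE] set_deriv_list[OF sr F] F by auto
  have Dnz: "?D \<noteq> \<zero>" and Di: "inv ?D \<in> B 0" using unit_inv[of ?D] D z by auto
  have DiE: "inv ?D \<in> E" using subfield_m_inv(1)[OF E, of ?D] D Dnz by auto
  \<comment> \<open>The Newton step: the linear part of the expansion at \<open>z\<close> cancels the value of \<open>F\<close>.\<close>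
  define y where "y = \<ominus> (inv ?D \<otimes> eval F z)"
  have y: "y \<in> E" "y \<in> B (int n + 1)" "y \<in> carrier R"
  proof -
    note E' = subringE[OF subfieldE(1)[OF E]]
    show "y \<in> E" unfolding y_def using DiE D E' by simp
    show "y \<in> B (int n + 1)" unfolding y_def by (rule B_uminus[OF B_mult0(1)[OF Di z(4)]])
    thus "y \<in> carrier R" by (rule B_carr)
  qed
  have yB: "y \<in> B 1" "y \<in> B 0" by (rule B_mono[OF _ y(2)], simp)+
  have yE: "y \<in> E \<inter> B 0" using y yB by auto
  obtain w where w: "w \<in> E \<inter> B 0" "eval F (z \<oplus> y) = eval F z \<oplus> y \<otimes> ?D \<oplus> y \<otimes> y \<otimes> w"
    using eval_taylor[OF sr F zE yE] by auto
  have car: "eval F z \<in> carrier R" "?D \<in> carrier R" "inv ?D \<in> carrier R" "w \<in> carrier R" "z \<in> carrier R" "c \<in> carrier R"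
    using D Di w z c by auto
  have "y \<otimes> ?D = \<ominus> (eval F z \<otimes> (inv ?D \<otimes> ?D))" unfolding y_def using car(1,2,3) by algebra
  hence "y \<otimes> ?D = \<ominus> eval F z" using Dnz car by simp
  hence "eval F (z \<oplus> y) = y \<otimes> y \<otimes> w" unfolding w(2) using car y(3) by (simp add: r_neg)
  moreover have "y \<otimes> y \<in> B (int n + 1 + 1)" using B_mult[OF y(2) yB(1)] .
  hence "y \<otimes> y \<otimes> w \<in> B (int (Suc n) + 1)" using w by (auto intro!: B_mult0(2) simp: add.commute)
  ultimately have 1: "eval F (z \<oplus> y) \<in> B (int (Suc n) + 1)" by simp
  have 2: "z \<oplus> y \<in> E \<inter> B 0" using subringE(7)[OF sr zE yE] .
  have "z \<oplus> y \<ominus> c = (z \<ominus> c) \<oplus> y" using car y by algebra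
  hence 3: "z \<oplus> y \<ominus> c \<in> B 1" using z(3) yB by auto
  have dF: "set (deriv_list F) \<subseteq> B 0" using set_deriv_list[OF sr F] by auto
  have "eval (deriv_list F) (z \<oplus> y) \<ominus> ?D \<in> B 1" using eval_cong[OF dF z(2) yB(1)] by simp
  moreover have "eval (deriv_list F) (z \<oplus> y) \<in> carrier R" using dF 2 by (intro eval_in_carrier) auto
  ultimately have "eval (deriv_list F) (z \<oplus> y) \<notin> B 1" using z(5) B_minus_cancel car by blast
  thus ?case using 1 2 3 by auto
qed

text \<open>
  The polynomial \<open>X\<^sup>m - u\<close> has \<open>1\<close> as a simple root modulo the maximal ideal, since
  \<open>m\<close> is not zero there.
\<close>

lemma root_approximation:
  assumes E: "subfield E R" and u: "u \<in> E" "u \<ominus> \<one> \<in> B 1" and m: "0 < m" "[(m::nat)] \<cdot> \<one> \<notin> B 1"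
  shows "\<exists>s\<in>E \<inter> B 0. s \<ominus> \<one> \<in> B 1 \<and> s [^] m \<ominus> u \<in> B (int n + 1)"
proof -
  note E' = subringE[OF subfieldE(1)[OF E]]
  have uc: "u \<in> carrier R" using u E' by auto
  have "\<one> \<oplus> (u \<ominus> \<one>) = u" using uc by algebra
  moreover have "u \<ominus> \<one> \<in> B 0" by (rule B_mono[OF _ u(2)]) simp
  ultimately have uB: "u \<in> B 0" using B_add[OF B_one] by metis
  let ?F = "\<one> # replicate (m - 1) \<zero> @ [\<ominus> u]"
  have F: "set ?F \<subseteq> E \<inter> B 0" using uB u E' by auto
  have m1: "[m] \<cdot> \<one> \<in> carrier R" by simp
  have r1: "eval ?F \<one> \<in> B 1"
    using eval_power_minus[OF uc one_closed m(1)] B_minus_sym[OF u(2)] uc by simp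
  have r2: "eval (deriv_list ?F) \<one> \<notin> B 1"
    using eval_deriv_power_minus[OF uc one_closed m(1)] m(2) m1 by (simp only: nat_pow_one r_one not_False_eq_True)
  obtain s where s: "s \<in> E \<inter> B 0" "s \<ominus> \<one> \<in> B 1" "eval ?F s \<in> B (int n + 1)"
    using newton_approximation[OF E F _ _ r1 r2, of n] E' by auto
  moreover have "s \<in> carrier R" using s by auto
  hence "eval ?F s = s [^] m \<ominus> u" using eval_power_minus[OF uc _ m(1)] by blast
  ultimately show ?thesis by auto
qed

text \<open>
  The terms of a polynomial of length at most \<open>k\<close> in \<open>\<theta>\<close> have pairwise different values modulo
  \<open>d1\<close>. No two of them can cancel, so the value of the sum is that of one of the terms.
\<close>

lemma distinct_values:
  assumes \<theta>: "\<theta> \<in> carrier R" "\<theta> \<noteq> \<zero>" "v \<theta> = d2" "\<theta> \<in> B 0"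
    and S: "\<And>x. x \<in> S \<Longrightarrow> x \<notin> B N \<Longrightarrow> d1 dvd v x" "S \<subseteq> B 0"
    and dist: "\<And>i j. i < k \<Longrightarrow> j < k \<Longrightarrow> d1 dvd (int i * d2 - int j * d2) \<Longrightarrow> i = j"
    and P: "set P \<subseteq> S" "length P \<le> k"
  shows "eval P \<theta> \<in> B N \<or> (\<exists>j<length P. d1 dvd v (eval P \<theta>) - int j * d2)"
  using P
proof (induct P)
  case (Cons a P)
  let ?r = "eval P \<theta>" let ?a = "a \<otimes> \<theta> [^] length P"
  have a: "a \<in> S" "a \<in> carrier R" "a \<in> B 0" using Cons S by auto
  have "set P \<subseteq> carrier R" using Cons(2) S by auto
  hence car: "?a \<in> carrier R" "?r \<in> carrier R" using a \<theta> eval_in_carrier by auto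
  have ev: "eval (a # P) \<theta> = ?a \<oplus> ?r" by simp
  have IH: "?r \<in> B N \<or> (\<exists>j<length P. d1 dvd v ?r - int j * d2)" using Cons by simp
  have va: "?a \<in> B N \<or> d1 dvd v ?a - int (length P) * d2"
  proof (cases "a \<in> B N")
    case True thus ?thesis using \<theta> by auto
  next
    case False
    hence "a \<noteq> \<zero>" by auto
    hence "v ?a = v a + int (length P) * d2" using a \<theta> by (simp add: v_mult)
    thus ?thesis using S(1)[OF a(1) False] by simp
  qed
  show ?case
  proof (cases "?a \<in> B N")
    case True
    show ?thesis
    proof (cases "?r \<in> B N")
      case False
      have "?a \<oplus> ?r \<ominus> ?r \<in> B N" using True car by (simp add: a_minus_def a_assoc r_neg)
      hence "v (?a \<oplus> ?r) = v ?r" using v_cong(2)[OF car(2) _ _ False] car by simp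
      moreover obtain j where "j < length P" "d1 dvd v ?r - int j * d2" using IH False by auto
      ultimately show ?thesis using ev by (intro disjI2 exI[of _ j]) simp_all
    qed (use True ev in auto)
  next
    case False
    hence dva: "d1 dvd v ?a - int (length P) * d2" and anz: "?a \<noteq> \<zero>" using va by auto
    show ?thesis
    proof (cases "?r \<in> B N")
      case True
      have "?a \<oplus> ?r \<ominus> ?a \<in> B N" using True car by (simp add: a_minus_def a_ac r_neg)
      hence "v (?a \<oplus> ?r) = v ?a" using v_cong(2)[OF car(1) _ _ False] car by simp
      thus ?thesis using dva ev by (intro disjI2 exI[of _ "length P"]) simp_all
    next
      case rF: False
      then obtain j where j: "j < length P" "d1 dvd v ?r - int j * d2" using IH by auto
      have rnz: "?r \<noteq> \<zero>" using rF by auto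
      have ne: "v ?a \<noteq> v ?r"
      proof
        assume "v ?a = v ?r"
        hence "d1 dvd (v ?r - int j * d2) - (v ?r - int (length P) * d2)" using j dva dvd_diff by metis
        hence "d1 dvd int (length P) * d2 - int j * d2" by (simp add: algebra_simps)
        hence "length P = j" using dist j Cons(3) by simp
        thus False using j by simp
      qed
      show ?thesis
      proof (cases "v ?a < v ?r")
        case True
        have "?r \<in> B (v ?a + 1)" using True car rnz B_iff by auto
        hence "v (?a \<oplus> ?r) = v ?a" using v_add_eq(2)[OF car(1) anz] by simp
        thus ?thesis using dva ev by (intro disjI2 exI[of _ "length P"]) simp_all
      next
        case False
        hence "?a \<in> B (v ?r + 1)" using ne car anz B_iff by auto
        hence "v (?r \<oplus> ?a) = v ?r" using v_add_eq(2)[OF car(2) rnz] by simp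
        hence "v (eval (a # P) \<theta>) = v ?r" using ev car by (simp only: a_comm)
        thus ?thesis using j by (intro disjI2 exI[of _ j]) auto
      qed
    qed
  qed
qed simp

end

section \<open>The value group of a tame compositum\<close>

context valued_field begin

text \<open>
  The valuation ring of a subfield is unramified over its own uniformizer, to every precision.
\<close>

lemma unramified_base:
  assumes K: "subfield K R" and \<pi>: "\<pi> \<in> K" "\<pi> \<noteq> \<zero>" "v \<pi> \<ge> 1"
    and div: "\<And>x. x \<in> K \<Longrightarrow> x \<noteq> \<zero> \<Longrightarrow> v \<pi> dvd v x"
  shows "unramified_upto \<pi> N (K \<inter> B 0)"
  unfolding unramified_upto_def
proof (intro conjI ballI impI)
  note K' = subringE[OF subfieldE(1)[OF K]]
  show "subring (K \<inter> B 0) R" by (rule subring_inter[OF subfieldE(1)[OF K] B_subring])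
  fix x assume x: "x \<in> K \<inter> B 0"
  { assume "x \<notin> B 1"
    hence "inv x \<in> B 0" "x \<noteq> \<zero>" using unit_inv[of x] x by auto
    thus "inv x \<in> K \<inter> B 0" using subfield_m_inv(1)[OF K, of x] x by auto }
next
  note K' = subringE[OF subfieldE(1)[OF K]]
  fix x assume "x \<in> K \<inter> B 0 \<inter> B 1"
  hence x: "x \<in> K" "x \<in> B 1" "x \<in> carrier R" by auto
  have pc: "\<pi> \<in> carrier R" using \<pi> K' by auto
  have pi: "inv \<pi> \<in> K" "inv \<pi> \<in> carrier R" using subfield_m_inv(1)[OF K, of \<pi>] \<pi> pc by auto
  have "inv \<pi> \<otimes> x \<in> B 0"
  proof (cases "x = \<zero>")
    case False
    hence "v x \<ge> 1" "v \<pi> dvd v x" using x B_iff div by auto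
    hence "v \<pi> \<le> v x" by (intro zdvd_imp_le) auto
    thus ?thesis using False pc \<pi> x by (auto simp: B_iff v_mult)
  qed (use pi in auto)
  moreover have "x \<ominus> \<pi> \<otimes> (inv \<pi> \<otimes> x) \<in> B N" using x pc \<pi> by (simp add: a_minus_def r_neg)
  ultimately show "\<exists>x'\<in>K \<inter> B 0. x \<ominus> \<pi> \<otimes> x' \<in> B N" using x pi K' by (intro bexI[of _ "inv \<pi> \<otimes> x"]) auto
qed (auto)

end

text \<open>
  A field generated by subfields \<open>K1\<close> and \<open>K2\<close> with uniformizers \<open>\<rho>\<close> and \<open>\<theta>0\<close> (elements
  whose values generate the value groups). Over a common element \<open>\<pi>\<close>, the ramification index \<open>e\<close>
  of \<open>K2\<close> is not zero in the residue field. The last assumption says that the residue field of \<open>K2\<close> is separable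
  algebraic over that of \<open>A\<close>. The element \<open>t\<close> makes the valuation normalized.
\<close>

locale tame_compositum = valued_field +
  fixes t \<pi> \<rho> \<theta>0 and A K1 K2 and e :: nat
  assumes t: "t \<in> carrier R" "t \<noteq> \<zero>" "v t = 1"
    and K1: "subfield K1 R" and K2: "subfield K2 R"
    and A: "A \<subseteq> K1" "A \<subseteq> K2" "A \<subseteq> B 0"
    and gen: "carrier R = generate_field R (K1 \<union> K2)"
    and \<pi>: "\<pi> \<in> K1" "\<pi> \<in> K2" "\<pi> \<noteq> \<zero>"
    and \<rho>: "\<rho> \<in> K1" "\<rho> \<noteq> \<zero>" "v \<rho> \<ge> 1"
    and \<theta>0: "\<theta>0 \<in> K2" "\<theta>0 \<noteq> \<zero>" "v \<theta>0 \<ge> 1"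
    and div1: "\<And>x. x \<in> K1 \<Longrightarrow> x \<noteq> \<zero> \<Longrightarrow> v \<rho> dvd v x"
    and div2: "\<And>x. x \<in> K2 \<Longrightarrow> x \<noteq> \<zero> \<Longrightarrow> v \<theta>0 dvd v x"
    and e: "v \<pi> = int e * v \<theta>0" "0 < e" "[e] \<cdot> \<one> \<notin> B 1"
    and residue: "\<And>c. c \<in> K2 \<Longrightarrow> c \<in> B 0 \<Longrightarrow>
       \<exists>F. set F \<subseteq> A \<and> eval (\<one> # F) c \<in> B 1 \<and> eval (deriv_list (\<one> # F)) c \<notin> B 1"
begin

lemmas K1' = subringE[OF subfieldE(1)[OF K1]]
lemmas K2' = subringE[OF subfieldE(1)[OF K2]]

lemma car: "\<pi> \<in> carrier R" "\<rho> \<in> carrier R" "\<theta>0 \<in> carrier R"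
  using \<pi> \<rho> \<theta>0 K1'(1) K2'(1) by auto

text \<open>
  Elements of \<open>K2\<close> that, up to precision \<open>N\<close>, are roots of a monic polynomial over \<open>A\<close> and
  simple modulo the maximal ideal. In a complete field they would generate the maximal unramified subextension of
  \<open>K2\<close>.
\<close>

definition hensel :: "int \<Rightarrow> 'a set" where
  "hensel N = {z \<in> K2 \<inter> B 0. \<exists>F. set F \<subseteq> A \<and> eval (\<one> # F) z \<in> B N \<and> eval (deriv_list (\<one> # F)) z \<notin> B 1}"

lemma hensel_lift:
  assumes "c \<in> K2" "c \<in> B 0" "N \<ge> 1"
  shows "\<exists>z\<in>hensel N. z \<ominus> c \<in> B 1"
proof -
  obtain F where F: "set F \<subseteq> A" "eval (\<one> # F) c \<in> B 1" "eval (deriv_list (\<one> # F)) c \<notin> B 1"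
    using residue[OF assms(1,2)] by auto
  have FF: "set (\<one> # F) \<subseteq> K2 \<inter> B 0" using F(1) A K2' by auto
  have "int (nat N) + 1 \<ge> N" using assms(3) by simp
  moreover obtain z where "z \<in> K2 \<inter> B 0" "z \<ominus> c \<in> B 1" "eval (\<one> # F) z \<in> B (int (nat N) + 1)"
    "eval (deriv_list (\<one> # F)) z \<notin> B 1"
    using newton_approximation[OF K2 FF assms(1,2) F(2,3)] by blast
  ultimately show ?thesis unfolding hensel_def using F(1) B_mono by blast
qed

text \<open>
  The polynomials have coefficients in \<open>A\<close>, hence in every ring of the chain, so the roots can be adjoined one
  after the other.
\<close>

lemma adjoin_hensel:
  assumes "finite Z" "Z \<subseteq> hensel N" "N \<ge> 1"
  shows "\<exists>S. unramified_upto \<rho> N S \<and> K1 \<inter> B 0 \<subseteq> S \<and> Z \<subseteq> S"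
  using assms(1,2)
proof (induct Z)
  case empty
  have "unramified_upto \<rho> N (K1 \<inter> B 0)" by (rule unramified_base[OF K1 \<rho> div1])
  thus ?case by (intro exI[of _ "K1 \<inter> B 0"]) simp
next
  case (insert z Z)
  then obtain S where S: "unramified_upto \<rho> N S" "K1 \<inter> B 0 \<subseteq> S" "Z \<subseteq> S" by auto
  obtain F where F: "set F \<subseteq> A" "eval (\<one> # F) z \<in> B N" "eval (deriv_list (\<one> # F)) z \<notin> B 1" and z: "z \<in> B 0"
    using insert unfolding hensel_def by auto
  have "set F \<subseteq> S" using F(1) A(1,3) S(2) by blast
  then obtain S' where "unramified_upto \<rho> N S'" "S \<subseteq> S'" "z \<in> S'"
    using adjoin_simple_root[OF t S(1) car(2) assms(3) _ F(2,3) z] by blast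
  thus ?case using S by (intro exI[of _ S']) auto
qed

text \<open>
  Elements that are polynomials in \<open>\<theta>\<close> over every unramified extension of the valuation ring of \<open>K1\<close>
  that contains certain approximate roots. Quantifying over all such extensions, rather than naming one,
  makes sums and products possible: the finite sets \<open>Z\<close> of two elements are simply united.
\<close>

definition polys :: "int \<Rightarrow> 'a \<Rightarrow> 'a set" where
  "polys N \<theta> = {y. \<exists>Z. finite Z \<and> Z \<subseteq> hensel N \<and>
     (\<forall>S. unramified_upto \<rho> N S \<and> K1 \<inter> B 0 \<subseteq> S \<and> Z \<subseteq> S \<longrightarrow> y \<in> simple_extension S \<theta>)}"

lemma simple_extension_unramified:
  assumes "unramified_upto \<rho> N S" "\<theta> \<in> B 0"
  shows "subring (simple_extension S \<theta>) R" "S \<subseteq> simple_extension S \<theta>" "\<theta> \<in> simple_extension S \<theta>"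
    "simple_extension S \<theta> \<subseteq> B 0" "x \<in> simple_extension S \<theta> \<Longrightarrow> \<exists>P. set P \<subseteq> S \<and> x = eval P \<theta>"
proof -
  have S: "subring S R" "S \<subseteq> B 0" using assms unfolding unramified_upto_def by auto
  have c: "\<theta> \<in> carrier R" using assms by auto
  show "subring (simple_extension S \<theta>) R" by (rule simple_extension_is_subring[OF S(1) c])
  show "S \<subseteq> simple_extension S \<theta>" by (rule simple_extension_incl[OF subringE(1)[OF S(1)] c])
  show "\<theta> \<in> simple_extension S \<theta>" by (rule simple_extension_mem[OF S(1) c])
  have *: "\<exists>P. set P \<subseteq> S \<and> x = eval P \<theta>" if "x \<in> simple_extension S \<theta>" for x
    using that simple_extension_as_eval_img[OF subringE(1)[OF S(1)] c] polynomial_incl[of S]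
      univ_poly_carrier[of R S] by auto
  thus "x \<in> simple_extension S \<theta> \<Longrightarrow> \<exists>P. set P \<subseteq> S \<and> x = eval P \<theta>" .
  show "simple_extension S \<theta> \<subseteq> B 0" using * eval_in_subring[OF B_subring _ assms(2)] S(2) by blast
qed

lemma polysI:
  assumes "finite Z" "Z \<subseteq> hensel N"
    "\<And>S. unramified_upto \<rho> N S \<Longrightarrow> K1 \<inter> B 0 \<subseteq> S \<Longrightarrow> Z \<subseteq> S \<Longrightarrow> y \<in> simple_extension S \<theta>"
  shows "y \<in> polys N \<theta>"
  using assms unfolding polys_def by blast

lemma polysE:
  assumes "y \<in> polys N \<theta>"
  obtains Z where "finite Z" "Z \<subseteq> hensel N"
    "\<And>S. unramified_upto \<rho> N S \<Longrightarrow> K1 \<inter> B 0 \<subseteq> S \<Longrightarrow> Z \<subseteq> S \<Longrightarrow> y \<in> simple_extension S \<theta>"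
  using assms unfolding polys_def by blast

lemma polys_basic:
  assumes "\<theta> \<in> B 0"
  shows "K1 \<inter> B 0 \<subseteq> polys N \<theta>" "hensel N \<subseteq> polys N \<theta>" "\<theta> \<in> polys N \<theta>"
proof -
  note se = simple_extension_unramified[OF _ assms]
  show "K1 \<inter> B 0 \<subseteq> polys N \<theta>"
    using se(2) by (intro subsetI polysI[of "{}"]) auto
  show "hensel N \<subseteq> polys N \<theta>"
  proof
    fix z assume "z \<in> hensel N"
    thus "z \<in> polys N \<theta>" using se(2) by (intro polysI[of "{z}"]) auto
  qed
  show "\<theta> \<in> polys N \<theta>" using se(3) by (intro polysI[of "{}"]) auto
qed

lemma polys_subset:
  assumes "\<theta> \<in> B 0" "N \<ge> 1" shows "polys N \<theta> \<subseteq> B 0"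
proof
  fix y assume "y \<in> polys N \<theta>"
  then obtain Z where Z: "finite Z" "Z \<subseteq> hensel N"
    "\<And>S. unramified_upto \<rho> N S \<Longrightarrow> K1 \<inter> B 0 \<subseteq> S \<Longrightarrow> Z \<subseteq> S \<Longrightarrow> y \<in> simple_extension S \<theta>" by (rule polysE) blast
  obtain S where S: "unramified_upto \<rho> N S" "K1 \<inter> B 0 \<subseteq> S" "Z \<subseteq> S" using adjoin_hensel[OF Z(1,2) assms(2)] by auto
  show "y \<in> B 0" using Z(3)[OF S] simple_extension_unramified(4)[OF S(1) assms(1)] by blast
qed

lemma polys_subring:
  assumes "\<theta> \<in> B 0" "N \<ge> 1" shows "subring (polys N \<theta>) R"
proof (rule subringI)
  note se = simple_extension_unramified[OF _ assms(1)]
  show "polys N \<theta> \<subseteq> carrier R" using polys_subset[OF assms] B_carrier by blast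
  show "\<one> \<in> polys N \<theta>" using polys_basic(1)[OF assms(1)] K1' by auto
  fix x assume "x \<in> polys N \<theta>"
  then obtain Z where Z: "finite Z" "Z \<subseteq> hensel N"
    "\<And>S. unramified_upto \<rho> N S \<Longrightarrow> K1 \<inter> B 0 \<subseteq> S \<Longrightarrow> Z \<subseteq> S \<Longrightarrow> x \<in> simple_extension S \<theta>" by (rule polysE) blast
  show "\<ominus> x \<in> polys N \<theta>" using Z subringE(5)[OF se(1)] by (intro polysI[of Z]) auto
  fix y assume "y \<in> polys N \<theta>"
  then obtain W where W: "finite W" "W \<subseteq> hensel N"
    "\<And>S. unramified_upto \<rho> N S \<Longrightarrow> K1 \<inter> B 0 \<subseteq> S \<Longrightarrow> W \<subseteq> S \<Longrightarrow> y \<in> simple_extension S \<theta>" by (rule polysE) blast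
  have u: "finite (Z \<union> W)" "Z \<union> W \<subseteq> hensel N" using Z W by auto
  show "x \<otimes> y \<in> polys N \<theta>" by (rule polysI[OF u]) (simp add: Z W subringE(6)[OF se(1)])
  show "x \<oplus> y \<in> polys N \<theta>" by (rule polysI[OF u]) (simp add: Z W subringE(7)[OF se(1)])
qed

text \<open>
  Expand \<open>b\<close> in powers of the uniformizer \<open>\<theta>\<close> of \<open>K2\<close>, with digits taken from
  \<open>hensel N\<close>. Digits represent all residue classes of \<open>K2\<close>, so each term removes the leading part of the
  remainder.
\<close>

lemma K2_approximation:
  assumes \<theta>: "\<theta> \<in> K2" "\<theta> \<noteq> \<zero>" "v \<theta> = v \<theta>0" and N: "N \<ge> 1" and b: "b \<in> K2" "b \<in> B 0"
  shows "\<exists>y\<in>polys N \<theta> \<inter> K2. b \<ominus> y \<in> B (int n)"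
proof (induct n)
  case 0
  have "b \<ominus> \<zero> \<in> B 0" using b by auto
  moreover have "\<theta> \<in> B 0" using \<theta> \<theta>0(3) K2' B_iff[of \<theta> 0] by auto
  hence "\<zero> \<in> polys N \<theta> \<inter> K2" using polys_basic(1)[of \<theta> N] K1' K2' by auto
  ultimately show ?case by force
next
  case (Suc n)
  have \<theta>c: "\<theta> \<in> carrier R" using \<theta> K2' by auto
  have \<theta>B: "\<theta> \<in> B 0" using \<theta> \<theta>c \<theta>0 B_iff by auto
  note P' = subringE[OF polys_subring[OF \<theta>B N]]
  note pb = polys_basic[OF \<theta>B, of N]
  obtain y where y: "y \<in> polys N \<theta>" "y \<in> K2" "b \<ominus> y \<in> B (int n)" using Suc by auto
  define r where "r = b \<ominus> y"
  have r: "r \<in> K2" "r \<in> B (int n)" "r \<in> carrier R" using y b K2' unfolding r_def by (auto simp: a_minus_def)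
  show ?case
  proof (cases "r \<in> B (int (Suc n))")
    case True thus ?thesis using y unfolding r_def by auto
  next
    case False
    hence rn: "r \<noteq> \<zero>" "v r = int n" using r notin_B[of r "int (Suc n)"] B_iff[of r "int n"] by auto
    hence "v \<theta>0 dvd int n" using div2 r by metis
    \<comment> \<open>The next term of the expansion is \<open>z \<otimes> \<theta>\<^sup>j\<close>, where \<open>z\<close> has the residue of
      \<open>c = r / \<theta>\<^sup>j\<close>.\<close>
    then obtain j0 where j0: "int n = v \<theta>0 * j0" by (elim dvdE)
    have "j0 \<ge> 0" using j0 \<theta>0(3) by (smt (verit, best) mult_pos_neg of_nat_0_le_iff)
    then obtain j where j: "j0 = int j" using nonneg_int_cases by blast
    let ?p = "\<theta> [^] j"
    have p: "?p \<in> polys N \<theta>" "?p \<in> K2" "?p \<in> carrier R" "?p \<noteq> \<zero>" "v ?p = int n"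
    proof -
      show "?p \<in> polys N \<theta>" "?p \<in> K2" using \<theta>(1) pb(3) P' K2' by (induct j) auto
      show "?p \<in> carrier R" "?p \<noteq> \<zero>" "v ?p = int n" using \<theta>c \<theta> j0 j by (auto simp: mult.commute)
    qed
    define c where "c = r \<otimes> inv ?p"
    have pi: "inv ?p \<in> K2" using subfield_m_inv(1)[OF K2, of ?p] p by auto
    have c: "c \<in> K2" "c \<in> carrier R" "c \<in> B 0" using pi r p K2' rn unfolding c_def by (auto simp: B_iff v_mult)
    obtain z where z: "z \<in> hensel N" "z \<ominus> c \<in> B 1" using hensel_lift[OF c(1,3) N] by auto
    have z2: "z \<in> K2" "z \<in> carrier R" using z K2' unfolding hensel_def by auto
    have bc: "b \<in> carrier R" "y \<in> carrier R" using b y K2'(1) by auto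
    have rc: "r = c \<otimes> ?p" unfolding c_def using r p by simp
    have "b \<ominus> (y \<oplus> z \<otimes> ?p) = r \<ominus> z \<otimes> ?p" unfolding r_def using bc z2(2) p(3) by algebra
    also have "\<dots> = ?p \<otimes> (c \<ominus> z)" unfolding rc using c z2 p(3) by algebra
    finally have "b \<ominus> (y \<oplus> z \<otimes> ?p) = ?p \<otimes> (c \<ominus> z)" .
    moreover have "?p \<in> B (int n)" using p B_iff by auto
    hence "?p \<otimes> (c \<ominus> z) \<in> B (int n + 1)" using B_mult[of ?p "int n" "c \<ominus> z" 1] B_minus_sym[OF z(2)] z2 c by auto
    moreover have "int (Suc n) = int n + 1" by simp
    ultimately have "b \<ominus> (y \<oplus> z \<otimes> ?p) \<in> B (int (Suc n))" by metis
    moreover have "y \<oplus> z \<otimes> ?p \<in> polys N \<theta> \<inter> K2" using y z p z2 pb P' K2' by auto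
    ultimately show ?thesis by blast
  qed
qed

text \<open>
  The unit \<open>u = \<theta>0\<^sup>e / \<pi>\<close> has the same residue as some \<open>z\<close> in \<open>hensel N\<close>. The quotient
  \<open>z / u\<close> is congruent to \<open>1\<close>, so by tameness it has an approximate \<open>e\<close>-th root \<open>s\<close>,
  and \<open>\<theta> = \<theta>0 \<otimes> s\<close> is as required.
\<close>

lemma tame_uniformizer:
  assumes N: "N \<ge> 1"
  shows "\<exists>\<theta> z. \<theta> \<in> K2 \<and> \<theta> \<noteq> \<zero> \<and> v \<theta> = v \<theta>0 \<and> z \<in> hensel N \<and> inv \<pi> \<otimes> \<theta> [^] e \<ominus> z \<in> B N"
proof -
  define u where "u = \<theta>0 [^] e \<otimes> inv \<pi>"
  have pe: "\<theta>0 [^] e \<in> K2" using \<theta>0 K2' by (induct e) auto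
  have pi: "inv \<pi> \<in> K2" "inv \<pi> \<in> carrier R" using subfield_m_inv(1)[OF K2, of \<pi>] \<pi> car by auto
  have u: "u \<in> K2" "u \<in> carrier R" "u \<noteq> \<zero>" "v u = 0"
    using pe pi K2' e(1) car \<theta>0(2) \<pi>(3) unfolding u_def by (auto simp: v_mult)
  hence u0: "u \<in> B 0" using B_iff by auto
  obtain z where z: "z \<in> hensel N" "z \<ominus> u \<in> B 1" using hensel_lift[OF u(1) u0 N] by auto
  have z2: "z \<in> K2" "z \<in> carrier R" using z K2' unfolding hensel_def by auto
  have ui: "inv u \<in> K2" "inv u \<in> carrier R" "inv u \<in> B 0"
    using subfield_m_inv(1)[OF K2, of u] u by (auto simp: B_iff)
  have "inv u \<otimes> z \<ominus> \<one> = inv u \<otimes> (z \<ominus> u)" using u z2 ui by (simp add: r_distr a_minus_def r_minus)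
  also have "\<dots> \<in> B 1" using ui z by auto
  finally have w: "inv u \<otimes> z \<ominus> \<one> \<in> B 1" "inv u \<otimes> z \<in> K2" using ui z2 K2' by auto
  obtain s where s: "s \<in> K2" "s \<in> B 0" "s \<ominus> \<one> \<in> B 1" "s [^] e \<ominus> inv u \<otimes> z \<in> B (int (nat N) + 1)"
    using root_approximation[OF K2 w(2,1) e(2,3)] by blast
  have sN: "s [^] e \<ominus> inv u \<otimes> z \<in> B N" by (rule B_mono[OF _ s(4)]) simp
  have sc: "s \<in> carrier R" using s K2' by auto
  have "s \<notin> B 1" using B_minus_cancel[OF s(3)] sc by auto
  hence s0: "s \<noteq> \<zero>" "v s = 0" using unit_inv[OF s(2)] by auto
  \<comment> \<open>Powers are abbreviated because rewriting would otherwise distribute them.\<close>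
  define x y where "x = \<theta>0 [^] e" and "y = s [^] e"
  have xy: "x \<in> carrier R" "y \<in> carrier R" using car sc unfolding x_def y_def by auto
  have "(\<theta>0 \<otimes> s) [^] e = x \<otimes> y" unfolding x_def y_def using car sc by (simp add: nat_pow_distrib)
  hence "inv \<pi> \<otimes> (\<theta>0 \<otimes> s) [^] e \<ominus> z = u \<otimes> y \<ominus> z"
    unfolding u_def x_def[symmetric] using xy pi by (simp add: m_ac)
  also have "\<dots> = u \<otimes> (y \<ominus> inv u \<otimes> z)"
    using u xy ui z2 by (simp add: r_distr a_minus_def r_minus)
  also have "\<dots> \<in> B N" using u0 sN unfolding y_def by auto
  finally have "inv \<pi> \<otimes> (\<theta>0 \<otimes> s) [^] e \<ominus> z \<in> B N" .
  moreover have "\<theta>0 \<otimes> s \<in> K2" "\<theta>0 \<otimes> s \<noteq> \<zero>" "v (\<theta>0 \<otimes> s) = v \<theta>0"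
    using \<theta>0 s s0 sc car K2' by (auto simp: v_mult)
  ultimately show ?thesis using z by blast
qed

text \<open>
  Put \<open>g = gcd (v \<rho>) (v \<theta>0)\<close>, \<open>k = v \<rho> / g\<close> and \<open>k2 = v \<theta>0 / g\<close>. As
  \<open>v \<rho>\<close> divides \<open>v \<pi> = e * v \<theta>0\<close> and \<open>k\<close> is coprime to \<open>k2\<close>, \<open>k\<close> divides
  \<open>e\<close>; let \<open>m = e / k\<close>. The unit \<open>\<eta> = \<theta>\<^sup>k / \<rho>\<^sup>k\<^sup>2\<close> is up to
  precision \<open>N\<close> a root of \<open>X\<^sup>m - q \<otimes> z\<close>, where \<open>q = \<pi> / \<rho>\<^sup>k\<^sup>2\<^sup>m\<close> is a unit of
  \<open>K1\<close>. Since \<open>m\<close> divides \<open>e\<close>, it is a unit too, the root is simple and \<open>\<eta>\<close> can be adjoined to the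
  unramified ring. Over the larger ring \<open>\<theta>\<close> is a root of \<open>X\<^sup>k - \<eta> \<otimes> \<rho>\<^sup>k\<^sup>2\<close>,
  and \<open>y\<close> becomes a polynomial of degree below \<open>k\<close> in \<open>\<theta>\<close>, whose terms have distinct
  values modulo \<open>v \<rho>\<close>.
\<close>

lemma value_of_approximable:
  assumes N: "N \<ge> 1" and \<theta>: "\<theta> \<in> K2" "\<theta> \<noteq> \<zero>" "v \<theta> = v \<theta>0"
    and z: "z \<in> hensel N" "inv \<pi> \<otimes> \<theta> [^] e \<ominus> z \<in> B N"
    and y: "y \<in> polys N \<theta>" "y \<notin> B N"
  shows "gcd (v \<rho>) (v \<theta>0) dvd v y"
proof -
  have \<theta>c: "\<theta> \<in> carrier R" using \<theta> K2' by auto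
  have \<theta>B: "\<theta> \<in> B 0" using \<theta> \<theta>c \<theta>0 B_iff by auto
  have zc: "z \<in> carrier R" using z K2' unfolding hensel_def by auto
  define g k k2 where "g = gcd (v \<rho>) (v \<theta>0)" and "k = nat (v \<rho> div g)" and "k2 = nat (v \<theta>0 div g)"
  have g: "g > 0" "g dvd v \<rho>" "g dvd v \<theta>0" using \<rho>(3) unfolding g_def by auto
  have k: "int k * g = v \<rho>" "int k2 * g = v \<theta>0"
    using g \<rho>(3) \<theta>0(3) unfolding k_def k2_def by (auto simp: pos_imp_zdiv_nonneg_iff)
  have k0: "0 < k" using k g \<rho>(3) by (cases k) auto
  have "int k = v \<rho> div g" "int k2 = v \<theta>0 div g" using k g(1) by (metis nonzero_mult_div_cancel_right less_irrefl)+
  hence cop: "coprime (int k) (int k2)" using \<rho>(3) unfolding g_def by (simp add: div_gcd_coprime)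
  have "int k dvd int e"
  proof -
    have "v \<rho> dvd v \<pi>" using div1 \<pi> by auto
    hence "int k * g dvd int e * int k2 * g" using e(1) k by (simp add: mult.assoc)
    hence "int k dvd int e * int k2" using g(1) by simp
    thus ?thesis using cop by (simp add: coprime_dvd_mult_left_iff)
  qed
  then obtain m where m: "e = k * m" by (auto elim: dvdE)
  have m0: "0 < m" using m e(2) by (cases m) auto
  have mu: "[m] \<cdot> \<one> \<notin> B 1"
  proof
    assume *: "[m] \<cdot> \<one> \<in> B 1"
    have "[n] \<cdot> ([m] \<cdot> \<one>) \<in> B 1" for n :: nat using * by (induct n) auto
    hence "[k] \<cdot> ([m] \<cdot> \<one>) \<in> B 1" .
    moreover have "[k] \<cdot> ([m] \<cdot> \<one>) = [e] \<cdot> \<one>" unfolding m using add.nat_pow_pow[of \<one> k m] by (simp add: mult.commute)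
    ultimately show False using e(3) by simp
  qed
  have \<rho>k: "\<rho> [^] n \<in> K1" "\<rho> [^] n \<in> carrier R" "\<rho> [^] n \<noteq> \<zero>" for n :: nat
    using \<rho> K1' car by (induct n) auto
  define \<eta> where "\<eta> = \<theta> [^] k \<otimes> inv (\<rho> [^] k2)"
  have \<eta>: "\<eta> \<in> carrier R" "\<eta> \<noteq> \<zero>" using \<theta>c \<rho>k \<theta> unfolding \<eta>_def by auto
  have "v \<eta> = int k * v \<theta>0 - int k2 * v \<rho>"
    unfolding \<eta>_def using \<theta>c \<rho>k \<theta> car \<rho>(2) by (simp add: v_mult)
  also have "\<dots> = 0" unfolding k[symmetric] by simp
  finally have v\<eta>: "v \<eta> = 0" .
  have \<eta>B: "\<eta> \<in> B 0" "\<eta> \<notin> B 1" using \<eta> v\<eta> by (simp_all add: B_iff)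
  note \<eta>u = \<eta>B(2)
  obtain Z where Z: "finite Z" "Z \<subseteq> hensel N"
    "\<And>S. unramified_upto \<rho> N S \<Longrightarrow> K1 \<inter> B 0 \<subseteq> S \<Longrightarrow> Z \<subseteq> S \<Longrightarrow> y \<in> simple_extension S \<theta>"
    using y(1) by (rule polysE) blast
  have "finite (insert z Z)" "insert z Z \<subseteq> hensel N" using Z z by auto
  then obtain S where S: "unramified_upto \<rho> N S" "K1 \<inter> B 0 \<subseteq> S" "insert z Z \<subseteq> S"
    using adjoin_hensel N by blast
  define q where "q = \<pi> \<otimes> inv (\<rho> [^] (k2 * m))"
  have q: "q \<in> K1" "q \<in> carrier R" "q \<noteq> \<zero>"
    using \<pi> car \<rho>k[of "k2 * m"] subfield_m_inv(1)[OF K1, of "\<rho> [^] (k2 * m)"] K1' unfolding q_def by auto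
  have "v q = v \<pi> - int (k2 * m) * v \<rho>"
    unfolding q_def using car \<pi>(3) \<rho>(2) \<rho>k by (simp add: v_mult)
  also have "v \<pi> = int (k2 * m) * v \<rho>" unfolding e(1) m k[symmetric] by (simp add: algebra_simps)
  finally have qB: "q \<in> B 0" using q B_iff by auto
  have Ss: "subring S R" "S \<subseteq> B 0" using S(1) unfolding unramified_upto_def by auto
  have qS: "q \<otimes> z \<in> S" using S(2,3) q(1) qB subringE(6)[OF Ss(1)] by auto
  have eq: "\<eta> [^] m \<ominus> q \<otimes> z \<in> B N"
  proof -
    define a b where "a = \<theta> [^] e" and "b = inv (\<rho> [^] (k2 * m))"
    have ab: "a \<in> carrier R" "b \<in> carrier R" using \<theta>c \<rho>k unfolding a_def b_def by auto
    have "\<eta> [^] m = (\<theta> [^] k) [^] m \<otimes> inv (\<rho> [^] k2) [^] m"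
      unfolding \<eta>_def using \<theta>c \<rho>k by (simp add: nat_pow_distrib)
    also have "inv (\<rho> [^] k2) [^] m = inv ((\<rho> [^] k2) [^] m)"
    proof (rule comm_inv_char[symmetric])
      show "(\<rho> [^] k2) [^] m \<otimes> inv (\<rho> [^] k2) [^] m = \<one>"
        using \<rho>k[of k2] nat_pow_distrib[of "\<rho> [^] k2" "inv (\<rho> [^] k2)" m] by simp
    qed (use \<rho>k[of k2] in auto)
    finally have "\<eta> [^] m = a \<otimes> b"
      unfolding a_def b_def m using \<theta>c car by (simp add: nat_pow_pow mult.commute)
    hence "\<eta> [^] m \<ominus> q \<otimes> z = a \<otimes> b \<ominus> \<pi> \<otimes> b \<otimes> z" unfolding q_def b_def by simp
    also have "\<dots> = (\<pi> \<otimes> inv \<pi>) \<otimes> a \<otimes> b \<ominus> \<pi> \<otimes> b \<otimes> z" using ab car \<pi> by simp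
    also have "\<dots> = (\<pi> \<otimes> b) \<otimes> (inv \<pi> \<otimes> a \<ominus> z)"
    proof -
      have "inv \<pi> \<in> carrier R" using \<pi> car by auto
      thus ?thesis using ab car(1) zc by algebra
    qed
    also have "\<dots> \<in> B N" using qB z(2) unfolding q_def a_def b_def by auto
    finally show ?thesis .
  qed
  have c: "q \<otimes> z \<in> carrier R" using q zc by auto
  let ?F = "replicate (m - 1) \<zero> @ [\<ominus> (q \<otimes> z)]"
  have F: "set ?F \<subseteq> S" using qS subringE[OF Ss(1)] by auto
  have F1: "eval (\<one> # ?F) \<eta> \<in> B N" using eq eval_power_minus[OF c \<eta>(1) m0] by simp
  have F2: "eval (deriv_list (\<one> # ?F)) \<eta> \<notin> B 1"
  proof -
    have "[n] \<cdot> \<one> \<in> B 0" for n :: nat by (induct n) auto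
    moreover have "\<eta> [^] n \<notin> B 1" for n :: nat
    proof (induct n)
      case (Suc n) thus ?case using unit_mult[OF B_pow[OF \<eta>B(1)] _ \<eta>B] by simp
    qed simp
    ultimately have "[m] \<cdot> \<one> \<otimes> \<eta> [^] (m - 1) \<notin> B 1" using mu \<eta>B(1) by (intro unit_mult) auto
    thus ?thesis using eval_deriv_power_minus[OF c \<eta>(1) m0] by simp
  qed
  obtain S' where S': "unramified_upto \<rho> N S'" "S \<subseteq> S'" "\<eta> \<in> S'"
    using adjoin_simple_root[OF t S(1) car(2) N F F1 F2 \<eta>B(1)] by auto
  have Ss': "subring S' R" "S' \<subseteq> B 0" using S'(1) unfolding unramified_upto_def by auto
  have "y \<in> simple_extension S' \<theta>" using Z(3)[OF S'(1)] S(2,3) S'(2) by blast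
  then obtain P where P: "set P \<subseteq> S'" "y = eval P \<theta>"
    using simple_extension_unramified(5)[OF S'(1) \<theta>B] by blast
  define c' where "c' = \<eta> \<otimes> \<rho> [^] k2"
  have "\<rho> [^] k2 \<in> K1 \<inter> B 0" using \<rho>k \<rho>(3) car \<rho>(2) by (auto simp: B_iff)
  hence c': "c' \<in> S'" using S'(2,3) S(2) subringE(6)[OF Ss'(1)] unfolding c'_def by blast
  have c'c: "c' \<in> carrier R" using c' Ss' by auto
  have \<theta>k: "\<theta> [^] k = c'" unfolding c'_def \<eta>_def using \<theta>c \<rho>k by simp
  let ?h = "replicate (k - 1) \<zero> @ [\<ominus> c']"
  have h: "set ?h \<subseteq> S'" using c' subringE[OF Ss'(1)] by auto
  obtain Q E where E: "set E \<subseteq> S'" "length E \<le> length ?h" "set Q \<subseteq> S'"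
    "\<forall>x\<in>carrier R. eval P x = eval Q x \<otimes> eval (\<one> # ?h) x \<oplus> eval E x"
    using monic_division[OF Ss'(1) h P(1)] by blast
  have "eval (\<one> # ?h) \<theta> = \<zero>" using eval_power_minus[OF c'c \<theta>c k0] \<theta>k c'c by (simp add: a_minus_def r_neg)
  moreover have "eval Q \<theta> \<in> carrier R" "eval E \<theta> \<in> carrier R" using E Ss' \<theta>c by (auto intro!: eval_in_carrier)
  moreover have "y = eval Q \<theta> \<otimes> eval (\<one> # ?h) \<theta> \<oplus> eval E \<theta>" unfolding P(2) using E(4) \<theta>c by blast
  ultimately have yE: "y = eval E \<theta>" by (simp del: eval.simps)
  have dist: "i = j" if "i < k" "j < k" "v \<rho> dvd (int i * v \<theta>0 - int j * v \<theta>0)" for i j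
  proof -
    have "int i * v \<theta>0 - int j * v \<theta>0 = ((int i - int j) * int k2) * g"
      unfolding k(2)[symmetric] by (simp add: algebra_simps)
    hence "int k * g dvd ((int i - int j) * int k2) * g" using that(3) k(1) by simp
    hence "int k dvd (int i - int j) * int k2" using g(1) by simp
    hence "int k dvd int i - int j" using cop by (simp add: coprime_dvd_mult_left_iff)
    hence "int i mod int k = int j mod int k" by (simp add: mod_eq_dvd_iff)
    thus ?thesis using that by simp
  qed
  have "eval E \<theta> \<in> B N \<or> (\<exists>j<length E. v \<rho> dvd v (eval E \<theta>) - int j * v \<theta>0)"
  proof (rule distinct_values[OF \<theta>c \<theta>(2,3) \<theta>B _ _ dist E(1)])
    show "v \<rho> dvd v x" if "x \<in> S'" "x \<notin> B N" for x
      using unramified_value[OF S'(1) car(2) \<rho>(2,3) that] .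
  qed (use Ss' E(2) k0 in auto)
  then obtain j where "v \<rho> dvd v y - int j * v \<theta>0" using yE y(2) by auto
  hence "g dvd v y - int j * v \<theta>0" using g(2) dvd_trans by blast
  moreover have "g dvd int j * v \<theta>0" using g(3) by simp
  ultimately have "g dvd (v y - int j * v \<theta>0) + int j * v \<theta>0" by (rule dvd_add)
  hence "g dvd v y" by simp
  thus ?thesis unfolding g_def .
qed

lemma generate_ring_approximation:
  assumes N: "N \<ge> 1" and \<theta>: "\<theta> \<in> K2" "\<theta> \<noteq> \<zero>" "v \<theta> = v \<theta>0"
    and a: "a \<in> generate_ring R ((K1 \<union> K2) \<inter> B 0)"
  shows "a \<in> B 0 \<and> (\<exists>y\<in>polys N \<theta>. a \<ominus> y \<in> B N)"
proof -
  have \<theta>c: "\<theta> \<in> carrier R" using \<theta> K2' by auto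
  have \<theta>B: "\<theta> \<in> B 0" using \<theta> \<theta>c \<theta>0 B_iff by auto
  note P' = subringE[OF polys_subring[OF \<theta>B N]]
  note pb = polys_basic[OF \<theta>B, of N]
  have P0: "y \<in> B 0" "y \<in> carrier R" if "y \<in> polys N \<theta>" for y using that polys_subset[OF \<theta>B N] by auto
  have self: "x \<ominus> x \<in> B N" if "x \<in> carrier R" for x using that by (simp add: a_minus_def r_neg)
  show ?thesis using a
  proof (induct a)
    case one thus ?case using P' self by (intro conjI bexI[of _ \<one>]) auto
  next
    case (incl h)
    hence h: "h \<in> B 0" "h \<in> K1 \<or> h \<in> K2" by auto
    show ?case
    proof (cases "h \<in> K1")
      case True thus ?thesis using h pb(1) self by (intro conjI bexI[of _ h]) auto
    next
      case False
      obtain y where "y \<in> polys N \<theta>" "h \<ominus> y \<in> B (int (nat N))"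
        using K2_approximation[OF \<theta> N, of h "nat N"] h False by auto
      thus ?thesis using h N by (intro conjI bexI[of _ y]) auto
    qed
  next
    case (a_inv x)
    then obtain y where y: "y \<in> polys N \<theta>" "x \<ominus> y \<in> B N" "x \<in> B 0" by auto
    have "\<ominus> x \<ominus> \<ominus> y = \<ominus> (x \<ominus> y)" using B_carr[OF y(3)] P0(2)[OF y(1)] by algebra
    also have "\<dots> \<in> B N" by (rule B_uminus[OF y(2)])
    finally show ?case by (rule conjI[OF B_uminus[OF y(3)] bexI[OF _ P'(5)[OF y(1)]]])
  next
    case (eng_add x1 x2)
    then obtain y1 y2 where y: "y1 \<in> polys N \<theta>" "x1 \<ominus> y1 \<in> B N" "x1 \<in> B 0"
      "y2 \<in> polys N \<theta>" "x2 \<ominus> y2 \<in> B N" "x2 \<in> B 0" by auto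
    have "x1 \<oplus> x2 \<ominus> (y1 \<oplus> y2) = (x1 \<ominus> y1) \<oplus> (x2 \<ominus> y2)"
      using B_carr[OF y(3)] B_carr[OF y(6)] P0(2)[OF y(1)] P0(2)[OF y(4)] by algebra
    also have "\<dots> \<in> B N" by (rule B_add[OF y(2,5)])
    finally show ?case by (rule conjI[OF B_add[OF y(3,6)] bexI[OF _ P'(7)[OF y(1,4)]]])
  next
    case (eng_mult x1 x2)
    then obtain y1 y2 where y: "y1 \<in> polys N \<theta>" "x1 \<ominus> y1 \<in> B N" "x1 \<in> B 0"
      "y2 \<in> polys N \<theta>" "x2 \<ominus> y2 \<in> B N" "x2 \<in> B 0" by auto
    have "x1 \<otimes> x2 \<ominus> (y1 \<otimes> y2) = (x1 \<ominus> y1) \<otimes> x2 \<oplus> y1 \<otimes> (x2 \<ominus> y2)"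
      using B_carr[OF y(3)] B_carr[OF y(6)] P0(2)[OF y(1)] P0(2)[OF y(4)] by algebra
    also have "\<dots> \<in> B N" by (rule B_add[OF B_mult0(2)[OF y(2,6)] B_mult0(1)[OF P0(1)[OF y(1)] y(5)]])
    finally show ?case by (rule conjI[OF B_mult0(1)[OF y(3,6)] bexI[OF _ P'(6)[OF y(1,4)]]])
  qed
qed

theorem value_group_compositum:
  assumes x: "x \<in> carrier R" "x \<noteq> \<zero>"
  shows "gcd (v \<rho>) (v \<theta>0) dvd v x"
proof -
  let ?H = "(K1 \<union> K2) \<inter> B 0" let ?W = "generate_ring R ?H"
  have H: "?H \<subseteq> carrier R" using B_carrier by auto
  have W: "subring ?W R" by (rule generate_ring_is_subring[OF H])
  note W' = subringE[OF W]
  have ring_case: "gcd (v \<rho>) (v \<theta>0) dvd v a" if a: "a \<in> ?W" "a \<noteq> \<zero>" for a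
  proof -
    \<comment> \<open>A precision just above the value of \<open>a\<close>, so that approximations to \<open>a\<close> have the same value.\<close>
    define N where "N = max 1 (v a + 1)"
    have N: "N \<ge> 1" "v a < N" unfolding N_def by auto
    obtain \<theta> z where \<theta>: "\<theta> \<in> K2" "\<theta> \<noteq> \<zero>" "v \<theta> = v \<theta>0" and z: "z \<in> hensel N" "inv \<pi> \<otimes> \<theta> [^] e \<ominus> z \<in> B N"
      using tame_uniformizer[OF N(1)] by blast
    obtain y where y: "y \<in> polys N \<theta>" "a \<ominus> y \<in> B N" and aB: "a \<in> B 0"
      using generate_ring_approximation[OF N(1) \<theta> a(1)] by blast
    have "\<theta> \<in> B 0" using \<theta> K2' \<theta>0(3) B_iff[of \<theta> 0] by auto
    hence yc: "y \<in> carrier R" using polys_subset[OF _ N(1), of \<theta>] y(1) by auto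
    have ac: "a \<in> carrier R" using aB by auto
    have aN: "a \<notin> B N" using a(2) ac N(2) notin_B by auto
    note c = v_cong[OF ac yc B_minus_sym[OF y(2) ac yc] aN]
    show ?thesis using value_of_approximable[OF N(1) \<theta> z y(1) c(4)] c(2) by simp
  qed
  \<comment> \<open>Of each nonzero element of \<open>K1\<close> or \<open>K2\<close> and its inverse, one is in the valuation ring.\<close>
  have "K1 \<union> K2 \<subseteq> fraction_field R ?W"
  proof
    fix h assume h: "h \<in> K1 \<union> K2"
    hence hc: "h \<in> carrier R" using K1' K2' by auto
    show "h \<in> fraction_field R ?W"
    proof (cases "h \<in> B 0")
      case True
      thus ?thesis using h fraction_field_incl[OF W] generate_ring.incl[of h ?H R] by auto
    next
      case False
      hence hn: "h \<noteq> \<zero>" "v h < 0" using notin_B hc by auto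
      hence "inv h \<in> K1 \<union> K2" using h subfield_m_inv(1)[OF K1, of h] subfield_m_inv(1)[OF K2, of h] by auto
      moreover have "inv h \<in> B 0" using hn hc by (simp add: B_iff)
      ultimately have "inv h \<in> ?W" using generate_ring.incl[of "inv h" ?H R] by auto
      moreover have "h = \<one> \<otimes> inv (inv h)" "inv h \<noteq> \<zero>" using hn hc by auto
      ultimately show ?thesis unfolding fraction_field_def using W'(3) by blast
    qed
  qed
  hence "carrier R \<subseteq> fraction_field R ?W"
    unfolding gen using K1' K2' by (intro generate_field_min_subfield1[OF _ fraction_field_subfield[OF W]]) auto
  then obtain a b where ab: "x = a \<otimes> inv b" "a \<in> ?W" "b \<in> ?W" "b \<noteq> \<zero>"
    using x unfolding fraction_field_def by blast
  have abc: "a \<in> carrier R" "b \<in> carrier R" using ab W' by auto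
  hence "a \<noteq> \<zero>" using x ab by auto
  hence "v x = v a - v b" using ab abc by (simp add: v_mult)
  thus ?thesis using ring_case[OF ab(2) \<open>a \<noteq> \<zero>\<close>] ring_case[OF ab(3,4)] by simp
qed

end

section \<open>Noetherian rings and integral elements\<close>

context cring begin

text \<open>
  Ideals of a subring are described by the operations of the ambient ring alone, so that the same set can be used in
  every ring record with these operations.
\<close>

lemma ideal_subring_iff:
  assumes A: "subring A R"
  shows "ideal I (R\<lparr>carrier := A\<rparr>) \<longleftrightarrow> I \<subseteq> A \<and> \<zero> \<in> I \<and> (\<forall>x\<in>I. \<forall>y\<in>I. x \<oplus> y \<in> I) \<and> (\<forall>a\<in>A. \<forall>x\<in>I. a \<otimes> x \<in> I)"
    (is "?l \<longleftrightarrow> ?r")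
proof -
  interpret S: cring "R\<lparr>carrier := A\<rparr>"
    using subring_is_ring[OF A] subcring_iff[OF subringE(1)[OF A]] subcringI'[OF A] by auto
  show ?thesis
  proof
    assume ?l
    then interpret ideal I "R\<lparr>carrier := A\<rparr>" .
    show ?r using a_subset zero_closed a_closed I_l_closed by auto
  next
    assume r: ?r
    show ?l
    proof (rule idealI)
      show "ring (R\<lparr>carrier := A\<rparr>)" by (rule S.ring_axioms)
      show "subgroup I (add_monoid (R\<lparr>carrier := A\<rparr>))"
      proof (rule S.add.subgroupI)
        fix x assume x: "x \<in> I"
        hence xA: "x \<in> carrier (R\<lparr>carrier := A\<rparr>)" using r by auto
        have "\<ominus>\<^bsub>R\<lparr>carrier := A\<rparr>\<^esub> x = \<ominus>\<^bsub>R\<lparr>carrier := A\<rparr>\<^esub> \<one>\<^bsub>R\<lparr>carrier := A\<rparr>\<^esub> \<otimes>\<^bsub>R\<lparr>carrier := A\<rparr>\<^esub> x"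
          using xA S.l_minus[OF S.one_closed xA] S.l_one[OF xA] by simp
        also have "\<dots> \<in> I" using r x S.a_inv_closed[OF S.one_closed] by simp
        finally show "\<ominus>\<^bsub>R\<lparr>carrier := A\<rparr>\<^esub> x \<in> I" .
      qed (use r in auto)
      fix a x assume "a \<in> I" "x \<in> carrier (R\<lparr>carrier := A\<rparr>)"
      moreover from this have "a \<in> carrier R" "x \<in> carrier R" using r subringE(1)[OF A] by auto
      hence "a \<otimes> x = x \<otimes> a" by (rule m_comm)
      ultimately show "x \<otimes>\<^bsub>R\<lparr>carrier := A\<rparr>\<^esub> a \<in> I" "a \<otimes>\<^bsub>R\<lparr>carrier := A\<rparr>\<^esub> x \<in> I" using r by auto
    qed
  qed
qed

lemma subring_cring: "subring A R \<Longrightarrow> cring (R\<lparr>carrier := A\<rparr>)"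
  using subcring_iff subringE(1) subcringI' by blast

lemma primeideal_subring_iff:
  assumes A: "subring A R"
  shows "primeideal P (R\<lparr>carrier := A\<rparr>) \<longleftrightarrow> ideal P (R\<lparr>carrier := A\<rparr>) \<and> \<one> \<notin> P \<and>
    (\<forall>a\<in>A. \<forall>b\<in>A. a \<otimes> b \<in> P \<longrightarrow> a \<in> P \<or> b \<in> P)" (is "?l \<longleftrightarrow> ?r")
proof
  assume l: ?l
  have i: "ideal P (R\<lparr>carrier := A\<rparr>)" using l by (simp add: primeideal_def)
  have "\<one> \<notin> P" using ideal.one_imp_carrier[OF i] primeideal.I_notcarr[OF l] by auto
  moreover have "a \<in> P \<or> b \<in> P" if "a \<in> A" "b \<in> A" "a \<otimes> b \<in> P" for a b
    using primeideal.I_prime[OF l, of a b] that by auto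
  ultimately show ?r using i by blast
next
  assume r: ?r
  show ?l using r subring_cring[OF A] subringE(3)[OF A] by (intro primeidealI) auto
qed

text \<open>
  By maximality, \<open>\<pp>\<close> and \<open>a\<close> together generate the unit ideal.
\<close>

lemma inverse_modulo_maximal_ideal:
  assumes A: "subring A R" and pm: "maximalideal \<pp> (R\<lparr>carrier := A\<rparr>)" and a: "a \<in> A - \<pp>"
  shows "\<exists>b\<in>A. \<exists>x\<in>\<pp>. a \<otimes> b = x \<oplus> \<one>"
proof -
  note A' = subringE[OF A]
  have pi: "\<pp> \<subseteq> A" "\<zero> \<in> \<pp>" "\<And>x y. x \<in> \<pp> \<Longrightarrow> y \<in> \<pp> \<Longrightarrow> x \<oplus> y \<in> \<pp>" "\<And>a x. a \<in> A \<Longrightarrow> x \<in> \<pp> \<Longrightarrow> a \<otimes> x \<in> \<pp>"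
    using maximalideal.axioms(1)[OF pm] unfolding ideal_subring_iff[OF A] by auto
  define I where "I = {x \<oplus> b \<otimes> a | x b. x \<in> \<pp> \<and> b \<in> A}"
  have ac: "a \<in> carrier R" using a A' by auto
  have "ideal I (R\<lparr>carrier := A\<rparr>)" unfolding ideal_subring_iff[OF A]
  proof (intro conjI ballI)
    show "I \<subseteq> A" unfolding I_def using pi A' a by auto
    have "\<zero> = \<zero> \<oplus> \<zero> \<otimes> a" using ac by simp
    thus "\<zero> \<in> I" unfolding I_def using pi(2) A'(2) by blast
    fix y z assume "y \<in> I"
    then obtain x b where y: "y = x \<oplus> b \<otimes> a" "x \<in> \<pp>" "b \<in> A" unfolding I_def by auto
    have yc: "x \<in> carrier R" "b \<in> carrier R" using y pi(1) A' by auto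
    { assume "z \<in> I"
      then obtain x' b' where z: "z = x' \<oplus> b' \<otimes> a" "x' \<in> \<pp>" "b' \<in> A" unfolding I_def by auto
      have zc: "x' \<in> carrier R" "b' \<in> carrier R" using z pi(1) A' by auto
      have "y \<oplus> z = (x \<oplus> x') \<oplus> (b \<oplus> b') \<otimes> a" unfolding y z using yc zc ac by algebra
      thus "y \<oplus> z \<in> I" unfolding I_def using pi(3)[OF y(2) z(2)] A'(7)[OF y(3) z(3)] by blast }
    { assume z: "z \<in> A"
      have zc: "z \<in> carrier R" using z A' by auto
      have "z \<otimes> y = z \<otimes> x \<oplus> (z \<otimes> b) \<otimes> a" unfolding y using yc zc ac by algebra
      thus "z \<otimes> y \<in> I" unfolding I_def using pi(4)[OF z y(2)] A'(6)[OF z y(3)] by blast }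
  qed
  moreover have "\<pp> \<subseteq> I"
  proof
    fix x assume x: "x \<in> \<pp>"
    hence "x = x \<oplus> \<zero> \<otimes> a" using ac pi(1) A'(1) by auto
    thus "x \<in> I" unfolding I_def using x A'(2) by blast
  qed
  moreover have "I \<subseteq> A" unfolding I_def using pi A' a by auto
  ultimately have "I = \<pp> \<or> I = A" using maximalideal.I_maximal[OF pm, of I] by simp
  moreover have "a \<in> I"
  proof -
    have "a = \<zero> \<oplus> \<one> \<otimes> a" using ac by simp
    thus ?thesis unfolding I_def using pi(2) A'(3) by blast
  qed
  ultimately have "\<one> \<in> I" using a A'(3) by auto
  then obtain x b where xb: "\<one> = x \<oplus> b \<otimes> a" "x \<in> \<pp>" "b \<in> A" unfolding I_def by auto
  have c: "x \<in> carrier R" "b \<in> carrier R" using xb pi(1) A' by auto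
  have "\<ominus> \<one> \<otimes> x \<in> \<pp>" using pi(4) xb(2) A' by auto
  moreover have "a \<otimes> b = (\<ominus> \<one> \<otimes> x) \<oplus> (x \<oplus> b \<otimes> a)" using c ac by algebra
  hence "a \<otimes> b = (\<ominus> \<one> \<otimes> x) \<oplus> \<one>" unfolding xb(1)[symmetric] .
  ultimately show ?thesis using xb(3) by blast
qed

lemma ascending_ideals_stable:
  assumes A: "subring A R" and N: "noetherian_ring (R\<lparr>carrier := A\<rparr>)"
    and I: "\<And>k::nat. ideal (I k) (R\<lparr>carrier := A\<rparr>)" "\<And>k. I k \<subseteq> I (Suc k)"
  shows "\<exists>k. \<forall>m\<ge>k. I m = I k"
proof -
  have mono: "I i \<subseteq> I j" if "i \<le> j" for i j using that I(2) by (rule lift_Suc_mono_le[rotated])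
  have "subset.chain {J. ideal J (R\<lparr>carrier := A\<rparr>)} (range I)"
    unfolding subset_chain_def
  proof (intro conjI ballI)
    fix U V assume "U \<in> range I" "V \<in> range I"
    then obtain i j where "U = I i" "V = I j" by auto
    thus "U \<subseteq> V \<or> V \<subseteq> U" using mono[of i j] mono[of j i] by (cases "i \<le> j") auto
  qed (use I(1) in auto)
  hence "\<Union>(range I) \<in> range I" by (intro noetherian_ring.ideal_chain_is_trivial[OF N]) auto
  then obtain k where "\<Union>(range I) = I k" by auto
  hence "\<forall>m\<ge>k. I m = I k" using mono by blast
  thus ?thesis by blast
qed

lemma maximal_ideal_in_family:
  assumes A: "subring A R" and N: "noetherian_ring (R\<lparr>carrier := A\<rparr>)"
    and I: "\<And>J. J \<in> F \<Longrightarrow> ideal J (R\<lparr>carrier := A\<rparr>)" "F \<noteq> {}"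
  shows "\<exists>M\<in>F. \<forall>J\<in>F. M \<subseteq> J \<longrightarrow> J = M"
proof (rule subset_Zorn_nonempty[OF I(2)])
  fix C assume C: "C \<noteq> {}" "subset.chain F C"
  hence "subset.chain {J. ideal J (R\<lparr>carrier := A\<rparr>)} C" using I(1) by (auto simp: subset_chain_def)
  hence "\<Union>C \<in> C" using noetherian_ring.ideal_chain_is_trivial[OF N] C(1) by blast
  thus "\<Union>C \<in> F" using C(2) by (auto simp: subset_chain_def)
qed

text \<open>
  The \<open>A\<close>-module generated by the powers of \<open>x\<close> with exponent below \<open>n\<close>.
\<close>

definition power_span :: "'a set \<Rightarrow> 'a \<Rightarrow> nat \<Rightarrow> 'a set" where
  "power_span A x n = {eval r x | r. set r \<subseteq> A \<and> length r = n}"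

context
  fixes A x
  assumes A: "subring A R" and x: "x \<in> carrier R"
begin

lemma power_span_carrier: "power_span A x n \<subseteq> carrier R"
  unfolding power_span_def using eval_in_carrier[OF _ x] subringE(1)[OF A] by blast

lemma power_span_le:
  assumes "set r \<subseteq> A" "length r \<le> n" shows "eval r x \<in> power_span A x n"
proof -
  have "eval (replicate (n - length r) \<zero> @ r) x = eval r x"
    using eval_replicate[OF _ x] assms(1) subringE(1)[OF A] by blast
  moreover have "set (replicate (n - length r) \<zero> @ r) \<subseteq> A" using assms(1) subringE(2)[OF A] by auto
  moreover have "length (replicate (n - length r) \<zero> @ r) = n" using assms(2) by simp
  ultimately show ?thesis unfolding power_span_def by (smt (verit) mem_Collect_eq)
qed

lemma power_span_zero: "\<zero> \<in> power_span A x n"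
  using power_span_le[of "[]" n] by simp

lemma power_span_mono: "power_span A x n \<subseteq> power_span A x (Suc n)"
proof
  fix y assume "y \<in> power_span A x n"
  then obtain r where "y = eval r x" "set r \<subseteq> A" "length r = n" unfolding power_span_def by auto
  thus "y \<in> power_span A x (Suc n)" using power_span_le[of r "Suc n"] by simp
qed

lemma power_span_add:
  assumes "y \<in> power_span A x n" "z \<in> power_span A x n" shows "y \<oplus> z \<in> power_span A x n"
proof -
  note A' = subringE[OF A]
  obtain r s where r: "y = eval r x" "set r \<subseteq> A" "length r = n" and s: "z = eval s x" "set s \<subseteq> A" "length s = n"
    using assms unfolding power_span_def by auto
  let ?q = "map2 (\<lambda>a b. a \<ominus> (\<ominus> \<one>) \<otimes> b) r s"
  have rs: "set r \<subseteq> carrier R" "set s \<subseteq> carrier R" using r s A' by auto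
  have "eval ?q x = y \<ominus> (\<ominus> \<one>) \<otimes> z"
    unfolding r(1) s(1) by (rule eval_map2_minus) (use r s rs x in auto)
  also have "\<dots> = y \<oplus> z" using power_span_carrier assms by (simp add: subset_iff l_minus a_minus_def)
  finally have "eval ?q x = y \<oplus> z" .
  moreover have "set ?q \<subseteq> A"
  proof
    fix w assume "w \<in> set ?q"
    then obtain a b where "(a, b) \<in> set (zip r s)" "w = a \<ominus> (\<ominus> \<one>) \<otimes> b" by auto
    moreover then have "a \<in> A" "b \<in> A" using r s by (auto dest: set_zip_leftD set_zip_rightD)
    ultimately show "w \<in> A" using A' by (simp add: a_minus_def)
  qed
  ultimately show ?thesis using power_span_le[of ?q n] r(3) s(3) by simp
qed

lemma power_span_smult:
  assumes "y \<in> power_span A x n" "a \<in> A" shows "a \<otimes> y \<in> power_span A x n"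
proof -
  note A' = subringE[OF A]
  obtain r where r: "y = eval r x" "set r \<subseteq> A" "length r = n"
    using assms unfolding power_span_def by auto
  have "set r \<subseteq> carrier R" "a \<in> carrier R" using r A' assms by auto
  hence "eval (map (\<lambda>c. a \<otimes> c) r) x = a \<otimes> y" using eval_smult x r by simp
  moreover have "set (map (\<lambda>c. a \<otimes> c) r) \<subseteq> A" using r assms A' by auto
  ultimately show ?thesis using power_span_le[of "map (\<lambda>c. a \<otimes> c) r" n] r(3) by simp
qed

lemma power_span_Suc:
  assumes "y \<in> power_span A x (Suc n)"
  shows "\<exists>a\<in>A. \<exists>z\<in>power_span A x n. y = a \<otimes> x [^] n \<oplus> z"
proof -
  obtain r where r: "y = eval r x" "set r \<subseteq> A" "length r = Suc n"
    using assms unfolding power_span_def by auto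
  then obtain a s where "r = a # s" by (cases r) auto
  thus ?thesis using r power_span_le[of s n] by auto
qed

lemma power_span_SucI:
  assumes "z \<in> power_span A x n" "a \<in> A"
  shows "a \<otimes> x [^] n \<oplus> z \<in> power_span A x (Suc n)"
proof -
  obtain r where r: "z = eval r x" "set r \<subseteq> A" "length r = n"
    using assms unfolding power_span_def by auto
  thus ?thesis using power_span_le[of "a # r" "Suc n"] assms by auto
qed

text \<open>
  Submodules of a finitely generated module over a noetherian ring satisfy the ascending chain condition. The
  induction on \<open>n\<close> splits a submodule into the ideal \<open>J\<close> of its coefficients at
  \<open>x\<^sup>n\<close> and its intersection with the span of the lower powers.
\<close>

lemma ascending_submodules_stable:
  assumes N: "noetherian_ring (R\<lparr>carrier := A\<rparr>)"
    and M: "\<And>k::nat. M k \<subseteq> power_span A x n" "\<And>k. M k \<subseteq> M (Suc k)" "\<And>k. \<zero> \<in> M k"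
      "\<And>k y z. y \<in> M k \<Longrightarrow> z \<in> M k \<Longrightarrow> y \<oplus> z \<in> M k" "\<And>k y a. y \<in> M k \<Longrightarrow> a \<in> A \<Longrightarrow> a \<otimes> y \<in> M k"
  shows "\<exists>k. \<forall>m\<ge>k. M m = M k"
  using M
proof (induct n arbitrary: M)
  case 0
  have "M k = {\<zero>}" for k using 0(1,3)[of k] unfolding power_span_def by auto
  thus ?case by blast
next
  case (Suc n)
  note A' = subringE[OF A]
  note M = Suc(2-6)
  have mono: "M i \<subseteq> M j" if "i \<le> j" for i j using that M(2) by (rule lift_Suc_mono_le[rotated])
  define J where "J k = {a \<in> A. \<exists>z\<in>power_span A x n. a \<otimes> x [^] n \<oplus> z \<in> M k}" for k
  have xn: "x [^] n \<in> carrier R" using x by simp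
  have psc: "z \<in> carrier R" if "z \<in> power_span A x n" for z using that power_span_carrier by auto
  have "ideal (J k) (R\<lparr>carrier := A\<rparr>)" for k
    unfolding ideal_subring_iff[OF A]
  proof (intro conjI ballI)
    have "\<zero> \<otimes> x [^] n \<oplus> \<zero> = \<zero>" using xn by simp
    thus "\<zero> \<in> J k" unfolding J_def using A' power_span_zero M(3)[of k] by (auto intro!: bexI[of _ \<zero>])
    fix a b assume a: "a \<in> J k"
    then obtain z where z: "a \<in> A" "z \<in> power_span A x n" "a \<otimes> x [^] n \<oplus> z \<in> M k" unfolding J_def by auto
    have ac: "a \<in> carrier R" "z \<in> carrier R" using z psc A' by auto
    { assume "b \<in> J k"
      then obtain w where w: "b \<in> A" "w \<in> power_span A x n" "b \<otimes> x [^] n \<oplus> w \<in> M k" unfolding J_def by auto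
      have bc: "b \<in> carrier R" "w \<in> carrier R" using w psc A' by auto
      have "(a \<oplus> b) \<otimes> x [^] n \<oplus> (z \<oplus> w) = (a \<otimes> x [^] n \<oplus> z) \<oplus> (b \<otimes> x [^] n \<oplus> w)"
        using ac bc xn by algebra
      also have "\<dots> \<in> M k" using M(4) z w by auto
      finally show "a \<oplus> b \<in> J k" unfolding J_def using z w A' power_span_add by auto }
    { assume b: "b \<in> A"
      have bc: "b \<in> carrier R" using b A' by auto
      have "(b \<otimes> a) \<otimes> x [^] n \<oplus> b \<otimes> z = b \<otimes> (a \<otimes> x [^] n \<oplus> z)"
        using ac bc xn by algebra
      also have "\<dots> \<in> M k" using M(5) z b by auto
      finally show "b \<otimes> a \<in> J k" unfolding J_def using z b A' power_span_smult by auto }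
  qed (auto simp: J_def)
  moreover have "J k \<subseteq> J (Suc k)" for k unfolding J_def using M(2) by blast
  ultimately obtain k1 where k1: "\<forall>m\<ge>k1. J m = J k1" using ascending_ideals_stable[OF A N] by metis
  have "\<exists>k. \<forall>m\<ge>k. M m \<inter> power_span A x n = M k \<inter> power_span A x n"
  proof (rule Suc(1)[of "\<lambda>k. M k \<inter> power_span A x n"])
    fix k show "M k \<inter> power_span A x n \<subseteq> M (Suc k) \<inter> power_span A x n" using M(2) by auto
  qed (use M(3-5) power_span_zero power_span_add power_span_smult in auto)
  then obtain k2 where k2: "\<forall>m\<ge>k2. M m \<inter> power_span A x n = M k2 \<inter> power_span A x n" by auto
  define k where "k = max k1 k2"
  have "M m \<subseteq> M k" if m: "m \<ge> k" for m
  proof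
    fix y assume y: "y \<in> M m"
    obtain a z where z: "a \<in> A" "z \<in> power_span A x n" "y = a \<otimes> x [^] n \<oplus> z"
      using power_span_Suc M(1) y by blast
    hence "a \<in> J m" unfolding J_def using y by auto
    moreover have "J m = J k" using k1 m unfolding k_def by (metis le_trans max.cobounded1)
    ultimately obtain w where w: "w \<in> power_span A x n" "a \<otimes> x [^] n \<oplus> w \<in> M k" unfolding J_def by auto
    have wm: "a \<otimes> x [^] n \<oplus> w \<in> M m" using w mono m by auto
    have c: "a \<in> carrier R" "z \<in> carrier R" "w \<in> carrier R" using z w psc A' by auto
    have m1: "\<ominus> \<one> \<in> A" using A' by auto
    have "z \<oplus> \<ominus> \<one> \<otimes> w = y \<oplus> \<ominus> \<one> \<otimes> (a \<otimes> x [^] n \<oplus> w)" unfolding z(3) using c xn by algebra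
    also have "\<dots> \<in> M m" using M(4,5) m1 y wm by auto
    finally have "z \<oplus> \<ominus> \<one> \<otimes> w \<in> M m \<inter> power_span A x n" using power_span_add power_span_smult m1 z w by auto
    also have "\<dots> = M k \<inter> power_span A x n" using k2 m unfolding k_def by (metis le_trans max.cobounded2)
    finally have "(z \<oplus> \<ominus> \<one> \<otimes> w) \<oplus> (a \<otimes> x [^] n \<oplus> w) \<in> M k" using w M(4) by auto
    moreover have "(z \<oplus> \<ominus> \<one> \<otimes> w) \<oplus> (a \<otimes> x [^] n \<oplus> w) = y" unfolding z(3) using c xn by algebra
    ultimately show "y \<in> M k" by simp
  qed
  hence "\<forall>m\<ge>k. M m = M k" using mono by blast
  thus ?case by blast
qed

end

end

context domain begin

lemma integral_closure_iff:
  assumes "subring A R"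
  shows "x \<in> integral_closure R A E \<longleftrightarrow> x \<in> E \<and> (\<exists>fs. set fs \<subseteq> A \<and> eval (\<one> # fs) x = \<zero>)"
proof
  assume "x \<in> integral_closure R A E"
  then obtain f where f: "x \<in> E" "f \<in> carrier (A[X])" "f \<noteq> []" "lead_coeff f = \<one>" "eval f x = \<zero>"
    unfolding integral_closure_def by auto
  then obtain fs where fs: "f = \<one> # fs" by (cases f) auto
  have "set f \<subseteq> A" using f(2) polynomial_incl univ_poly_carrier[of R A] by blast
  thus "x \<in> E \<and> (\<exists>fs. set fs \<subseteq> A \<and> eval (\<one> # fs) x = \<zero>)" using f fs by auto
next
  assume "x \<in> E \<and> (\<exists>fs. set fs \<subseteq> A \<and> eval (\<one> # fs) x = \<zero>)"
  then obtain fs where fs: "x \<in> E" "set fs \<subseteq> A" "eval (\<one> # fs) x = \<zero>" by auto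
  have "polynomial A (\<one> # fs)" unfolding polynomial_def using fs subringE(3)[OF assms] by auto
  hence "\<one> # fs \<in> carrier (A[X])" using univ_poly_carrier by blast
  thus "x \<in> integral_closure R A E" unfolding integral_closure_def using fs
    by (auto simp del: eval.simps intro!: bexI[of _ "\<one> # fs"])
qed

lemma integral_closure_incl:
  assumes A: "subring A R" and E: "A \<subseteq> E"
  shows "A \<subseteq> integral_closure R A E"
proof
  fix a assume a: "a \<in> A"
  hence "a \<in> carrier R" using subringE(1)[OF A] by auto
  moreover then have "eval [\<one>, \<ominus> a] a = \<zero>" by (simp add: r_neg)
  ultimately show "a \<in> integral_closure R A E" unfolding integral_closure_iff[OF A]
    using a E subringE(5)[OF A] by (intro conjI exI[of _ "[\<ominus> a]"]) auto
qed

text \<open>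
  The modules spanned by the powers of \<open>w\<close> form an ascending chain inside the span of the powers of \<open>x\<close>, as
  that span contains \<open>1\<close> and is stable under \<open>w\<close>. Where the chain becomes stationary, a power of
  \<open>w\<close> is a combination of lower ones.
\<close>

lemma integral_if_stable:
  assumes A: "subring A R" and N: "noetherian_ring (R\<lparr>carrier := A\<rparr>)" and x: "x \<in> carrier R" and w: "w \<in> carrier R"
    and n: "0 < n" and st: "\<And>y. y \<in> power_span A x n \<Longrightarrow> w \<otimes> y \<in> power_span A x n"
  shows "w \<in> integral_closure R A (carrier R)"
proof -
  note A' = subringE[OF A]
  have one: "\<one> \<in> power_span A x n" using power_span_le[OF A x, of "[\<one>]" n] A' n by simp
  have wk: "w [^] k \<in> power_span A x n" for k :: nat
  proof (induct k)
    case (Suc k)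
    have "w [^] Suc k = w \<otimes> w [^] k" using w by (simp add: m_comm)
    thus ?case using st[OF Suc] by simp
  qed (use one in simp)
  have "power_span A w k \<subseteq> power_span A x n" for k
  proof (induct k)
    case 0 thus ?case using power_span_zero[OF A x] unfolding power_span_def by auto
  next
    case (Suc k)
    show ?case
    proof
      fix y assume "y \<in> power_span A w (Suc k)"
      then obtain a z where "a \<in> A" "z \<in> power_span A w k" "y = a \<otimes> w [^] k \<oplus> z" using power_span_Suc[OF A w] by blast
      thus "y \<in> power_span A x n" using Suc wk power_span_add[OF A x] power_span_smult[OF A x] by auto
    qed
  qed
  hence "\<exists>k. \<forall>m\<ge>k. power_span A w m = power_span A w k"
    by (intro ascending_submodules_stable[OF A x N, of _ n])
      (auto intro: power_span_mono[OF A w, THEN subsetD] power_span_zero[OF A w] power_span_add[OF A w] power_span_smult[OF A w])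
  then obtain k where "power_span A w (Suc k) = power_span A w k" by (meson le_SucI order_refl)
  moreover have "\<one> \<otimes> w [^] k \<oplus> \<zero> \<in> power_span A w (Suc k)"
    using power_span_SucI[OF A w power_span_zero[OF A w]] A' by auto
  ultimately have "w [^] k \<in> power_span A w k" using w by simp
  then obtain r where r: "w [^] k = eval r w" "set r \<subseteq> A" "length r = k" unfolding power_span_def by auto
  have rc: "set r \<subseteq> carrier R" using r A' by auto
  let ?f = "map (\<lambda>a. \<ominus> \<one> \<otimes> a) r"
  have fA: "set ?f \<subseteq> A" using r A' by auto
  have "eval ?f w = \<ominus> \<one> \<otimes> w [^] k" using eval_smult[OF rc _ w, of "\<ominus> \<one>"] r by simp
  moreover have "eval r w \<in> carrier R" using r(1) w by (metis nat_pow_closed)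
  ultimately have "eval (\<one> # ?f) w = \<zero>" using r(1,3) w by (simp add: l_minus r_neg)
  thus ?thesis unfolding integral_closure_iff[OF A] using w fA by blast
qed

text \<open>
  If \<open>a\<^sub>0 x\<^sup>n + \<dots> + a\<^sub>n = 0\<close>, then each
  \<open>(a\<^sub>0 x\<^sup>i + \<dots> + a\<^sub>i) x\<close> with \<open>i < n\<close> is integral over \<open>A\<close>. Multiplication by this element maps the
  span of \<open>1, x, \<dots>, x\<^sup>n\<^sup>-\<^sup>1\<close> to itself: on low powers this is visible, and on
  high powers the equation allows replacing the initial part by the negative of the rest.
\<close>

lemma integral_prefix:
  assumes A: "subring A R" and N: "noetherian_ring (R\<lparr>carrier := A\<rparr>)" and x: "x \<in> carrier R"
    and pq: "set p \<subseteq> A" "set q \<subseteq> A" "q \<noteq> []" "eval (p @ q) x = \<zero>"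
  shows "eval p x \<otimes> x \<in> integral_closure R A (carrier R)"
proof (cases "p = []")
  case True
  have "eval [\<one>, \<zero>] \<zero> = \<zero>" by simp
  hence "\<zero> \<in> integral_closure R A (carrier R)" unfolding integral_closure_iff[OF A] using subringE(2)[OF A]
    by (intro conjI exI[of _ "[\<zero>]"]) auto
  thus ?thesis using True x by simp
next
  case False
  note A' = subringE[OF A]
  define n where "n = length p + length q - 1"
  have n: "0 < n" using False pq(3) unfolding n_def by (cases p; cases q) auto
  have c: "set p \<subseteq> carrier R" "set q \<subseteq> carrier R" using pq A' by auto
  have ec: "eval p x \<in> carrier R" "eval q x \<in> carrier R" using c x eval_in_carrier by auto
  have pw: "eval (r @ replicate k \<zero>) x = eval r x \<otimes> x [^] k" if "set r \<subseteq> carrier R" for r k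
  proof -
    have "eval (replicate k \<zero>) x = \<zero>" using eval_replicate[of "[]" x k] x by simp
    moreover have "set (replicate k \<zero>) \<subseteq> carrier R" by auto
    ultimately show ?thesis using eval_append[OF that _ x, of "replicate k \<zero>"] eval_in_carrier[OF that x] x by simp
  qed
  have zero: "eval p x \<otimes> x [^] length q \<oplus> eval q x = \<zero>" using eval_append[OF c x] pq(4) by simp
  have pow: "eval p x \<otimes> x \<otimes> x [^] m \<in> power_span A x n" if m: "m < n" for m
  proof (cases "length q \<le> Suc m")
    case True
    let ?r = "map (\<lambda>a. \<ominus> \<one> \<otimes> a) q @ replicate (Suc m - length q) \<zero>"
    have s: "set (map (\<lambda>a. \<ominus> \<one> \<otimes> a) q) \<subseteq> carrier R" using c by auto
    define y z where "y = x [^] length q" and "z = x [^] (Suc m - length q)"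
    have yz: "y \<in> carrier R" "z \<in> carrier R" using x unfolding y_def z_def by auto
    have pyq: "eval p x \<otimes> y = \<ominus> eval q x" using zero ec yz minus_equality[of "eval p x \<otimes> y" "eval q x"] unfolding y_def by simp
    have "x \<otimes> x [^] m = x [^] Suc m" using x m_comm[of x "x [^] m"] by simp
    also have "\<dots> = y \<otimes> z" unfolding y_def z_def using nat_pow_mult[OF x, of "length q" "Suc m - length q"] True by simp
    finally have "x \<otimes> x [^] m = y \<otimes> z" .
    hence "eval p x \<otimes> x \<otimes> x [^] m = (eval p x \<otimes> y) \<otimes> z" using ec x yz by (simp add: m_assoc)
    also have "\<dots> = (\<ominus> \<one> \<otimes> eval q x) \<otimes> z" unfolding pyq using ec by (simp add: l_minus)
    also have "\<dots> = eval ?r x" unfolding pw[OF s] z_def using eval_smult[OF c(2) _ x] by simp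
    finally have "eval p x \<otimes> x \<otimes> x [^] m = eval ?r x" .
    moreover have "set ?r \<subseteq> A" using pq A' by auto
    moreover have "length ?r \<le> n" using m True by simp
    ultimately show ?thesis using power_span_le[OF A x] by simp
  next
    case False
    have "x \<otimes> x [^] m = x [^] Suc m" using x m_comm[of x "x [^] m"] by simp
    hence "eval p x \<otimes> x \<otimes> x [^] m = eval (p @ replicate (Suc m) \<zero>) x"
      unfolding pw[OF c(1)] using ec x by (simp add: m_assoc del: nat_pow_Suc)
    moreover have "set (p @ replicate (Suc m) \<zero>) \<subseteq> A" using pq A' by auto
    moreover have "length (p @ replicate (Suc m) \<zero>) \<le> n" using False unfolding n_def by simp
    ultimately show ?thesis using power_span_le[OF A x] by metis
  qed
  have "eval p x \<otimes> x \<otimes> eval r x \<in> power_span A x n" if "set r \<subseteq> A" "length r \<le> n" for r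
    using that
  proof (induct r)
    case Nil thus ?case using power_span_zero[OF A x] ec x by simp
  next
    case (Cons a r)
    have ac: "a \<in> carrier R" "eval r x \<in> carrier R" "x [^] length r \<in> carrier R"
      using Cons A' x by (auto intro!: eval_in_carrier)
    have "eval p x \<otimes> x \<otimes> eval (a # r) x = a \<otimes> (eval p x \<otimes> x \<otimes> x [^] length r) \<oplus> eval p x \<otimes> x \<otimes> eval r x"
      using ac ec x by simp (use ac(3) in algebra)
    thus ?case using Cons pow[of "length r"] power_span_add[OF A x] power_span_smult[OF A x] by simp
  qed
  hence st: "eval p x \<otimes> x \<otimes> y \<in> power_span A x n" if "y \<in> power_span A x n" for y
    using that unfolding power_span_def by auto
  show ?thesis by (rule integral_if_stable[OF A N x _ n st]) (use ec x in auto)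
qed

text \<open>
  Let \<open>a\<close> be a coefficient outside \<open>P\<close>, and let \<open>b\<close> be the value of the initial part ending with
  \<open>a\<close>. Then \<open>b\<close> and \<open>b \<otimes> x\<close> are integral, which settles the case \<open>b \<notin> P\<close>. Otherwise
  \<open>b \<ominus> a\<close>, which is \<open>x\<close> times the value of the preceding initial part, lies outside \<open>P\<close>.
\<close>

lemma valuation_ring_of_prime:
  assumes A: "subring A R" and N: "noetherian_ring (R\<lparr>carrier := A\<rparr>)" and x: "x \<in> carrier R"
    and C: "subring C R" "C = integral_closure R A (carrier R)"
    and P: "primeideal P (R\<lparr>carrier := C\<rparr>)"
    and f: "set f \<subseteq> A" "\<not> set f \<subseteq> P" "eval f x = \<zero>"
  shows "\<exists>c\<in>C. \<exists>s\<in>C - P. s \<otimes> x = c \<or> c \<otimes> x = s"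
proof -
  note A' = subringE[OF A]
  note C' = subringE[OF C(1)]
  have P': "P \<subseteq> C" "\<zero> \<in> P" "\<And>x y. x \<in> P \<Longrightarrow> y \<in> P \<Longrightarrow> x \<oplus> y \<in> P" "\<And>a x. a \<in> C \<Longrightarrow> x \<in> P \<Longrightarrow> a \<otimes> x \<in> P"
    using P unfolding primeideal_subring_iff[OF C(1)] ideal_subring_iff[OF C(1)] by auto
  have AC: "A \<subseteq> C" unfolding C(2) by (rule integral_closure_incl[OF A A'(1)])
  obtain a where "a \<in> set f" "a \<notin> P" using f by auto
  then obtain p q where pq: "f = p @ a # q" by (meson split_list)
  have s: "set p \<subseteq> A" "set q \<subseteq> A" "a \<in> A" using f pq by auto
  have pc: "set p \<subseteq> carrier R" using s A' by auto
  have ac: "a \<in> carrier R" "eval p x \<in> carrier R" using s A' x pc eval_in_carrier by auto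
  have pref: "eval p x \<otimes> x \<in> C"
    unfolding C(2) using integral_prefix[OF A N x, of p "a # q"] s f(3) pq by auto
  define b where "b = eval p x \<otimes> x \<oplus> a"
  have b: "b = eval (p @ [a]) x" unfolding b_def using eval_append_aux[OF pc ac(1) x] by simp
  have bC: "b \<in> C" unfolding b_def using pref s AC C' by auto
  show ?thesis
  proof (cases "b \<in> P")
    case False
    have "q \<noteq> []" using False f(3) pq b P'(2) by auto
    hence "eval (p @ [a]) x \<otimes> x \<in> integral_closure R A (carrier R)"
      using integral_prefix[OF A N x, of "p @ [a]" q] s f(3) pq by auto
    hence "b \<otimes> x \<in> C" unfolding b C(2) .
    thus ?thesis using False bC by blast
  next
    case True
    have w: "eval p x \<otimes> x \<notin> P"
    proof
      assume *: "eval p x \<otimes> x \<in> P"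
      have "\<ominus> \<one> \<otimes> (eval p x \<otimes> x) \<in> P" using P'(4)[OF _ *, of "\<ominus> \<one>"] C' by auto
      hence "b \<oplus> \<ominus> \<one> \<otimes> (eval p x \<otimes> x) \<in> P" using True P' by auto
      moreover have "b \<oplus> \<ominus> \<one> \<otimes> (eval p x \<otimes> x) = a" unfolding b_def using ac x by algebra
      ultimately show False using \<open>a \<notin> P\<close> by simp
    qed
    have "p \<noteq> []" using w P'(2) x by auto
    then obtain p' c where p': "p = p' @ [c]" by (metis rev_exhaust)
    have s': "set p' \<subseteq> A" "c \<in> A" using s p' by auto
    hence s'': "set p' \<subseteq> carrier R" "c \<in> carrier R" using A' by auto
    have "eval p' x \<otimes> x \<in> C" unfolding C(2) using integral_prefix[OF A N x, of p' "c # a # q"] s' s f(3) pq p' by auto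
    hence "eval p x \<in> C" unfolding p' eval_append_aux[OF s'' x] using s'(2) AC C' by auto
    thus ?thesis using w pref by blast
  qed
qed

end

section \<open>Uniformizers of a Dedekind domain\<close>

text \<open>
  A maximal ideal \<open>\<pp>\<close> of height one in a noetherian ring \<open>A\<close>. Maximality appears as
  invertibility modulo \<open>\<pp>\<close>, and the height as minimality of \<open>\<pp>\<close> among nonzero primes. All
  assumptions refer only to \<open>A\<close>, so they pass to every field \<open>R\<close> that contains it.
\<close>

locale noetherian_prime = field R for R (structure) +
  fixes A \<pp> :: "'a set"
  assumes A: "subring A R" and noeth: "noetherian_ring (R\<lparr>carrier := A\<rparr>)"
    and prime: "primeideal \<pp> (R\<lparr>carrier := A\<rparr>)"
    and inverse_mod: "\<And>a. a \<in> A - \<pp> \<Longrightarrow> \<exists>b\<in>A. \<exists>x\<in>\<pp>. a \<otimes> b = x \<oplus> \<one>"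
    and min: "\<And>Q. primeideal Q (R\<lparr>carrier := A\<rparr>) \<Longrightarrow> Q \<subseteq> \<pp> \<Longrightarrow> Q \<noteq> {\<zero>} \<Longrightarrow> Q = \<pp>"
    and nz: "\<pp> \<noteq> {\<zero>}"
begin

lemmas A' = subringE[OF A]

lemma p: "\<pp> \<subseteq> A" "\<zero> \<in> \<pp>" "\<And>x y. x \<in> \<pp> \<Longrightarrow> y \<in> \<pp> \<Longrightarrow> x \<oplus> y \<in> \<pp>"
  "\<And>a x. a \<in> A \<Longrightarrow> x \<in> \<pp> \<Longrightarrow> a \<otimes> x \<in> \<pp>" "\<one> \<notin> \<pp>"
  "\<And>a b. a \<in> A \<Longrightarrow> b \<in> A \<Longrightarrow> a \<otimes> b \<in> \<pp> \<Longrightarrow> a \<in> \<pp> \<or> b \<in> \<pp>"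
  using prime unfolding primeideal_subring_iff[OF A] ideal_subring_iff[OF A] by auto

lemma Ac: "a \<in> A \<Longrightarrow> a \<in> carrier R" using A'(1) by auto
lemma pc: "a \<in> \<pp> \<Longrightarrow> a \<in> carrier R" using p(1) Ac by auto

lemma inverse_modulo:
  assumes "a \<in> A - \<pp>" shows "\<exists>b\<in>A. a \<otimes> b \<ominus> \<one> \<in> \<pp>"
proof -
  obtain b x where bx: "b \<in> A" "x \<in> \<pp>" "a \<otimes> b = x \<oplus> \<one>" using inverse_mod[OF assms] by blast
  have "a \<otimes> b \<ominus> \<one> = x" unfolding bx(3) using pc[OF bx(2)] by algebra
  hence "a \<otimes> b \<ominus> \<one> \<in> \<pp>" using bx(2) by simp
  thus ?thesis using bx(1) by blast
qed

lemma den_mult: "s \<in> A - \<pp> \<Longrightarrow> t \<in> A - \<pp> \<Longrightarrow> s \<otimes> t \<in> A - \<pp>"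
  using p(6)[of s t] A'(6)[of s t] by auto
lemma den_one: "\<one> \<in> A - \<pp>" using p(5) A'(3) by auto
lemma den_nz: "s \<in> A - \<pp> \<Longrightarrow> s \<in> carrier R \<and> s \<noteq> \<zero>" using p(2) Ac by auto

lemma p_mult_right: "x \<in> \<pp> \<Longrightarrow> a \<in> A \<Longrightarrow> x \<otimes> a \<in> \<pp>"
  using p(4)[of a x] m_comm[of x a] pc Ac by auto

end

locale dedekind_prime = noetherian_prime +
  assumes int_closed: "integral_closure R A (fraction_field R A) = A"
begin

text \<open>
  The element \<open>y\<close> behaves like the inverse of a uniformizer: it is not in the localization at \<open>\<pp>\<close>, but
  its products with \<open>\<pp>\<close> are. Take \<open>y = b / a\<close>, where \<open>a\<close> is in \<open>\<pp>\<close> and the conductor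
  \<open>J b\<close> of \<open>y\<close> into the localization is maximal among the proper ones. A maximal conductor is prime, and therefore
  equal to \<open>\<pp>\<close>.
\<close>

lemma exists_inverse_like:
  "\<exists>y\<in>fraction_field R A. (\<forall>s\<in>A - \<pp>. s \<otimes> y \<notin> A) \<and> (\<forall>x\<in>\<pp>. \<exists>s\<in>A - \<pp>. s \<otimes> (x \<otimes> y) \<in> A)"
proof -
  obtain a where a: "a \<in> \<pp>" "a \<noteq> \<zero>" using nz p by auto
  have aA: "a \<in> A" "a \<in> carrier R" using a p Ac by auto
  \<comment> \<open>\<open>J b\<close> consists of the \<open>x\<close> in \<open>A\<close> for which \<open>x \<otimes> b / a\<close> is in the localization at \<open>\<pp>\<close>.\<close>
  define J where "J b = {x \<in> A. \<exists>s\<in>A - \<pp>. \<exists>c\<in>A. s \<otimes> x \<otimes> b = a \<otimes> c}" for b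
  define F where "F = {J b | b. b \<in> A \<and> \<one> \<notin> J b}"
  have Ji: "ideal (J b) (R\<lparr>carrier := A\<rparr>)" if b: "b \<in> A" for b
    unfolding ideal_subring_iff[OF A]
  proof (intro conjI ballI)
    have "\<one> \<otimes> \<zero> \<otimes> b = a \<otimes> \<zero>" using b aA Ac by auto
    thus "\<zero> \<in> J b" unfolding J_def using A'(2) den_one by blast
    fix x y assume x: "x \<in> J b"
    then obtain s c where s: "x \<in> A" "s \<in> A - \<pp>" "c \<in> A" "s \<otimes> x \<otimes> b = a \<otimes> c" unfolding J_def by auto
    have sc: "s \<in> carrier R" "c \<in> carrier R" "x \<in> carrier R" "b \<in> carrier R" using s b Ac by auto
    { assume "y \<in> J b"
      then obtain t d where t: "y \<in> A" "t \<in> A - \<pp>" "d \<in> A" "t \<otimes> y \<otimes> b = a \<otimes> d" unfolding J_def by auto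
      have tc: "t \<in> carrier R" "d \<in> carrier R" "y \<in> carrier R" using t Ac by auto
      have "(s \<otimes> t) \<otimes> (x \<oplus> y) \<otimes> b = t \<otimes> (s \<otimes> x \<otimes> b) \<oplus> s \<otimes> (t \<otimes> y \<otimes> b)" using sc tc by algebra
      also have "\<dots> = a \<otimes> (t \<otimes> c \<oplus> s \<otimes> d)" unfolding s(4) t(4) using sc tc aA by algebra
      finally have e: "(s \<otimes> t) \<otimes> (x \<oplus> y) \<otimes> b = a \<otimes> (t \<otimes> c \<oplus> s \<otimes> d)" .
      have "s \<otimes> t \<in> A - \<pp>" "t \<otimes> c \<oplus> s \<otimes> d \<in> A" "x \<oplus> y \<in> A" using s t A' den_mult by auto
      thus "x \<oplus> y \<in> J b" unfolding J_def using e by blast }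
    { assume y: "y \<in> A"
      have "s \<otimes> (y \<otimes> x) \<otimes> b = y \<otimes> (s \<otimes> x \<otimes> b)" using sc y Ac by (simp add: m_ac)
      also have "\<dots> = a \<otimes> (y \<otimes> c)" unfolding s(4) using sc y Ac aA by (simp add: m_ac)
      finally have e: "s \<otimes> (y \<otimes> x) \<otimes> b = a \<otimes> (y \<otimes> c)" .
      have "y \<otimes> x \<in> A" "y \<otimes> c \<in> A" using s y A' by auto
      thus "y \<otimes> x \<in> J b" unfolding J_def using e s by blast }
  qed (auto simp: J_def)
  have J1: "\<one> \<notin> J \<one>"
  proof
    assume "\<one> \<in> J \<one>"
    then obtain s c where s: "s \<in> A - \<pp>" "c \<in> A" "s = a \<otimes> c" unfolding J_def using Ac by auto
    thus False using p_mult_right[OF a(1)] by auto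
  qed
  have "F \<noteq> {}" unfolding F_def using J1 A' by auto
  then obtain M where M: "M \<in> F" "\<forall>J'\<in>F. M \<subseteq> J' \<longrightarrow> J' = M"
    using maximal_ideal_in_family[OF A noeth, of F] Ji unfolding F_def by (smt (verit) mem_Collect_eq)
  obtain b where b: "b \<in> A" "\<one> \<notin> J b" "M = J b" using M(1) unfolding F_def by auto
  have bc: "b \<in> carrier R" using b Ac by auto
  have Jp: "J b \<subseteq> \<pp>"
  proof
    fix x assume "x \<in> J b"
    then obtain s c where s: "x \<in> A" "s \<in> A - \<pp>" "c \<in> A" "s \<otimes> x \<otimes> b = a \<otimes> c" unfolding J_def by auto
    show "x \<in> \<pp>"
    proof (rule ccontr)
      assume "x \<notin> \<pp>"
      hence "s \<otimes> x \<in> A - \<pp>" using den_mult s by auto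
      moreover have "s \<otimes> x \<otimes> \<one> \<otimes> b = a \<otimes> c" using s Ac bc by simp
      ultimately have "\<one> \<in> J b" unfolding J_def using A'(3) s(3) by blast
      thus False using b by simp
    qed
  qed
  have aJ: "a \<in> J b"
  proof -
    have "\<one> \<otimes> a \<otimes> b = a \<otimes> b" using aA by simp
    thus ?thesis unfolding J_def using aA(1) b(1) den_one by blast
  qed
  have "primeideal (J b) (R\<lparr>carrier := A\<rparr>)"
    unfolding primeideal_subring_iff[OF A]
  proof (intro conjI ballI impI Ji b)
    fix x y assume xy: "x \<in> A" "y \<in> A" "x \<otimes> y \<in> J b"
    have xyc: "x \<in> carrier R" "y \<in> carrier R" using xy Ac by auto
    show "x \<in> J b \<or> y \<in> J b"
    proof (rule disjCI)
      assume "y \<notin> J b"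
      have yb: "y \<otimes> b \<in> A" using xy b A' by auto
      have "\<one> \<notin> J (y \<otimes> b)"
      proof
        assume "\<one> \<in> J (y \<otimes> b)"
        then obtain s c where s: "s \<in> A - \<pp>" "c \<in> A" "s \<otimes> \<one> \<otimes> (y \<otimes> b) = a \<otimes> c" unfolding J_def by auto
        hence "s \<otimes> y \<otimes> b = a \<otimes> c" using xyc bc Ac by (simp add: m_assoc)
        hence "y \<in> J b" unfolding J_def using xy(2) s(1,2) by blast
        thus False using \<open>y \<notin> J b\<close> by simp
      qed
      hence "J (y \<otimes> b) \<in> F" unfolding F_def using yb by blast
      moreover have "M \<subseteq> J (y \<otimes> b)"
      proof
        fix z assume "z \<in> M"
        then obtain s c where s: "z \<in> A" "s \<in> A - \<pp>" "c \<in> A" "s \<otimes> z \<otimes> b = a \<otimes> c" unfolding b(3) J_def by auto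
        have sc: "s \<in> carrier R" "z \<in> carrier R" "c \<in> carrier R" using s(1-3) Ac by auto
        have "s \<otimes> z \<otimes> (y \<otimes> b) = y \<otimes> (s \<otimes> z \<otimes> b)" using sc xyc bc by (simp add: m_ac)
        also have "\<dots> = a \<otimes> (y \<otimes> c)" unfolding s(4) using sc xyc aA by (simp add: m_ac)
        finally have "s \<otimes> z \<otimes> (y \<otimes> b) = a \<otimes> (y \<otimes> c)" .
        moreover have "y \<otimes> c \<in> A" using xy s A' by auto
        ultimately show "z \<in> J (y \<otimes> b)" unfolding J_def using s(1,2) by blast
      qed
      ultimately have eq: "J (y \<otimes> b) = J b" using M(2) b(3) by blast
      obtain s c where s: "s \<in> A - \<pp>" "c \<in> A" "s \<otimes> (x \<otimes> y) \<otimes> b = a \<otimes> c" using xy(3) unfolding J_def by auto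
      have "s \<in> carrier R" using s(1) Ac by auto
      hence "s \<otimes> x \<otimes> (y \<otimes> b) = a \<otimes> c" unfolding s(3)[symmetric] using xyc bc by (simp add: m_assoc)
      hence "x \<in> J (y \<otimes> b)" unfolding J_def using xy(1) s(1,2) by blast
      thus "x \<in> J b" using eq by simp
    qed
  qed
  hence Jb: "J b = \<pp>" using min[OF _ Jp] aJ a(2) by blast
  define y where "y = b \<otimes> inv a"
  have ai: "inv a \<in> carrier R" using aA a by auto
  have "y \<in> fraction_field R A" unfolding fraction_field_def y_def using b aA a by blast
  moreover have "s \<otimes> y \<notin> A" if s: "s \<in> A - \<pp>" for s
  proof
    assume "s \<otimes> y \<in> A"
    moreover have "s \<in> carrier R" using s Ac by auto
    hence "s \<otimes> \<one> \<otimes> b = a \<otimes> (s \<otimes> y)" unfolding y_def using aA a bc ai by (simp add: m_lcomm[of a])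
    ultimately have "\<one> \<in> J b" unfolding J_def using A'(3) s by blast
    thus False using b by simp
  qed
  moreover have "\<exists>s\<in>A - \<pp>. s \<otimes> (x \<otimes> y) \<in> A" if x: "x \<in> \<pp>" for x
  proof -
    have "x \<in> J b" using x Jb by simp
    then obtain s c where s: "s \<in> A - \<pp>" "c \<in> A" "s \<otimes> x \<otimes> b = a \<otimes> c" unfolding J_def by auto
    have sc: "s \<in> carrier R" "c \<in> carrier R" "x \<in> carrier R" using s(1,2) x pc Ac by auto
    have "s \<otimes> (x \<otimes> y) = (s \<otimes> x \<otimes> b) \<otimes> inv a" unfolding y_def using sc bc ai by (simp add: m_assoc)
    also have "\<dots> = (a \<otimes> inv a) \<otimes> c" unfolding s(3) using aA(2) ai sc by (simp add: m_ac)
    also have "\<dots> = c" using aA a sc by simp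
    finally show ?thesis using s by auto
  qed
  ultimately show ?thesis by blast
qed

text \<open>
  The usual way to make a relation monic: multiplying one for \<open>y\<close> with leading coefficient \<open>s\<close> by a power of
  \<open>s\<close> gives a monic one for \<open>s \<otimes> y\<close>. Here \<open>r\<close> is the part of the relation below the leading term.
\<close>

lemma eval_scale:
  assumes "set r \<subseteq> A" "s \<in> A" "y \<in> carrier R"
  shows "\<exists>r'. set r' \<subseteq> A \<and> length r' = length r \<and> eval r' (s \<otimes> y) = s [^] (length r - 1) \<otimes> eval r y"
  using assms(1)
proof (induct r rule: rev_induct)
  case Nil thus ?case by simp
next
  case (snoc a r)
  then obtain r' where r': "set r' \<subseteq> A" "length r' = length r" "eval r' (s \<otimes> y) = s [^] (length r - 1) \<otimes> eval r y" by auto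
  have c: "set r \<subseteq> carrier R" "set r' \<subseteq> carrier R" "a \<in> carrier R" "a \<in> A" "s \<in> carrier R" using snoc r' Ac assms by auto
  have ey: "eval r y \<in> carrier R" using eval_in_carrier c assms by auto
  have "s [^] n \<in> A" for n :: nat using assms(2) A' by (induct n) auto
  hence sp: "s [^] length r \<in> A" .
  have "eval (r' @ [s [^] length r \<otimes> a]) (s \<otimes> y) = s [^] (length r - 1) \<otimes> eval r y \<otimes> (s \<otimes> y) \<oplus> s [^] length r \<otimes> a"
    using eval_append_aux[OF c(2), of "s [^] length r \<otimes> a" "s \<otimes> y"] c assms r'(3) by simp
  also have "s [^] (length r - 1) \<otimes> eval r y \<otimes> (s \<otimes> y) = s [^] length r \<otimes> (eval r y \<otimes> y)"
  proof (cases "length r")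
    case 0 thus ?thesis using assms c by simp
  next
    case (Suc k)
    have sk: "s [^] k \<in> carrier R" using c by simp
    show ?thesis unfolding Suc using sk c ey assms(3) by (simp add: m_ac)
  qed
  also have "s [^] length r \<otimes> (eval r y \<otimes> y) \<oplus> s [^] length r \<otimes> a = s [^] length r \<otimes> eval (r @ [a]) y"
    using eval_append_aux[OF c(1) c(3) assms(3)] c ey assms(3) by (simp add: r_distr)
  finally show ?case using r' c sp A' by (intro exI[of _ "r' @ [s [^] length r \<otimes> a]"]) auto
qed

text \<open>
  Otherwise \<open>y\<close> would map the maximal ideal of the localization into itself. With a nonzero \<open>c\<close> in
  \<open>\<pp>\<close>, all \<open>c \<otimes> y\<^sup>k\<close> would then lie in the localization, and the ascending chain condition would
  make \<open>y\<close> integral over it. As \<open>A\<close> is integrally closed, \<open>y\<close> would itself be in the localization.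
\<close>

lemma exists_local_generator:
  assumes y: "y \<in> fraction_field R A" "\<And>s. s \<in> A - \<pp> \<Longrightarrow> s \<otimes> y \<notin> A"
  shows "\<exists>\<pi>\<in>\<pp>. \<forall>s\<in>A - \<pp>. s \<otimes> (\<pi> \<otimes> y) \<notin> \<pp>"
proof (rule ccontr)
  assume "\<not> ?thesis"
  hence H: "\<exists>s\<in>A - \<pp>. s \<otimes> (x \<otimes> y) \<in> \<pp>" if "x \<in> \<pp>" for x using that by blast
  have Ks: "subring (fraction_field R A) R" using subfieldE(1)[OF fraction_field_subfield[OF A]] .
  have yc: "y \<in> carrier R" using y subringE(1)[OF Ks] by auto
  obtain c where c: "c \<in> \<pp>" "c \<noteq> \<zero>" using nz p by auto
  have cc: "c \<in> carrier R" using c pc by auto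
  have pow: "\<exists>t\<in>A - \<pp>. t \<otimes> (c \<otimes> y [^] k) \<in> \<pp>" for k :: nat
  proof (induct k)
    case 0 thus ?case using c cc by (intro bexI[OF _ den_one]) simp
  next
    case (Suc k)
    then obtain t where t: "t \<in> A - \<pp>" "t \<otimes> (c \<otimes> y [^] k) \<in> \<pp>" by auto
    then obtain s where s: "s \<in> A - \<pp>" "s \<otimes> (t \<otimes> (c \<otimes> y [^] k) \<otimes> y) \<in> \<pp>" using H by blast
    have "s \<in> carrier R" "t \<in> carrier R" using s(1) t(1) Ac by auto
    hence "(s \<otimes> t) \<otimes> (c \<otimes> y [^] Suc k) = s \<otimes> (t \<otimes> (c \<otimes> y [^] k) \<otimes> y)"
      using cc yc by (simp add: m_assoc)
    hence "(s \<otimes> t) \<otimes> (c \<otimes> y [^] Suc k) \<in> \<pp>" using s(2) by simp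
    thus ?case using den_mult[OF s(1) t(1)] by blast
  qed
  \<comment> \<open>The contraction to \<open>A\<close> of \<open>c\<close> times the module spanned by the powers of \<open>y\<close> over the
    localization at \<open>\<pp>\<close>.\<close>
  define I where "I k = {x \<in> A. \<exists>s\<in>A - \<pp>. \<exists>z\<in>power_span A y k. s \<otimes> x = c \<otimes> z}" for k
  have psc: "z \<in> carrier R" if "z \<in> power_span A y k" for z k using that power_span_carrier[OF A yc] by auto
  have Ii: "ideal (I k) (R\<lparr>carrier := A\<rparr>)" for k
    unfolding ideal_subring_iff[OF A]
  proof (intro conjI ballI)
    have "\<one> \<otimes> \<zero> = c \<otimes> \<zero>" using cc by simp
    thus "\<zero> \<in> I k" unfolding I_def using A'(2) den_one power_span_zero[OF A yc] by blast
    fix x w assume x: "x \<in> I k"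
    then obtain s z where s: "x \<in> A" "s \<in> A - \<pp>" "z \<in> power_span A y k" "s \<otimes> x = c \<otimes> z" unfolding I_def by auto
    have sc: "s \<in> carrier R" "z \<in> carrier R" "x \<in> carrier R" using s psc Ac by auto
    { assume "w \<in> I k"
      then obtain t u where t: "w \<in> A" "t \<in> A - \<pp>" "u \<in> power_span A y k" "t \<otimes> w = c \<otimes> u" unfolding I_def by auto
      have tc: "t \<in> carrier R" "u \<in> carrier R" "w \<in> carrier R" using t psc Ac by auto
      have "(s \<otimes> t) \<otimes> (x \<oplus> w) = t \<otimes> (s \<otimes> x) \<oplus> s \<otimes> (t \<otimes> w)" using sc tc by algebra
      also have "\<dots> = c \<otimes> (t \<otimes> z \<oplus> s \<otimes> u)" unfolding s(4) t(4) using sc tc cc by algebra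
      finally have e: "(s \<otimes> t) \<otimes> (x \<oplus> w) = c \<otimes> (t \<otimes> z \<oplus> s \<otimes> u)" .
      have "s \<otimes> t \<in> A - \<pp>" "t \<otimes> z \<oplus> s \<otimes> u \<in> power_span A y k" "x \<oplus> w \<in> A"
        using s t A' den_mult power_span_add[OF A yc] power_span_smult[OF A yc] by auto
      thus "x \<oplus> w \<in> I k" unfolding I_def using e by blast }
    { assume w: "w \<in> A"
      have wc: "w \<in> carrier R" using w Ac by auto
      have "s \<otimes> (w \<otimes> x) = w \<otimes> (s \<otimes> x)" using sc wc by (simp add: m_ac)
      also have "\<dots> = c \<otimes> (w \<otimes> z)" unfolding s(4) using sc wc cc by (simp add: m_ac)
      finally have e: "s \<otimes> (w \<otimes> x) = c \<otimes> (w \<otimes> z)" .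
      have "w \<otimes> x \<in> A" "w \<otimes> z \<in> power_span A y k" using s w A' power_span_smult[OF A yc] by auto
      thus "w \<otimes> x \<in> I k" unfolding I_def using e s by blast }
  qed (auto simp: I_def)
  have Im: "I k \<subseteq> I (Suc k)" for k
  proof
    fix x assume "x \<in> I k"
    then obtain s z where "x \<in> A" "s \<in> A - \<pp>" "z \<in> power_span A y k" "s \<otimes> x = c \<otimes> z" unfolding I_def by auto
    moreover from this(3) have "z \<in> power_span A y (Suc k)" by (rule power_span_mono[OF A yc, THEN subsetD])
    ultimately show "x \<in> I (Suc k)" unfolding I_def by auto
  qed
  have "\<exists>n. \<forall>m\<ge>n. I m = I n" by (rule ascending_ideals_stable[OF A noeth]) (rule Ii, rule Im)
  then obtain k where k': "\<forall>m\<ge>k. I m = I k" ..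
  have k: "I (Suc k) = I k" by (rule k'[rule_format]) simp
  obtain t where t: "t \<in> A - \<pp>" "t \<otimes> (c \<otimes> y [^] k) \<in> \<pp>" using pow by blast
  have tc: "t \<in> carrier R" using t Ac by auto
  have "\<one> \<otimes> (t \<otimes> (c \<otimes> y [^] k)) = c \<otimes> (t \<otimes> y [^] k \<oplus> \<zero>)" using tc cc yc by (simp add: m_lcomm)
  moreover have "t \<otimes> y [^] k \<oplus> \<zero> \<in> power_span A y (Suc k)"
    using power_span_SucI[OF A yc power_span_zero[OF A yc]] t by blast
  ultimately have "t \<otimes> (c \<otimes> y [^] k) \<in> I (Suc k)" unfolding I_def using t p(1) den_one by blast
  hence "t \<otimes> (c \<otimes> y [^] k) \<in> I k" using k by simp
  then obtain s z where s: "s \<in> A - \<pp>" "z \<in> power_span A y k" "s \<otimes> (t \<otimes> (c \<otimes> y [^] k)) = c \<otimes> z" unfolding I_def by auto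
  define \<sigma> where "\<sigma> = s \<otimes> t"
  have \<sigma>: "\<sigma> \<in> A - \<pp>" unfolding \<sigma>_def using den_mult s t by auto
  have \<sigma>c: "\<sigma> \<in> carrier R" using \<sigma> Ac by auto
  have sc: "s \<in> carrier R" "z \<in> carrier R" using s psc Ac by auto
  have "c \<otimes> (\<sigma> \<otimes> y [^] k) = c \<otimes> z" unfolding s(3)[symmetric] \<sigma>_def using sc tc cc yc by (simp add: m_ac)
  hence z: "\<sigma> \<otimes> y [^] k = z" using c(2) cc \<sigma>c yc sc m_lcancel by simp
  obtain r where r: "z = eval r y" "set r \<subseteq> A" "length r = k" using s(2) unfolding power_span_def by auto
  have "k \<noteq> 0" using z r \<sigma>c den_nz[OF \<sigma>] by (cases k) auto
  then obtain l where l: "k = Suc l" by (cases k) auto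
  obtain r' where r': "set r' \<subseteq> A" "length r' = k" "eval r' (\<sigma> \<otimes> y) = \<sigma> [^] l \<otimes> eval r y"
    using eval_scale[OF r(2) _ yc, of \<sigma>] \<sigma> r(3) l by auto
  have \<sigma>y: "\<sigma> \<otimes> y \<in> carrier R" using \<sigma>c yc by simp
  have "\<sigma> [^] l \<otimes> eval r y = (\<sigma> \<otimes> y) [^] k"
    unfolding r(1)[symmetric] z[symmetric] l using \<sigma>c yc by (simp add: nat_pow_distrib m_ac)
  hence e: "eval r' (\<sigma> \<otimes> y) = (\<sigma> \<otimes> y) [^] k" using r'(3) by simp
  let ?f = "map (\<lambda>a. \<ominus> \<one> \<otimes> a) r'"
  have rc: "set r' \<subseteq> carrier R" using r' Ac by auto
  have "eval ?f (\<sigma> \<otimes> y) = \<ominus> \<one> \<otimes> (\<sigma> \<otimes> y) [^] k" using eval_smult[OF rc _ \<sigma>y, of "\<ominus> \<one>"] e by simp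
  hence "eval (\<one> # ?f) (\<sigma> \<otimes> y) = \<zero>" using r'(2) \<sigma>y by (simp add: l_minus r_neg del: eval_smult)
  moreover have "set ?f \<subseteq> A" using r' A' by auto
  moreover have "\<sigma> \<otimes> y \<in> fraction_field R A" using \<sigma> y(1) fraction_field_incl[OF A] subringE(6)[OF Ks] by auto
  ultimately have "\<sigma> \<otimes> y \<in> A" using int_closed integral_closure_iff[OF A, of "\<sigma> \<otimes> y" "fraction_field R A"] by blast
  thus False using y(2)[OF \<sigma>] by simp
qed

text \<open>
  The element \<open>\<pi>\<close> divides all of \<open>\<pp>\<close> in the localization, because \<open>\<pi> \<otimes> y\<close> is a unit there.
  Dividing \<open>x\<close> by \<open>\<pi>\<close> as often as possible ends in a unit: the quotients would otherwise generate a strictly ascending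
  chain of ideals.
\<close>

theorem exists_uniformizer:
  "\<exists>\<pi>\<in>\<pp>. \<pi> \<noteq> \<zero> \<and> (\<forall>x\<in>A. x \<noteq> \<zero> \<longrightarrow> (\<exists>n::nat. \<exists>s\<in>A - \<pp>. \<exists>u\<in>A - \<pp>. s \<otimes> x = \<pi> [^] n \<otimes> u))"
proof -
  obtain y where y: "y \<in> fraction_field R A" "\<And>s. s \<in> A - \<pp> \<Longrightarrow> s \<otimes> y \<notin> A"
    "\<And>x. x \<in> \<pp> \<Longrightarrow> \<exists>s\<in>A - \<pp>. s \<otimes> (x \<otimes> y) \<in> A" using exists_inverse_like by blast
  have yc: "y \<in> carrier R" using y(1) subfieldE(3)[OF fraction_field_subfield[OF A]] by auto
  obtain \<pi> where \<pi>: "\<pi> \<in> \<pp>" "\<And>s. s \<in> A - \<pp> \<Longrightarrow> s \<otimes> (\<pi> \<otimes> y) \<notin> \<pp>" using exists_local_generator[OF y(1,2)] by blast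
  have \<pi>c: "\<pi> \<in> carrier R" using \<pi> pc by auto
  obtain t where t: "t \<in> A - \<pp>" "t \<otimes> (\<pi> \<otimes> y) \<in> A" using y(3)[OF \<pi>(1)] by blast
  define w where "w = t \<otimes> (\<pi> \<otimes> y)"
  have w: "w \<in> A - \<pp>" unfolding w_def using t \<pi>(2) by auto
  have \<pi>0: "\<pi> \<noteq> \<zero>"
  proof
    assume "\<pi> = \<zero>"
    hence "w = \<zero>" unfolding w_def using t(1) Ac yc by auto
    thus False using den_nz[OF w] by simp
  qed
  have div: "\<exists>s\<in>A - \<pp>. \<exists>z\<in>A. s \<otimes> x = \<pi> \<otimes> z" if x: "x \<in> \<pp>" for x
  proof -
    obtain s where s: "s \<in> A - \<pp>" "s \<otimes> (x \<otimes> y) \<in> A" using y(3)[OF x] by blast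
    have c: "s \<in> carrier R" "t \<in> carrier R" "x \<in> carrier R" using s(1) t(1) x pc Ac by auto
    have "(s \<otimes> w) \<otimes> x = \<pi> \<otimes> (t \<otimes> (s \<otimes> (x \<otimes> y)))"
      unfolding w_def using c \<pi>c yc by (simp add: m_ac)
    moreover have "s \<otimes> w \<in> A - \<pp>" "t \<otimes> (s \<otimes> (x \<otimes> y)) \<in> A" using s t w den_mult A' by auto
    ultimately show ?thesis by blast
  qed
  have "\<exists>n::nat. \<exists>s\<in>A - \<pp>. \<exists>u\<in>A - \<pp>. s \<otimes> x = \<pi> [^] n \<otimes> u" if x: "x \<in> A" "x \<noteq> \<zero>" for x
  proof (rule ccontr)
    assume neg: "\<not> ?thesis"
    have xc: "x \<in> carrier R" using x Ac by auto
    have "\<pi> \<in> A" using \<pi>(1) p(1) by auto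
    hence \<pi>A: "\<pi> [^] n \<in> A" "\<pi> [^] n \<in> carrier R" for n :: nat using A'(3,6) \<pi>c by (induct n) auto
    have all: "\<exists>s\<in>A - \<pp>. \<exists>u\<in>A. s \<otimes> x = \<pi> [^] n \<otimes> u" for n :: nat
    proof (induct n)
      case 0
      have "\<one> \<otimes> x = \<pi> [^] (0::nat) \<otimes> x" using xc by simp
      thus ?case using den_one x by blast
    next
      case (Suc n)
      then obtain s u where s: "s \<in> A - \<pp>" "u \<in> A" "s \<otimes> x = \<pi> [^] n \<otimes> u" by blast
      have "u \<in> \<pp>"
      proof (rule ccontr)
        assume "u \<notin> \<pp>"
        hence "u \<in> A - \<pp>" using s(2) by simp
        thus False using neg s(1,3) by blast
      qed
      then obtain s' z where z: "s' \<in> A - \<pp>" "z \<in> A" "s' \<otimes> u = \<pi> \<otimes> z" using div by blast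
      have c: "s \<in> carrier R" "s' \<in> carrier R" "u \<in> carrier R" "z \<in> carrier R" using s z Ac by auto
      have "(s' \<otimes> s) \<otimes> x = s' \<otimes> (s \<otimes> x)" using c xc by (simp add: m_assoc)
      also have "\<dots> = s' \<otimes> (\<pi> [^] n \<otimes> u)" unfolding s(3) ..
      also have "\<dots> = \<pi> [^] n \<otimes> (s' \<otimes> u)" using c \<pi>A(2)[of n] by (simp add: m_ac)
      also have "\<dots> = \<pi> [^] n \<otimes> (\<pi> \<otimes> z)" unfolding z(3) ..
      also have "\<dots> = \<pi> [^] Suc n \<otimes> z" using c \<pi>A(2)[of n] \<pi>c by (simp add: m_ac)
      finally have "(s' \<otimes> s) \<otimes> x = \<pi> [^] Suc n \<otimes> z" .
      thus ?case using den_mult[OF z(1) s(1)] z(2) by blast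
    qed
    \<comment> \<open>\<open>I n\<close> consists of the \<open>z\<close> in \<open>A\<close> for which \<open>\<pi>\<^sup>n \<otimes> z\<close> is a multiple of \<open>x\<close> in the
      localization at \<open>\<pp>\<close>.\<close>
    define I where "I n = {z \<in> A. \<exists>s\<in>A - \<pp>. \<exists>c\<in>A. s \<otimes> \<pi> [^] n \<otimes> z = x \<otimes> c}" for n :: nat
    have Ii: "ideal (I n) (R\<lparr>carrier := A\<rparr>)" for n
      unfolding ideal_subring_iff[OF A]
    proof (intro conjI ballI)
      have "\<one> \<otimes> \<pi> [^] n \<otimes> \<zero> = x \<otimes> \<zero>" using xc \<pi>A(2)[of n] by simp
      thus "\<zero> \<in> I n" unfolding I_def using A'(2) den_one by blast
      fix z w assume z: "z \<in> I n"
      then obtain s c where s: "z \<in> A" "s \<in> A - \<pp>" "c \<in> A" "s \<otimes> \<pi> [^] n \<otimes> z = x \<otimes> c" unfolding I_def by auto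
      have sc: "s \<in> carrier R" "z \<in> carrier R" "c \<in> carrier R" using s Ac by auto
      define P where "P = \<pi> [^] n"
      have P: "P \<in> carrier R" unfolding P_def using \<pi>c by simp
      note s' = s(4)[folded P_def]
      { assume "w \<in> I n"
        then obtain t d where t: "w \<in> A" "t \<in> A - \<pp>" "d \<in> A" "t \<otimes> \<pi> [^] n \<otimes> w = x \<otimes> d" unfolding I_def by auto
        have tc: "t \<in> carrier R" "d \<in> carrier R" "w \<in> carrier R" using t Ac by auto
        note t' = t(4)[folded P_def]
        have "(s \<otimes> t) \<otimes> P \<otimes> (z \<oplus> w) = t \<otimes> (s \<otimes> P \<otimes> z) \<oplus> s \<otimes> (t \<otimes> P \<otimes> w)" using sc tc P by algebra
        also have "\<dots> = x \<otimes> (t \<otimes> c \<oplus> s \<otimes> d)" unfolding s' t' using sc tc xc by algebra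
        finally have e: "(s \<otimes> t) \<otimes> \<pi> [^] n \<otimes> (z \<oplus> w) = x \<otimes> (t \<otimes> c \<oplus> s \<otimes> d)" unfolding P_def .
        have "s \<otimes> t \<in> A - \<pp>" "t \<otimes> c \<oplus> s \<otimes> d \<in> A" "z \<oplus> w \<in> A" using s t A' den_mult by auto
        thus "z \<oplus> w \<in> I n" unfolding I_def using e by blast }
      { assume w: "w \<in> A"
        have wc: "w \<in> carrier R" using w Ac by auto
        have "s \<otimes> P \<otimes> (w \<otimes> z) = w \<otimes> (s \<otimes> P \<otimes> z)" using sc wc P by (simp add: m_ac)
        also have "\<dots> = x \<otimes> (w \<otimes> c)" unfolding s' using sc wc xc by (simp add: m_ac)
        finally have e: "s \<otimes> \<pi> [^] n \<otimes> (w \<otimes> z) = x \<otimes> (w \<otimes> c)" unfolding P_def .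
        have "w \<otimes> z \<in> A" "w \<otimes> c \<in> A" using s w A' by auto
        thus "w \<otimes> z \<in> I n" unfolding I_def using e s by blast }
    qed (auto simp: I_def)
    have Im: "I n \<subseteq> I (Suc n)" for n
    proof
      fix z assume "z \<in> I n"
      then obtain s c where s: "z \<in> A" "s \<in> A - \<pp>" "c \<in> A" "s \<otimes> \<pi> [^] n \<otimes> z = x \<otimes> c" unfolding I_def by auto
      have sc: "s \<in> carrier R" "z \<in> carrier R" "c \<in> carrier R" using s Ac by auto
      have "s \<otimes> \<pi> [^] Suc n \<otimes> z = \<pi> \<otimes> (s \<otimes> \<pi> [^] n \<otimes> z)" using sc \<pi>A(2)[of n] \<pi>c by (simp add: m_ac)
      also have "\<dots> = x \<otimes> (\<pi> \<otimes> c)" unfolding s(4) using sc \<pi>c xc by (simp add: m_ac)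
      finally have "s \<otimes> \<pi> [^] Suc n \<otimes> z = x \<otimes> (\<pi> \<otimes> c)" .
      moreover have "\<pi> \<otimes> c \<in> A" using \<pi> p(1) s A' by auto
      ultimately show "z \<in> I (Suc n)" unfolding I_def using s by blast
    qed
    have "\<exists>n. \<forall>m\<ge>n. I m = I n" by (rule ascending_ideals_stable[OF A noeth]) (rule Ii, rule Im)
    then obtain n where n': "\<forall>m\<ge>n. I m = I n" ..
    have n: "I (Suc n) = I n" by (rule n'[rule_format]) simp
    obtain s u where s: "s \<in> A - \<pp>" "u \<in> A" "s \<otimes> x = \<pi> [^] Suc n \<otimes> u" using all by blast
    have uc: "u \<in> carrier R" "s \<in> carrier R" using s(1,2) Ac by auto
    have "\<one> \<otimes> \<pi> [^] Suc n \<otimes> u = s \<otimes> x" unfolding s(3) using l_one[OF \<pi>A(2)[of "Suc n"]] by simp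
    also have "\<dots> = x \<otimes> s" by (rule m_comm[OF uc(2) xc])
    finally have "\<one> \<otimes> \<pi> [^] Suc n \<otimes> u = x \<otimes> s" .
    hence "u \<in> I (Suc n)" unfolding I_def using s den_one by blast
    hence "u \<in> I n" using n by simp
    then obtain t c where t: "t \<in> A - \<pp>" "c \<in> A" "t \<otimes> \<pi> [^] n \<otimes> u = x \<otimes> c" unfolding I_def by auto
    have c: "s \<in> carrier R" "t \<in> carrier R" "u \<in> carrier R" "c \<in> carrier R" using s t Ac by auto
    have "x \<otimes> (t \<otimes> s) = t \<otimes> (s \<otimes> x)" using c xc by (simp add: m_ac)
    also have "\<dots> = t \<otimes> (\<pi> [^] Suc n \<otimes> u)" unfolding s(3) ..
    also have "\<dots> = \<pi> \<otimes> (t \<otimes> \<pi> [^] n \<otimes> u)" using c \<pi>c \<pi>A(2)[of n] by (simp add: m_ac)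
    also have "\<dots> = \<pi> \<otimes> (x \<otimes> c)" unfolding t(3) ..
    also have "\<dots> = x \<otimes> (\<pi> \<otimes> c)" using c \<pi>c xc by (simp add: m_ac)
    finally have "t \<otimes> s = \<pi> \<otimes> c" using m_lcancel[OF x(2) xc] c \<pi>c by simp
    moreover have "t \<otimes> s \<in> A - \<pp>" using den_mult s t by auto
    ultimately show False using p_mult_right[OF \<pi>(1) t(2)] by simp
  qed
  thus ?thesis using \<pi>(1) \<pi>0 by blast
qed

end

section \<open>Discrete valuations from valuation rings\<close>

context valued_field begin

text \<open>
  The value group of the subfield is a nonzero subgroup of the integers, generated by its least positive element.
\<close>

lemma value_generator:
  assumes E: "subfield E R" and x: "x \<in> E" "x \<noteq> \<zero>" "v x \<noteq> 0"
  shows "\<exists>t\<in>E. t \<noteq> \<zero> \<and> 1 \<le> v t \<and> (\<forall>y\<in>E. y \<noteq> \<zero> \<longrightarrow> v t dvd v y)"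
proof -
  note E' = subringE[OF subfieldE(1)[OF E]]
  have inv: "inv y \<in> E" "y \<in> carrier R" if "y \<in> E" "y \<noteq> \<zero>" for y
    using that subfield_m_inv(1)[OF E, of y] E' by auto
  define P where "P n \<longleftrightarrow> 0 < n \<and> (\<exists>y\<in>E. y \<noteq> \<zero> \<and> v y = int n)" for n :: nat
  have "P (nat \<bar>v x\<bar>)"
  proof (cases "0 \<le> v x")
    case True thus ?thesis unfolding P_def using x by (auto intro!: bexI[of _ x])
  next
    case False thus ?thesis unfolding P_def using x inv[OF x(1,2)] by (auto intro!: bexI[of _ "inv x"])
  qed
  hence "P (LEAST n. P n)" by (rule LeastI)
  then obtain t where t: "t \<in> E" "t \<noteq> \<zero>" "v t = int (LEAST n. P n)" "0 < (LEAST n. P n)" unfolding P_def by auto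
  have pw: "y [^] n \<in> E" if "y \<in> E" for y and n :: nat using that E' by (induct n) auto
  have "v t dvd v y" if y: "y \<in> E" "y \<noteq> \<zero>" for y
  proof (rule ccontr)
    assume nd: "\<not> v t dvd v y"
    define q where "q = v y div v t"
    have tc: "t \<in> carrier R" using t inv by auto
    have "\<exists>z\<in>E. z \<noteq> \<zero> \<and> v z = - q * v t"
    proof (cases q)
      case (nonneg n)
      thus ?thesis using t(2) tc inv[OF t(1,2)] pw by (intro bexI[of _ "inv t [^] n"]) auto
    next
      case (neg n)
      have "v (t [^] Suc n) = - q * v t" unfolding neg using v_pow[OF tc t(2), of "Suc n"] by (simp del: nat_pow_Suc)
      thus ?thesis using t(2) pow_nz[OF tc t(2), of "Suc n"] pw[OF t(1), of "Suc n"] by (intro bexI[of _ "t [^] Suc n"]) (auto simp del: nat_pow_Suc)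
    qed
    then obtain z where z: "z \<in> E" "z \<noteq> \<zero>" "v z = - q * v t" by blast
    hence zc: "z \<in> carrier R" using inv by auto
    have "v (y \<otimes> z) = v y - q * v t" using v_mult[OF inv(2)[OF y] zc y(2) z(2)] z(3) by simp
    also have "\<dots> = v y mod v t" unfolding q_def by (simp add: minus_div_mult_eq_mod)
    finally have vm: "v (y \<otimes> z) = v y mod v t" .
    have "0 < v t" using t(3,4) by simp
    hence pos: "0 < v y mod v t" using nd pos_mod_sign[of "v t" "v y"] by (auto simp: dvd_eq_mod_eq_0 order_less_le)
    have "y \<otimes> z \<in> E" "y \<otimes> z \<noteq> \<zero>" using E'(6)[OF y(1) z(1)] mult_nz[OF inv(2)[OF y] zc] y z by auto
    hence "P (nat (v y mod v t))" unfolding P_def using vm pos by (auto intro!: bexI[of _ "y \<otimes> z"])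
    hence "(LEAST n. P n) \<le> nat (v y mod v t)" by (rule Least_le)
    moreover have "v y mod v t < v t" using t by simp
    ultimately show False using t(3) pos by linarith
  qed
  thus ?thesis using t by (intro bexI[of _ t]) auto
qed

lemma normalize_valuation:
  assumes x: "x \<in> carrier R" "x \<noteq> \<zero>" "v x \<noteq> 0"
  shows "\<exists>w t. valued_field R w \<and> t \<in> carrier R \<and> t \<noteq> \<zero> \<and> w t = 1 \<and>
    (\<forall>y\<in>carrier R. y \<noteq> \<zero> \<longrightarrow> (0 \<le> w y \<longleftrightarrow> 0 \<le> v y))"
proof -
  obtain t where t: "t \<in> carrier R" "t \<noteq> \<zero>" "1 \<le> v t" "\<And>y. y \<in> carrier R \<Longrightarrow> y \<noteq> \<zero> \<Longrightarrow> v t dvd v y"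
    using value_generator[OF carrier_is_subfield x] by auto
  define w where "w y = v y div v t" for y
  have vw: "v y = w y * v t" if "y \<in> carrier R" "y \<noteq> \<zero>" for y using t(4)[OF that] unfolding w_def by simp
  have "valued_field R w"
  proof (unfold_locales)
    fix y z assume a: "y \<in> carrier R" "z \<in> carrier R" "y \<noteq> \<zero>" "z \<noteq> \<zero>"
    have "w (y \<otimes> z) * v t = (w y + w z) * v t" using vw v_mult a by (simp add: distrib_right flip: vw)
    thus "w (y \<otimes> z) = w y + w z" using t(3) by simp
    assume "y \<oplus> z \<noteq> \<zero>"
    hence "min (v y) (v z) \<le> v (y \<oplus> z)" using a v_add by blast
    thus "min (w y) (w z) \<le> w (y \<oplus> z)" unfolding w_def using t(3) zdiv_mono1[of _ _ "v t"]
      by (auto simp: min_le_iff_disj)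
  qed
  moreover have "w t = 1" unfolding w_def using t(3) by simp
  moreover have "0 \<le> w y \<longleftrightarrow> 0 \<le> v y" if "y \<in> carrier R" "y \<noteq> \<zero>" for y
    using vw[OF that] t(3) by (simp add: zero_le_mult_iff)
  ultimately show ?thesis using t by blast
qed

end

text \<open>
  A valuation ring without reference to a valuation: of each nonzero element and its inverse, one belongs to it.
\<close>

locale valuation_ring = field R for R (structure) +
  fixes V
  assumes V: "subring V R" and val: "\<And>x. x \<in> carrier R \<Longrightarrow> x \<noteq> \<zero> \<Longrightarrow> x \<in> V \<or> inv x \<in> V"
begin

lemmas V' = subringE[OF V]

definition unit where "unit u \<longleftrightarrow> u \<in> V \<and> u \<noteq> \<zero> \<and> inv u \<in> V"

lemma unit_carr: "unit u \<Longrightarrow> u \<in> carrier R" unfolding unit_def using V' by auto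

lemma unit_mult: "unit u \<Longrightarrow> unit w \<Longrightarrow> unit (u \<otimes> w)"
  using unit_carr[of u] unit_carr[of w] V' unfolding unit_def by (auto simp: inv_mult)

lemma unit_inv: "unit u \<Longrightarrow> unit (inv u)"
  using unit_carr[of u] unfolding unit_def by auto

lemma unit_one: "unit \<one>" unfolding unit_def using V' by auto

lemma V_pow: "x \<in> V \<Longrightarrow> x [^] (n::nat) \<in> V"
  using V' by (induct n) auto

text \<open>
  The nonunits of a valuation ring form an ideal, to which \<open>\<one>\<close> does not belong.
\<close>

lemma one_plus_nonunit:
  assumes r: "r \<in> V" "\<not> unit r" shows "unit (\<one> \<oplus> r)"
proof (cases "r = \<zero>")
  case False
  have rc: "r \<in> carrier R" using r V' by auto
  have ir: "inv r \<notin> V" using r False unfolding unit_def by auto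
  let ?z = "\<one> \<oplus> r"
  have zV: "?z \<in> V" using r V' by auto
  have zc: "?z \<in> carrier R" using rc by auto
  have z0: "?z \<noteq> \<zero>"
  proof
    assume "?z = \<zero>"
    hence "r = \<ominus> \<one>" using rc by (metis minus_equality one_closed a_comm minus_minus)
    moreover have "\<ominus> \<one> \<otimes> \<ominus> \<one> = \<one>" by algebra
    hence "inv (\<ominus> \<one>) = \<ominus> \<one>" by (intro comm_inv_char) auto
    ultimately show False using ir V' by auto
  qed
  have "inv ?z \<in> V"
  proof (rule ccontr)
    assume iz: "inv ?z \<notin> V"
    have "r \<otimes> inv ?z \<in> V \<or> inv (r \<otimes> inv ?z) \<in> V" using val[of "r \<otimes> inv ?z"] rc zc z0 False by auto
    thus False
    proof
      assume a: "r \<otimes> inv ?z \<in> V"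
      have "\<one> \<ominus> r \<otimes> inv ?z = ?z \<otimes> inv ?z \<ominus> r \<otimes> inv ?z" using zc z0 by simp
      also have "\<dots> = inv ?z" using inv_nz(1)[OF zc z0] rc by algebra
      finally show False using iz a V' by (simp add: a_minus_def) (metis V'(3,5,7))
    next
      assume "inv (r \<otimes> inv ?z) \<in> V"
      hence a: "inv r \<otimes> ?z \<in> V" using rc zc z0 False by (simp add: inv_mult)
      have "inv r \<otimes> ?z \<ominus> \<one> = inv r \<otimes> ?z \<ominus> inv r \<otimes> r" using rc False by simp
      also have "\<dots> = inv r" using inv_nz(1)[OF rc False] rc by algebra
      finally show False using ir a V' by (simp add: a_minus_def) (metis V'(3,5,7))
    qed
  qed
  thus ?thesis using zV z0 unfolding unit_def by simp
qed (use unit_one in simp)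

text \<open>
  In a vanishing sum two nonzero terms \<open>a\<^sub>i x\<^sup>i\<close> and \<open>a\<^sub>j x\<^sup>j\<close> must agree up to a unit, since otherwise
  one term would dominate. Hence \<open>x\<^sup>i\<^sup>-\<^sup>j\<close> is a unit times an element of \<open>K\<close>. The induction
  over the coefficients produces either such a pair or a dominating term.
\<close>

lemma power_of_coefficient_times_unit:
  assumes K: "subfield K R" and x: "x \<in> carrier R" "x \<noteq> \<zero>" and P: "set P \<subseteq> K" "\<not> set P \<subseteq> {\<zero>}" "eval P x = \<zero>"
  shows "\<exists>k. 1 \<le> k \<and> k < length P \<and> (\<exists>a\<in>K. a \<noteq> \<zero> \<and> (\<exists>u. unit u \<and> x [^] k = a \<otimes> u))"
proof -
  note K' = subringE[OF subfieldE(1)[OF K]]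
  have Ki: "inv a \<in> K" if "a \<in> K" "a \<noteq> \<zero>" for a using that subfield_m_inv(1)[OF K, of a] by auto
  define Q where "Q l \<longleftrightarrow> (\<exists>k. 1 \<le> k \<and> k < l \<and> (\<exists>a\<in>K. a \<noteq> \<zero> \<and> (\<exists>u. unit u \<and> x [^] k = a \<otimes> u)))" for l :: nat
  have mono: "Q l \<Longrightarrow> Q (Suc l)" for l unfolding Q_def by (meson less_SucI)
  have "Q (length P) \<or> (\<exists>a\<in>K. a \<noteq> \<zero> \<and> (\<exists>j<length P. \<exists>u. unit u \<and> eval P x = a \<otimes> x [^] j \<otimes> u))"
    using P(1,2)
  proof (induct P)
    case (Cons c P)
    let ?l = "length P" let ?e = "eval P x"
    have c: "c \<in> K" "c \<in> carrier R" using Cons(2) K' by auto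
    have sp: "set P \<subseteq> carrier R" using Cons(2) K' by auto
    have ec: "?e \<in> carrier R" using eval_in_carrier[OF sp x(1)] .
    have xl: "x [^] ?l \<in> carrier R" "x [^] ?l \<noteq> \<zero>" using x by auto
    show ?case
    proof (cases "set P \<subseteq> {\<zero>}")
      case True
      hence "?e = \<zero>" using x by (induct P) auto
      hence "eval (c # P) x = c \<otimes> x [^] ?l \<otimes> \<one>" using c xl by simp
      moreover have "c \<noteq> \<zero>" using Cons(3) True by auto
      ultimately show ?thesis using c unit_one by (metis length_Cons lessI)
    next
      case False
      hence IH: "Q ?l \<or> (\<exists>a\<in>K. a \<noteq> \<zero> \<and> (\<exists>j<?l. \<exists>u. unit u \<and> ?e = a \<otimes> x [^] j \<otimes> u))" using Cons by simp
      show ?thesis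
      proof (cases "Q ?l")
        case True thus ?thesis using mono by simp
      next
        case nQ: False
        then obtain a j u where a: "a \<in> K" "a \<noteq> \<zero>" "j < ?l" "unit u" "?e = a \<otimes> x [^] j \<otimes> u" using IH by blast
        have ac: "a \<in> carrier R" "u \<in> carrier R" "u \<noteq> \<zero>" using a K' unit_carr unfolding unit_def by auto
        have xj: "x [^] j \<in> carrier R" "x [^] j \<noteq> \<zero>" using x by auto
        have e0: "?e \<noteq> \<zero>" using a ac xj by simp
        show ?thesis
        proof (cases "c = \<zero>")
          case True
          hence "eval (c # P) x = a \<otimes> x [^] j \<otimes> u" using a(5) ec xl by simp
          thus ?thesis using a by (metis length_Cons less_SucI)
        next
          case c0: False
          let ?t = "c \<otimes> x [^] ?l"
          have t: "?t \<in> carrier R" "?t \<noteq> \<zero>" using c c0 xl by auto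
          \<comment> \<open>The quotient of the new term and the previous partial sum decides: a unit yields a pair of
            terms that agree up to a unit, and otherwise one of the two dominates.\<close>
          define r where "r = ?t \<otimes> inv ?e"
          have r: "r \<in> carrier R" "r \<noteq> \<zero>" "inv r = ?e \<otimes> inv ?t" "r \<otimes> ?e = ?t" "inv r \<otimes> ?t = ?e"
            unfolding r_def using t ec e0 by (auto simp: inv_mult m_comm)
          have ev: "eval (c # P) x = ?t \<oplus> ?e" by simp
          consider "unit r" | "r \<in> V" "\<not> unit r" | "inv r \<in> V" "\<not> unit (inv r)"
            using val[OF r(1,2)] unit_inv[of "inv r"] inv_inv_nz[OF r(1,2)] by (cases "unit r"; auto)
          thus ?thesis
          proof cases
            case 1
            define y where "y = x [^] (?l - j)"
            have y: "y \<in> carrier R" unfolding y_def using x by simp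
            have xx: "x [^] ?l = y \<otimes> x [^] j" unfolding y_def using nat_pow_mult[OF x(1), of "?l - j" j] a(3) by simp
            define z where "z = x [^] j"
            have z: "z \<in> carrier R" "z \<noteq> \<zero>" using xj z_def by auto
            have "c \<otimes> (y \<otimes> z) = r \<otimes> (a \<otimes> z \<otimes> u)" using r(4) xx a(5) z_def by simp
            hence "(c \<otimes> y) \<otimes> z = (r \<otimes> a \<otimes> u) \<otimes> z" using c y z r(1) ac by (simp add: m_ac)
            hence "c \<otimes> y = r \<otimes> a \<otimes> u" using z c y r(1) ac by (subst (asm) m_rcancel) auto
            hence "inv c \<otimes> (c \<otimes> y) = inv c \<otimes> (r \<otimes> a \<otimes> u)" by simp
            hence "y = inv c \<otimes> (r \<otimes> a \<otimes> u)" using c c0 y by simp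
            also have "\<dots> = (inv c \<otimes> a) \<otimes> (r \<otimes> u)" using inv_nz(1)[OF c(2) c0] r(1) ac by (simp add: m_ac)
            finally have "x [^] (?l - j) = (inv c \<otimes> a) \<otimes> (r \<otimes> u)" unfolding y_def .
            moreover have "inv c \<otimes> a \<in> K" "inv c \<otimes> a \<noteq> \<zero>" using Ki[OF c(1) c0] a K' c c0 ac by auto
            moreover have "unit (r \<otimes> u)" using 1 a unit_mult by auto
            moreover have "1 \<le> ?l - j" "?l - j < length (c # P)" using a(3) by auto
            ultimately have "Q (length (c # P))" unfolding Q_def by blast
            thus ?thesis by simp
          next
            case 2
            have "unit (u \<otimes> (\<one> \<oplus> r))" using one_plus_nonunit[OF 2] unit_mult a by auto
            moreover have "eval (c # P) x = r \<otimes> ?e \<oplus> ?e" unfolding ev r(4) ..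
            hence "eval (c # P) x = ?e \<otimes> (\<one> \<oplus> r)" using r(1) ec by (simp add: r_distr m_comm a_comm)
            hence "eval (c # P) x = a \<otimes> x [^] j \<otimes> (u \<otimes> (\<one> \<oplus> r))" unfolding a(5) using ac xj r(1) by (simp add: m_assoc)
            ultimately show ?thesis using a by (metis length_Cons less_SucI)
          next
            case 3
            have "unit (\<one> \<oplus> inv r)" using one_plus_nonunit[OF 3] .
            moreover have "eval (c # P) x = ?t \<oplus> inv r \<otimes> ?t" unfolding ev r(5) ..
            hence "eval (c # P) x = c \<otimes> x [^] ?l \<otimes> (\<one> \<oplus> inv r)" using inv_nz(1)[OF r(1,2)] t(1) by algebra
            ultimately show ?thesis using c c0 by (metis length_Cons lessI)
          qed
        qed
      qed
    qed
  qed simp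
  moreover have "a \<otimes> x [^] j \<otimes> u \<noteq> \<zero>" if "a \<in> K" "a \<noteq> \<zero>" "unit u" for a u and j :: nat
    using that K'(1) unit_carr[of u] x unfolding unit_def by auto
  ultimately show ?thesis using P(3) unfolding Q_def by metis
qed

text \<open>
  The hypothesis says that some fixed multiple \<open>N\<close> of each value is a multiple of the value of \<open>\<pi>\<close>. Then
  \<open>x \<mapsto> b - a\<close> is a valuation with values in the integers whose valuation ring is \<open>V\<close>;
  normalizing it yields the value one.
\<close>

theorem discrete_valuation:
  assumes \<pi>: "\<pi> \<in> V" "\<pi> \<noteq> \<zero>" "inv \<pi> \<notin> V" and N: "0 < N"
    and fin: "\<And>x. x \<in> carrier R \<Longrightarrow> x \<noteq> \<zero> \<Longrightarrow> \<exists>a b. \<exists>u. unit u \<and> x [^] (N::nat) \<otimes> \<pi> [^] (a::nat) = \<pi> [^] (b::nat) \<otimes> u"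
  shows "\<exists>v t. valued_field R v \<and> t \<in> carrier R \<and> t \<noteq> \<zero> \<and> v t = 1 \<and>
    (\<forall>y\<in>carrier R. y \<noteq> \<zero> \<longrightarrow> (0 \<le> v y \<longleftrightarrow> y \<in> V))"
proof -
  have \<pi>c: "\<pi> \<in> carrier R" using \<pi> V' by auto
  have pc: "\<pi> [^] (n::nat) \<in> carrier R" "\<pi> [^] n \<noteq> \<zero>" for n using \<pi>c \<pi> by auto
  have no: "\<pi> [^] (Suc k) \<otimes> w \<noteq> u" if "w \<in> V" "unit u" for k w u
  proof
    assume *: "\<pi> [^] (Suc k) \<otimes> w = u"
    have c: "w \<in> carrier R" "u \<in> carrier R" "u \<noteq> \<zero>" using that V' unit_carr unfolding unit_def by auto
    have "\<pi> \<otimes> (\<pi> [^] k \<otimes> w \<otimes> inv u) = \<pi> [^] (Suc k) \<otimes> w \<otimes> inv u"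
      using c pc(1)[of k] \<pi>c inv_nz(1)[OF c(2,3)] by (simp add: m_ac)
    also have "\<dots> = \<one>" unfolding * using c by simp
    finally have "inv \<pi> = \<pi> [^] k \<otimes> w \<otimes> inv u"
      using c pc(1)[of k] \<pi>c inv_nz(1)[OF c(2,3)] by (intro comm_inv_char) auto
    moreover have "\<pi> [^] k \<otimes> w \<otimes> inv u \<in> V" using V_pow[OF \<pi>(1)] that V' unfolding unit_def by auto
    ultimately show False using \<pi> by simp
  qed
  define rel where "rel x m \<longleftrightarrow> (\<exists>a b. \<exists>u. unit u \<and> x [^] N \<otimes> \<pi> [^] (a::nat) = \<pi> [^] (b::nat) \<otimes> u \<and> m = int b - int a)" for x m
  have relE: thesis if "rel x m"
    "\<And>u a b. unit u \<Longrightarrow> x [^] N \<otimes> \<pi> [^] (a::nat) = \<pi> [^] (b::nat) \<otimes> u \<Longrightarrow> m = int b - int a \<Longrightarrow> thesis" for x m thesis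
    using that(1) unfolding rel_def by (elim exE conjE) (rule that(2))
  \<comment> \<open>Well-definedness: a difference would make a positive power of \<open>\<pi>\<close> divide a unit.\<close>
  have aux: "\<not> b' + a < b + a'" if r: "unit u" "x [^] N \<otimes> \<pi> [^] a = \<pi> [^] b \<otimes> u" "unit u'" "x [^] N \<otimes> \<pi> [^] a' = \<pi> [^] b' \<otimes> u'"
    and x: "x \<in> carrier R" for x u u' and a b a' b' :: nat
  proof
    assume "b' + a < b + a'"
    then obtain k where k: "b + a' = (b' + a) + Suc k" by (metis add_Suc_right less_iff_Suc_add)
    have c: "u \<in> carrier R" "u' \<in> carrier R" "x [^] N \<in> carrier R" using unit_carr r x by auto
    have "\<pi> [^] (b' + a) \<otimes> (\<pi> [^] (Suc k) \<otimes> u) = \<pi> [^] (b + a') \<otimes> u"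
      unfolding k using nat_pow_mult[OF \<pi>c, of "b' + a" "Suc k"] pc(1)[of "b'+a"] pc(1)[of "Suc k"] c by (simp only: m_assoc[symmetric])
    also have "\<dots> = \<pi> [^] b \<otimes> \<pi> [^] a' \<otimes> u" using nat_pow_mult[OF \<pi>c, of b a'] by simp
    also have "\<dots> = \<pi> [^] a' \<otimes> (\<pi> [^] b \<otimes> u)" using pc(1)[of b] pc(1)[of a'] c by (simp add: m_ac)
    also have "\<dots> = \<pi> [^] a' \<otimes> (x [^] N \<otimes> \<pi> [^] a)" unfolding r(2) ..
    also have "\<dots> = \<pi> [^] a \<otimes> (x [^] N \<otimes> \<pi> [^] a')" using pc(1)[of a] pc(1)[of a'] c by (simp add: m_ac)
    also have "\<dots> = \<pi> [^] a \<otimes> (\<pi> [^] b' \<otimes> u')" unfolding r(4) ..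
    also have "\<dots> = \<pi> [^] (a + b') \<otimes> u'" unfolding nat_pow_mult[OF \<pi>c, of a b', symmetric]
      using pc(1)[of a] pc(1)[of b'] c by (simp only: m_assoc)
    also have "\<dots> = \<pi> [^] (b' + a) \<otimes> u'" by (simp only: add.commute)
    finally have "\<pi> [^] (Suc k) \<otimes> u = u'" using m_lcancel[OF pc(2) pc(1), of "\<pi> [^] (Suc k) \<otimes> u" u' "b' + a"] c pc(1)[of "Suc k"] by blast
    thus False using no[of u u' k] r unfolding unit_def by auto
  qed
  have uniq: "m = m'" if rm: "rel x m" and rm': "rel x m'" and xx: "x \<in> carrier R" for x m m'
  proof -
    obtain u a b where r: "unit u" "x [^] N \<otimes> \<pi> [^] (a::nat) = \<pi> [^] (b::nat) \<otimes> u" "m = int b - int a" using rm by (rule relE)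
    obtain u' a' b' where r': "unit u'" "x [^] N \<otimes> \<pi> [^] (a'::nat) = \<pi> [^] (b'::nat) \<otimes> u'" "m' = int b' - int a'" using rm' by (rule relE)
    show ?thesis using aux[OF r(1,2) r'(1,2) xx] aux[OF r'(1,2) r(1,2) xx] r(3) r'(3) by linarith
  qed
  define v where "v x = (THE m. rel x m)" for x
  have vI: "v x = m" if "rel x m" "x \<in> carrier R" for x m
    unfolding v_def using that uniq by (intro the_equality) blast+
  have vE: "rel x (v x)" if x: "x \<in> carrier R" "x \<noteq> \<zero>" for x
  proof -
    obtain m where "rel x m" using fin[OF x] unfolding rel_def by blast
    thus ?thesis using vI x by metis
  qed
  have vmult: "v (x \<otimes> y) = v x + v y" if xy: "x \<in> carrier R" "y \<in> carrier R" "x \<noteq> \<zero>" "y \<noteq> \<zero>" for x y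
  proof (rule vI)
    obtain u a b where r: "unit u" "x [^] N \<otimes> \<pi> [^] (a::nat) = \<pi> [^] (b::nat) \<otimes> u" "v x = int b - int a" using vE[OF xy(1,3)] by (rule relE)
    obtain u' a' b' where r': "unit u'" "y [^] N \<otimes> \<pi> [^] (a'::nat) = \<pi> [^] (b'::nat) \<otimes> u'" "v y = int b' - int a'" using vE[OF xy(2,4)] by (rule relE)
    have c: "u \<in> carrier R" "u' \<in> carrier R" "x [^] N \<in> carrier R" "y [^] N \<in> carrier R" using unit_carr r r' xy by auto
    have "(x \<otimes> y) [^] N \<otimes> \<pi> [^] (a + a') = (x [^] N \<otimes> \<pi> [^] a) \<otimes> (y [^] N \<otimes> \<pi> [^] a')"
      using nat_pow_distrib[OF xy(1,2), of N] nat_pow_mult[OF \<pi>c, of a a', symmetric] pc(1)[of a] pc(1)[of a'] c by (simp add: m_ac)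
    also have "\<dots> = (\<pi> [^] b \<otimes> u) \<otimes> (\<pi> [^] b' \<otimes> u')" unfolding r(2) r'(2) ..
    also have "\<dots> = \<pi> [^] (b + b') \<otimes> (u \<otimes> u')"
      using nat_pow_mult[OF \<pi>c, of b b', symmetric] pc(1)[of b] pc(1)[of b'] c by (simp add: m_ac)
    finally have "(x \<otimes> y) [^] N \<otimes> \<pi> [^] (a + a') = \<pi> [^] (b + b') \<otimes> (u \<otimes> u')" .
    moreover have "v x + v y = int (b + b') - int (a + a')" using r r' by simp
    ultimately show "rel (x \<otimes> y) (v x + v y)" unfolding rel_def using unit_mult[OF r(1) r'(1)] by blast
  qed (use xy in auto)
  have vone: "v \<one> = 0" using vmult[of \<one> \<one>] by simp
  have vV: "0 \<le> v x" if x: "x \<in> V" "x \<noteq> \<zero>" for x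
  proof (rule ccontr)
    have xc: "x \<in> carrier R" using x V' by auto
    obtain u a b where r: "unit u" "x [^] N \<otimes> \<pi> [^] (a::nat) = \<pi> [^] (b::nat) \<otimes> u" "v x = int b - int a" using vE[OF xc x(2)] by (rule relE)
    assume "\<not> 0 \<le> v x"
    hence "b < a" using r by linarith
    then obtain k where k: "a = b + Suc k" by (metis add_Suc_right less_iff_Suc_add)
    have c: "u \<in> carrier R" "x [^] N \<in> carrier R" using unit_carr r xc by auto
    have "\<pi> [^] b \<otimes> (\<pi> [^] (Suc k) \<otimes> x [^] N) = (\<pi> [^] b \<otimes> \<pi> [^] (Suc k)) \<otimes> x [^] N"
      using pc(1)[of b] pc(1)[of "Suc k"] c by (simp only: m_assoc)
    also have "\<dots> = x [^] N \<otimes> \<pi> [^] a" unfolding nat_pow_mult[OF \<pi>c] k using m_comm pc(1) c by blast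
    also have "\<dots> = \<pi> [^] b \<otimes> u" by (rule r(2))
    finally have "\<pi> [^] (Suc k) \<otimes> x [^] N = u" using m_lcancel[OF pc(2) pc(1), of "\<pi> [^] (Suc k) \<otimes> x [^] N" u b] c pc(1)[of "Suc k"] by blast
    thus False using no[OF V_pow[OF x(1), of N] r(1), of k] by simp
  qed
  have vinv: "v (inv x) = - v x" if "x \<in> carrier R" "x \<noteq> \<zero>" for x
    using vmult[of x "inv x"] that vone by auto
  have Vv: "x \<in> V" if x: "x \<in> carrier R" "x \<noteq> \<zero>" "0 \<le> v x" for x
  proof (rule ccontr)
    assume nx: "x \<notin> V"
    hence ix: "inv x \<in> V" "inv x \<in> carrier R" using val x by auto
    have "0 \<le> v (inv x)" using vV[OF ix(1)] x by auto
    hence v0: "v x = 0" using vinv x by auto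
    obtain u a b where r: "unit u" "x [^] N \<otimes> \<pi> [^] (a::nat) = \<pi> [^] (b::nat) \<otimes> u" "v x = int b - int a" using vE[OF x(1,2)] by (rule relE)
    have c: "u \<in> carrier R" "x [^] N \<in> carrier R" using unit_carr r x by auto
    have "b = a" using v0 r by simp
    hence "\<pi> [^] a \<otimes> x [^] N = \<pi> [^] a \<otimes> u" using r(2) m_comm[OF c(2) pc(1)[of a]] by simp
    hence xN: "x [^] N = u" using m_lcancel[OF pc(2) pc(1) c(2) c(1)] by blast
    obtain M where M: "N = Suc M" using N by (cases N) auto
    have "u \<otimes> inv x [^] M = x \<otimes> (x [^] M \<otimes> inv x [^] M)" unfolding xN[symmetric] M using x ix by (simp add: m_ac)
    also have "x [^] M \<otimes> inv x [^] M = \<one>" using nat_pow_distrib[of x "inv x" M] x by simp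
    finally have "x = u \<otimes> inv x [^] M" using x by simp
    moreover have "u \<otimes> inv x [^] M \<in> V" using r(1) V_pow[OF ix(1)] V' unfolding unit_def by auto
    ultimately show False using nx by simp
  qed
  have vadd: "v x \<le> v (x \<oplus> y)" if xy: "x \<in> carrier R" "y \<in> carrier R" "x \<noteq> \<zero>" "y \<noteq> \<zero>" "x \<oplus> y \<noteq> \<zero>" and le: "v x \<le> v y" for x y
  proof -
    have q: "y \<otimes> inv x \<in> carrier R" "y \<otimes> inv x \<noteq> \<zero>" "v (y \<otimes> inv x) = v y - v x" using xy vmult[of y "inv x"] vinv by auto
    hence "y \<otimes> inv x \<in> V" using Vv le by simp
    hence s: "\<one> \<oplus> y \<otimes> inv x \<in> V" "\<one> \<oplus> y \<otimes> inv x \<in> carrier R" using V' q by auto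
    have e: "x \<oplus> y = x \<otimes> (\<one> \<oplus> y \<otimes> inv x)" using xy q by (simp add: r_distr)
    hence s0: "\<one> \<oplus> y \<otimes> inv x \<noteq> \<zero>" using xy by auto
    have "v (x \<oplus> y) = v x + v (\<one> \<oplus> y \<otimes> inv x)" unfolding e using vmult xy s s0 by blast
    thus ?thesis using vV[OF s(1) s0] by simp
  qed
  have vf: "valued_field R v"
  proof (unfold_locales)
    fix x y assume a: "x \<in> carrier R" "y \<in> carrier R" "x \<noteq> \<zero>" "y \<noteq> \<zero>"
    show "v (x \<otimes> y) = v x + v y" by (rule vmult[OF a])
    assume s: "x \<oplus> y \<noteq> \<zero>"
    show "min (v x) (v y) \<le> v (x \<oplus> y)"
    proof (cases "v x \<le> v y")
      case True thus ?thesis using vadd[OF a s] by simp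
    next
      case False thus ?thesis using vadd[OF a(2,1,4,3)] s a_comm[OF a(1,2)] by auto
    qed
  qed
  interpret W: valued_field R v by (rule vf)
  have "\<not> 0 \<le> v (inv \<pi>)" using Vv[of "inv \<pi>"] \<pi> \<pi>c by auto
  hence "v \<pi> \<noteq> 0" using vinv \<pi>c \<pi> by auto
  then obtain w t where "valued_field R w" "t \<in> carrier R" "t \<noteq> \<zero>" "w t = 1"
    "\<And>y. y\<in>carrier R \<Longrightarrow> y \<noteq> \<zero> \<Longrightarrow> (0 \<le> w y \<longleftrightarrow> 0 \<le> v y)"
    using W.normalize_valuation[OF \<pi>c \<pi>(2)] by blast
  moreover have "0 \<le> v y \<longleftrightarrow> y \<in> V" if "y \<in> carrier R" "y \<noteq> \<zero>" for y using vV Vv that by blast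
  ultimately show ?thesis by metis
qed

end

section \<open>Primes of an integral closure and their valuations\<close>

text \<open>
  The integral closure \<open>C\<close> of \<open>A\<close> in \<open>R\<close>. The assumption on \<open>\<pi>\<close> says that it generates the maximal ideal of
  the localization of \<open>A\<close> at \<open>\<pp>\<close>; the last one bounds the degree of \<open>R\<close> over the fraction field
  of \<open>A\<close> by \<open>n\<close>, with denominators cleared. The same \<open>\<pi>\<close> and \<open>n\<close> serve for all intermediate
  fields.
\<close>

locale dedekind_extension = noetherian_prime +
  fixes \<pi> and n :: nat and C
  assumes \<pi>: "\<pi> \<in> \<pp>" "\<pi> \<noteq> \<zero>"
    and uniformizer: "\<And>x. x \<in> A \<Longrightarrow> x \<noteq> \<zero> \<Longrightarrow> \<exists>m::nat. \<exists>s\<in>A - \<pp>. \<exists>u\<in>A - \<pp>. s \<otimes> x = \<pi> [^] m \<otimes> u"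
    and C: "subring C R" "C = integral_closure R A (carrier R)"
    and dependent: "\<And>us. set us \<subseteq> carrier R \<Longrightarrow> length us = Suc n \<Longrightarrow>
      \<exists>as. length as = length us \<and> set as \<subseteq> A \<and> \<not> set as \<subseteq> {\<zero>} \<and> combine as us = \<zero>"
begin

lemmas C' = subringE[OF C(1)]

lemma Cc: "c \<in> C \<Longrightarrow> c \<in> carrier R" using C'(1) by auto

lemma A_sub_C: "A \<subseteq> C"
  unfolding C(2) by (rule integral_closure_incl[OF A A'(1)])

lemma \<pi>_mem: "\<pi> \<in> A" "\<pi> \<in> C" "\<pi> \<in> carrier R" using \<pi> p(1) A_sub_C Ac by auto

text \<open>
  Over the localization at \<open>\<pp>\<close>, \<open>\<pi>\<^sup>m\<close> is the content of the list \<open>as\<close> and \<open>bs\<close> its primitive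
  part; \<open>s\<close> is a common denominator.
\<close>

lemma extract_content:
  assumes "set as \<subseteq> A" "\<not> set as \<subseteq> {\<zero>}"
  shows "\<exists>s\<in>A - \<pp>. \<exists>m::nat. \<exists>bs. set bs \<subseteq> A \<and> \<not> set bs \<subseteq> \<pp> \<and> length bs = length as \<and>
    map (\<lambda>a. s \<otimes> a) as = map (\<lambda>b. \<pi> [^] m \<otimes> b) bs"
  using assms
proof (induct as)
  case (Cons a as)
  have a: "a \<in> A" "a \<in> carrier R" and as: "set as \<subseteq> A" "set as \<subseteq> carrier R" using Cons Ac by auto
  have \<pi>p: "\<pi> [^] m \<in> carrier R" "\<pi> [^] m \<in> A" for m :: nat using \<pi>_mem A' by (induct m) auto
  show ?case
  proof (cases "set as \<subseteq> {\<zero>}")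
    case True
    hence "a \<noteq> \<zero>" using Cons(3) by auto
    then obtain m s u where u: "s \<in> A - \<pp>" "u \<in> A - \<pp>" "s \<otimes> a = \<pi> [^] (m::nat) \<otimes> u" using uniformizer a by blast
    have "map (\<lambda>a. s \<otimes> a) as = map (\<lambda>b. \<pi> [^] m \<otimes> b) as"
      using True u(1) Ac \<pi>p by (intro map_cong) auto
    thus ?thesis using u as by (intro bexI[OF _ u(1)] exI[of _ m] exI[of _ "u # as"]) auto
  next
    case False
    then obtain s m bs where IH: "s \<in> A - \<pp>" "set bs \<subseteq> A" "\<not> set bs \<subseteq> \<pp>" "length bs = length as"
      "map (\<lambda>a. s \<otimes> a) as = map (\<lambda>b. \<pi> [^] (m::nat) \<otimes> b) bs" using Cons(1)[OF as(1)] by blast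
    have sc: "s \<in> carrier R" using IH Ac by auto
    have bsc: "set bs \<subseteq> carrier R" using IH(2) Ac by auto
    show ?thesis
    proof (cases "a = \<zero>")
      case True
      have "map (\<lambda>a. s \<otimes> a) (a # as) = map (\<lambda>b. \<pi> [^] m \<otimes> b) (\<zero> # bs)" using IH(5) True sc \<pi>p by simp
      thus ?thesis using IH A' by (intro bexI[OF _ IH(1)] exI[of _ m] exI[of _ "\<zero> # bs"]) auto
    next
      case a0: False
      then obtain k t u where u: "t \<in> A - \<pp>" "u \<in> A - \<pp>" "t \<otimes> a = \<pi> [^] (k::nat) \<otimes> u" using uniformizer a by blast
      have tc: "t \<in> carrier R" "u \<in> carrier R" using u Ac by auto
      have st: "s \<otimes> t \<in> A - \<pp>" using den_mult IH u by auto
      have sta: "(s \<otimes> t) \<otimes> a = s \<otimes> (\<pi> [^] k \<otimes> u)" using sc tc a u(3) by (simp add: m_assoc)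
      have m1: "map (\<lambda>a. (s \<otimes> t) \<otimes> a) as = map (\<lambda>x. t \<otimes> x) (map (\<lambda>a. s \<otimes> a) as)"
        using as sc tc by (auto simp: m_ac)
      show ?thesis
      proof (cases "m \<le> k")
        case True
        then obtain j where j: "k = m + j" using le_Suc_ex by blast
        define b where "b = s \<otimes> (\<pi> [^] j \<otimes> u)"
        have "(s \<otimes> t) \<otimes> a = \<pi> [^] m \<otimes> b" unfolding sta b_def j using sc tc \<pi>p[of m] \<pi>p[of j] \<pi>_mem(3) by (simp add: m_ac flip: nat_pow_mult)
        moreover have "map (\<lambda>a. (s \<otimes> t) \<otimes> a) as = map (\<lambda>b. \<pi> [^] m \<otimes> b) (map (\<lambda>x. t \<otimes> x) bs)"
          unfolding m1 IH(5) using bsc tc \<pi>p[of m] by (auto simp: m_lcomm)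
        ultimately have eq: "map (\<lambda>a. (s \<otimes> t) \<otimes> a) (a # as) = map (\<lambda>b. \<pi> [^] m \<otimes> b) (b # map (\<lambda>x. t \<otimes> x) bs)" by simp
        obtain x where "x \<in> set bs" "x \<notin> \<pp>" using IH(3) by auto
        hence "t \<otimes> x \<notin> \<pp>" using p(6)[of t x] u IH(2) by auto
        hence "\<not> set (b # map (\<lambda>x. t \<otimes> x) bs) \<subseteq> \<pp>" using \<open>x \<in> set bs\<close> by auto
        moreover have "set (b # map (\<lambda>x. t \<otimes> x) bs) \<subseteq> A" unfolding b_def using IH(1,2) u \<pi>p A' by auto
        ultimately show ?thesis using eq st IH(4)
          by (intro bexI[OF _ st] exI[of _ m] exI[of _ "b # map (\<lambda>x. t \<otimes> x) bs"]) auto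
      next
        case False
        then obtain j where j: "m = k + j" using le_Suc_ex nat_le_linear by blast
        have "(s \<otimes> t) \<otimes> a = \<pi> [^] k \<otimes> (s \<otimes> u)" unfolding sta using sc tc \<pi>p[of k] by (simp add: m_ac)
        moreover have "map (\<lambda>a. (s \<otimes> t) \<otimes> a) as = map (\<lambda>b. \<pi> [^] k \<otimes> b) (map (\<lambda>x. t \<otimes> (\<pi> [^] j \<otimes> x)) bs)"
          unfolding m1 IH(5) j using bsc tc \<pi>p[of k] \<pi>p[of j] \<pi>_mem(3) by (auto simp: m_ac simp flip: nat_pow_mult)
        ultimately have eq: "map (\<lambda>a. (s \<otimes> t) \<otimes> a) (a # as) = map (\<lambda>b. \<pi> [^] k \<otimes> b) ((s \<otimes> u) # map (\<lambda>x. t \<otimes> (\<pi> [^] j \<otimes> x)) bs)" by simp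
        have "set ((s \<otimes> u) # map (\<lambda>x. t \<otimes> (\<pi> [^] j \<otimes> x)) bs) \<subseteq> A" using IH(1,2) u \<pi>p A' by auto
        moreover have "s \<otimes> u \<notin> \<pp>" using den_mult IH u by auto
        ultimately show ?thesis using eq IH(4)
          by (intro bexI[OF _ st] exI[of _ k] exI[of _ "(s \<otimes> u) # map (\<lambda>x. t \<otimes> (\<pi> [^] j \<otimes> x)) bs"]) auto
      qed
    qed
  qed
qed simp

lemma primitive_dependence:
  assumes "set us \<subseteq> carrier R" "length us = Suc n"
  shows "\<exists>as. length as = length us \<and> set as \<subseteq> A \<and> \<not> set as \<subseteq> \<pp> \<and> combine as us = \<zero>"
proof -
  obtain as where as: "length as = length us" "set as \<subseteq> A" "\<not> set as \<subseteq> {\<zero>}" "combine as us = \<zero>"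
    using dependent[OF assms] by blast
  obtain s m bs where b: "s \<in> A - \<pp>" "set bs \<subseteq> A" "\<not> set bs \<subseteq> \<pp>" "length bs = length as"
      "map (\<lambda>a. s \<otimes> a) as = map (\<lambda>b. \<pi> [^] (m::nat) \<otimes> b) bs" using extract_content[OF as(2,3)] by blast
  have c: "set as \<subseteq> carrier R" "set bs \<subseteq> carrier R" "s \<in> carrier R" using as b Ac by auto
  have "\<pi> [^] m \<otimes> combine bs us = s \<otimes> combine as us"
    using combine_smult[OF c(1) assms(1) c(3)] combine_smult[OF c(2) assms(1), of "\<pi> [^] m"] b(5) \<pi>_mem by simp
  hence "\<pi> [^] m \<otimes> combine bs us = \<zero>" using as(4) c by simp
  moreover have "combine bs us \<in> carrier R" using c assms by auto
  ultimately have "combine bs us = \<zero>" using \<pi>(2) \<pi>_mem(3) by (metis mult_nz nat_pow_closed pow_nz)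
  thus ?thesis using b as by auto
qed

lemma primitive_relation:
  assumes "x \<in> carrier R"
  shows "\<exists>f. length f = Suc n \<and> set f \<subseteq> A \<and> \<not> set f \<subseteq> \<pp> \<and> eval f x = \<zero>"
proof -
  have "set (exp_base x (Suc n)) \<subseteq> carrier R" "length (exp_base x (Suc n)) = Suc n"
    using assms unfolding exp_base_def by auto
  then obtain as where "length as = Suc n" "set as \<subseteq> A" "\<not> set as \<subseteq> \<pp>" "combine as (exp_base x (Suc n)) = \<zero>"
    using primitive_dependence by metis
  thus ?thesis using combine_eq_eval[of as x] by auto
qed

definition lies_over :: "'a set \<Rightarrow> bool" where
  "lies_over P \<longleftrightarrow> primeideal P (R\<lparr>carrier := C\<rparr>) \<and> P \<inter> A = \<pp>"

lemma over_prime: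
  assumes "lies_over P"
  shows "ideal P (R\<lparr>carrier := C\<rparr>)" "P \<subseteq> C" "\<zero> \<in> P" "\<And>x y. x \<in> P \<Longrightarrow> y \<in> P \<Longrightarrow> x \<oplus> y \<in> P"
    "\<And>a x. a \<in> C \<Longrightarrow> x \<in> P \<Longrightarrow> a \<otimes> x \<in> P" "\<one> \<notin> P"
    "\<And>a b. a \<in> C \<Longrightarrow> b \<in> C \<Longrightarrow> a \<otimes> b \<in> P \<Longrightarrow> a \<in> P \<or> b \<in> P" "\<pp> \<subseteq> P" "\<And>a. a \<in> A \<Longrightarrow> a \<in> P \<Longrightarrow> a \<in> \<pp>"
  using assms unfolding lies_over_def primeideal_subring_iff[OF C(1)] ideal_subring_iff[OF C(1)] by auto

lemma over_den: "lies_over P \<Longrightarrow> s \<in> C - P \<Longrightarrow> t \<in> C - P \<Longrightarrow> s \<otimes> t \<in> C - P"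
  using over_prime(7)[of P s t] C'(6)[of s t] by auto

lemma over_minus: "lies_over P \<Longrightarrow> x \<in> P \<Longrightarrow> y \<in> P \<Longrightarrow> x \<ominus> y \<in> P"
proof -
  assume P: "lies_over P" and x: "x \<in> P" and y: "y \<in> P"
  note Q = over_prime[OF P]
  have c: "x \<in> carrier R" "y \<in> carrier R" using x y Q(2) Cc by auto
  have "\<ominus> \<one> \<otimes> y \<in> P" using Q(5) y C' by auto
  hence "x \<oplus> \<ominus> \<one> \<otimes> y \<in> P" using Q(4) x by auto
  thus "x \<ominus> y \<in> P" using c by (simp add: a_minus_def l_minus)
qed

text \<open>
  Take a monic relation of least degree for \<open>c\<close> modulo \<open>P\<close>. Its constant term is not in \<open>\<pp>\<close>, for otherwise
  \<open>c\<close> could be cancelled, and is invertible modulo \<open>\<pp>\<close>; so \<open>c\<close> divides \<open>1\<close> modulo \<open>P\<close>.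
\<close>

lemma over_maximal:
  assumes P: "lies_over P" and c: "c \<in> C - P"
  shows "\<exists>d\<in>C. c \<otimes> d \<ominus> \<one> \<in> P"
proof -
  note Q = over_prime[OF P]
  have cc: "c \<in> carrier R" "c \<in> C" using c Cc by auto
  define T where "T m \<longleftrightarrow> (\<exists>fs. set fs \<subseteq> A \<and> length fs = m \<and> eval (\<one> # fs) c \<in> P)" for m
  have "c \<in> integral_closure R A (carrier R)" using cc(2) unfolding C(2) .
  then obtain gs where "set gs \<subseteq> A" "eval (\<one> # gs) c = \<zero>" unfolding integral_closure_iff[OF A] by auto
  hence "T (length gs)" unfolding T_def using Q(3) by auto
  hence L: "T (LEAST m. T m)" "\<And>m. T m \<Longrightarrow> (LEAST m. T m) \<le> m" by (auto intro: LeastI Least_le)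
  then obtain fs where fs: "set fs \<subseteq> A" "length fs = (LEAST m. T m)" "eval (\<one> # fs) c \<in> P" unfolding T_def by auto
  have "fs \<noteq> []" using fs(3) Q(6) cc by auto
  then obtain gs a where ga: "fs = gs @ [a]" by (metis rev_exhaust)
  have s: "set (\<one> # gs) \<subseteq> A" "a \<in> A" using fs(1) ga A' by auto
  hence s': "set (\<one> # gs) \<subseteq> carrier R" "a \<in> carrier R" using Ac by auto
  define E where "E = eval (\<one> # gs) c"
  have EC: "E \<in> C" unfolding E_def using eval_in_subring[OF C(1) _ cc(2)] s(1) A_sub_C by blast
  have Ec: "E \<in> carrier R" using EC Cc by auto
  have e: "E \<otimes> c \<oplus> a \<in> P" using fs(3) eval_append_aux[OF s' cc(1)] unfolding ga E_def by simp
  have "a \<notin> \<pp>"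
  proof
    assume "a \<in> \<pp>"
    hence "E \<otimes> c \<oplus> a \<ominus> a \<in> P" using over_minus[OF P e] Q(8) by auto
    hence "E \<otimes> c \<in> P" using Ec cc(1) s'(2) by (simp add: a_minus_def a_assoc r_neg)
    hence "E \<in> P" using Q(7)[OF EC cc(2)] c by auto
    hence "T (length gs)" unfolding T_def E_def using s(1) by auto
    hence "(LEAST m. T m) \<le> length gs" by (rule L(2))
    thus False using fs(2) ga by simp
  qed
  then obtain b where b: "b \<in> A" "a \<otimes> b \<ominus> \<one> \<in> \<pp>" using inverse_modulo s by auto
  have bc: "b \<in> carrier R" "b \<in> C" using b Ac A_sub_C by auto
  have "(a \<otimes> b \<ominus> \<one>) \<ominus> b \<otimes> (E \<otimes> c \<oplus> a) \<in> P"
    using over_minus[OF P] b(2) Q(8) Q(5)[OF bc(2) e] by auto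
  moreover have "(a \<otimes> b \<ominus> \<one>) \<ominus> b \<otimes> (E \<otimes> c \<oplus> a) = c \<otimes> (\<ominus> (b \<otimes> E)) \<ominus> \<one>"
    using s'(2) bc(1) Ec cc(1) by algebra
  moreover have "\<ominus> (b \<otimes> E) \<in> C" using bc EC C' by auto
  ultimately show ?thesis by auto
qed

lemma over_antichain:
  assumes P: "lies_over P" and Q: "lies_over Q" and sub: "Q \<subseteq> P"
  shows "Q = P"
proof (rule ccontr)
  assume "Q \<noteq> P"
  then obtain x where x: "x \<in> P" "x \<notin> Q" using sub by auto
  have xC: "x \<in> C - Q" using x over_prime(2)[OF P] by auto
  then obtain d where d: "d \<in> C" "x \<otimes> d \<ominus> \<one> \<in> Q" using over_maximal[OF Q] by blast
  have c: "x \<in> carrier R" "d \<in> carrier R" using xC d Cc by auto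
  have "d \<otimes> x \<in> P" using over_prime(5)[OF P] d x by auto
  hence "d \<otimes> x \<ominus> (x \<otimes> d \<ominus> \<one>) \<in> P" using over_minus[OF P] d sub by auto
  moreover have "d \<otimes> x \<ominus> (x \<otimes> d \<ominus> \<one>) = \<one>" using c by algebra
  ultimately show False using over_prime(6)[OF P] by simp
qed

text \<open>
  The localization of \<open>C\<close> at \<open>P\<close>, as a subring of \<open>R\<close>.
\<close>

definition local_ring :: "'a set \<Rightarrow> 'a set" where
  "local_ring P = {x \<in> carrier R. \<exists>s\<in>C - P. s \<otimes> x \<in> C}"

lemma local_ring_valuation_ring:
  assumes P: "lies_over P"
  shows "valuation_ring R (local_ring P)" "C \<subseteq> local_ring P" "\<And>s. s \<in> C - P \<Longrightarrow> inv s \<in> local_ring P"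
    "\<And>x. x \<in> P \<Longrightarrow> x \<noteq> \<zero> \<Longrightarrow> inv x \<notin> local_ring P"
proof -
  note Q = over_prime[OF P]
  have one: "\<one> \<in> C - P" using Q C' by auto
  show CL: "C \<subseteq> local_ring P"
  proof
    fix c assume c: "c \<in> C"
    hence "\<one> \<otimes> c \<in> C" using Cc by auto
    thus "c \<in> local_ring P" unfolding local_ring_def using one c Cc by blast
  qed
  show si: "inv s \<in> local_ring P" if s: "s \<in> C - P" for s
  proof -
    have "s \<in> carrier R" "s \<noteq> \<zero>" using s Cc Q(3) by auto
    hence "inv s \<in> carrier R" "s \<otimes> inv s \<in> C" using C' by auto
    thus ?thesis unfolding local_ring_def using s by blast
  qed
  show "inv x \<notin> local_ring P" if x: "x \<in> P" "x \<noteq> \<zero>" for x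
  proof
    assume "inv x \<in> local_ring P"
    then obtain s where s: "s \<in> C - P" "s \<otimes> inv x \<in> C" unfolding local_ring_def by auto
    have xc: "x \<in> carrier R" using x Q(2) Cc by auto
    have "s \<otimes> inv x \<otimes> x \<in> P" using Q(5) s(2) x(1) by auto
    thus False using s xc x Cc by auto
  qed
  have sub: "subring (local_ring P) R"
  proof (rule subringI)
    show "local_ring P \<subseteq> carrier R" unfolding local_ring_def by auto
    show "\<one> \<in> local_ring P" using CL C' by auto
  next
    fix x assume "x \<in> local_ring P"
    then obtain s where s: "s \<in> C - P" "s \<otimes> x \<in> C" "x \<in> carrier R" unfolding local_ring_def by auto
    have sc: "s \<in> carrier R" using s Cc by auto
    have "s \<otimes> \<ominus> x = \<ominus> (s \<otimes> x)" using sc s by algebra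
    hence "s \<otimes> \<ominus> x \<in> C" using s C' by auto
    thus "\<ominus> x \<in> local_ring P" unfolding local_ring_def using s by auto
    fix y assume "y \<in> local_ring P"
    then obtain t where t: "t \<in> C - P" "t \<otimes> y \<in> C" "y \<in> carrier R" unfolding local_ring_def by auto
    have tc: "t \<in> carrier R" using t Cc by auto
    have "(s \<otimes> t) \<otimes> (x \<otimes> y) = (s \<otimes> x) \<otimes> (t \<otimes> y)" using sc tc s(3) t(3) by algebra
    hence "(s \<otimes> t) \<otimes> (x \<otimes> y) \<in> C" using s t C' by auto
    thus "x \<otimes> y \<in> local_ring P" unfolding local_ring_def using over_den[OF P s(1) t(1)] s(3) t(3) by blast
    have "(s \<otimes> t) \<otimes> (x \<oplus> y) = t \<otimes> (s \<otimes> x) \<oplus> s \<otimes> (t \<otimes> y)" using sc tc s(3) t(3) by algebra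
    hence "(s \<otimes> t) \<otimes> (x \<oplus> y) \<in> C" using s t C' by auto
    thus "x \<oplus> y \<in> local_ring P" unfolding local_ring_def using over_den[OF P s(1) t(1)] s(3) t(3) by blast
  qed
  show "valuation_ring R (local_ring P)"
  proof (intro valuation_ring.intro valuation_ring_axioms.intro)
    show "field R" by (rule field_axioms)
    show "subring (local_ring P) R" by (rule sub)
  next
    fix x assume x: "x \<in> carrier R" "x \<noteq> \<zero>"
    obtain f where f: "set f \<subseteq> A" "\<not> set f \<subseteq> \<pp>" "eval f x = \<zero>" using primitive_relation[OF x(1)] by blast
    have "\<not> set f \<subseteq> P" using f(1,2) Q(9) by blast
    then obtain c s where cs: "c \<in> C" "s \<in> C - P" "s \<otimes> x = c \<or> c \<otimes> x = s"
      using valuation_ring_of_prime[OF A noeth x(1) C _ f(1) _ f(3)] P unfolding lies_over_def by blast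
    show "x \<in> local_ring P \<or> inv x \<in> local_ring P"
    proof (cases "s \<otimes> x = c")
      case True thus ?thesis unfolding local_ring_def using x cs by auto
    next
      case False
      hence "c \<otimes> x = s" using cs by auto
      hence "s \<otimes> inv x = c" using x cs Cc by auto
      thus ?thesis unfolding local_ring_def using x cs by auto
    qed
  qed
qed

text \<open>
  The normalized valuation with valuation ring \<open>local_ring P\<close>. It is determined by \<open>P\<close> on nonzero elements; as the value
  of zero is arbitrary, a predicate is used instead of a function of \<open>P\<close>.
\<close>

definition valuation_at :: "('a \<Rightarrow> int) \<Rightarrow> 'a set \<Rightarrow> bool" where
  "valuation_at v P \<longleftrightarrow> valued_field R v \<and> (\<exists>t\<in>carrier R. t \<noteq> \<zero> \<and> v t = 1) \<and>
     (\<forall>y\<in>carrier R. y \<noteq> \<zero> \<longrightarrow> (0 \<le> v y \<longleftrightarrow> y \<in> local_ring P))"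

text \<open>
  Up to units of the local ring, elements of the fraction field of \<open>A\<close> are powers of \<open>\<pi>\<close>, and every
  element of \<open>R\<close> has a power with exponent at most \<open>n\<close> of that kind. The common multiple \<open>n!\<close> of
  these exponents serves for all elements.
\<close>

lemma exists_valuation_at:
  assumes P: "lies_over P"
  shows "\<exists>v. valuation_at v P"
proof -
  note L = local_ring_valuation_ring[OF P]
  note Q = over_prime[OF P]
  interpret V: valuation_ring R "local_ring P" by (rule L(1))
  let ?K = "fraction_field R A"
  have K: "subfield ?K R" by (rule fraction_field_subfield[OF A])
  have su: "V.unit s" if "s \<in> A - \<pp>" for s
  proof -
    have "s \<in> C - P" using that A_sub_C Q(9) by auto
    thus ?thesis unfolding V.unit_def using L(2,3) Q(3) by auto
  qed
  have \<pi>p: "\<pi> [^] m \<in> carrier R" for m :: nat using \<pi>_mem by simp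
  have Kx: "\<exists>i j u. V.unit u \<and> a \<otimes> \<pi> [^] (i::nat) = \<pi> [^] (j::nat) \<otimes> u" if a: "a \<in> ?K" "a \<noteq> \<zero>" for a
  proof -
    obtain c d where cd: "a = c \<otimes> inv d" "c \<in> A" "d \<in> A" "d \<noteq> \<zero>" using a unfolding fraction_field_def by blast
    have cdc: "c \<in> carrier R" "d \<in> carrier R" using cd Ac by auto
    have "c \<noteq> \<zero>" using a cd cdc by auto
    obtain m s u where u: "s \<in> A - \<pp>" "u \<in> A - \<pp>" "s \<otimes> c = \<pi> [^] (m::nat) \<otimes> u" using uniformizer[OF cd(2) \<open>c \<noteq> \<zero>\<close>] by blast
    obtain k t w where w: "t \<in> A - \<pp>" "w \<in> A - \<pp>" "t \<otimes> d = \<pi> [^] (k::nat) \<otimes> w" using uniformizer[OF cd(3,4)] by blast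
    have un: "V.unit s" "V.unit u" "V.unit t" "V.unit w" using u w su by auto
    have c: "s \<in> carrier R" "u \<in> carrier R" "t \<in> carrier R" "w \<in> carrier R" using un V.unit_carr by auto
    have nz: "s \<noteq> \<zero>" "w \<noteq> \<zero>" using un unfolding V.unit_def by auto
    define U where "U = (t \<otimes> u) \<otimes> inv (s \<otimes> w)"
    have sw: "s \<otimes> w \<in> carrier R" "s \<otimes> w \<noteq> \<zero>" using c nz by auto
    have U: "V.unit U" unfolding U_def using un V.unit_mult V.unit_inv by auto
    have ac: "a \<in> carrier R" "a \<otimes> d = c" using cd cdc by auto
    have "(a \<otimes> \<pi> [^] k) \<otimes> (s \<otimes> w) = (s \<otimes> a) \<otimes> (\<pi> [^] k \<otimes> w)" using ac c \<pi>p[of k] by (simp add: m_ac)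
    also have "\<dots> = (s \<otimes> a) \<otimes> (t \<otimes> d)" unfolding w(3) ..
    also have "\<dots> = t \<otimes> (s \<otimes> (a \<otimes> d))" using ac(1) c cdc by (simp add: m_ac)
    also have "\<dots> = t \<otimes> (\<pi> [^] m \<otimes> u)" unfolding ac(2) u(3) ..
    also have "\<dots> = (\<pi> [^] m \<otimes> (t \<otimes> u)) " using c \<pi>p[of m] by (simp add: m_ac)
    also have "\<dots> = (\<pi> [^] m \<otimes> U) \<otimes> (s \<otimes> w)" unfolding U_def using c \<pi>p[of m] sw by (simp add: m_assoc)
    finally have "a \<otimes> \<pi> [^] k = \<pi> [^] m \<otimes> U"
      using m_rcancel[OF sw(2) sw(1), of "a \<otimes> \<pi> [^] k" "\<pi> [^] m \<otimes> U"] ac(1) \<pi>p[of m] \<pi>p[of k] V.unit_carr[OF U] by simp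
    thus ?thesis using U by blast
  qed
  have fin: "\<exists>a b. \<exists>u. V.unit u \<and> x [^] (fact n :: nat) \<otimes> \<pi> [^] (a::nat) = \<pi> [^] (b::nat) \<otimes> u"
    if x: "x \<in> carrier R" "x \<noteq> \<zero>" for x
  proof -
    obtain f where f: "length f = Suc n" "set f \<subseteq> A" "\<not> set f \<subseteq> \<pp>" "eval f x = \<zero>" using primitive_relation[OF x(1)] by blast
    have "set f \<subseteq> ?K" "\<not> set f \<subseteq> {\<zero>}" using f fraction_field_incl[OF A] p(2) by auto
    then obtain k a u where k: "1 \<le> k" "k < length f" "a \<in> ?K" "a \<noteq> \<zero>" "V.unit u" "x [^] k = a \<otimes> u"
      using V.power_of_coefficient_times_unit[OF K x _ _ f(4)] by blast
    obtain i j w where w: "V.unit w" "a \<otimes> \<pi> [^] (i::nat) = \<pi> [^] (j::nat) \<otimes> w" using Kx[OF k(3,4)] by blast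
    have c: "a \<in> carrier R" "u \<in> carrier R" "w \<in> carrier R" using k subfieldE(3)[OF K] V.unit_carr w by auto
    have 1: "x [^] k \<otimes> \<pi> [^] i = \<pi> [^] j \<otimes> (w \<otimes> u)"
    proof -
      have "x [^] k \<otimes> \<pi> [^] i = (a \<otimes> \<pi> [^] i) \<otimes> u" unfolding k(6) using c \<pi>p[of i] by (simp add: m_ac)
      also have "\<dots> = \<pi> [^] j \<otimes> (w \<otimes> u)" unfolding w(2) using c \<pi>p[of j] by (simp add: m_ac)
      finally show ?thesis .
    qed
    have "k dvd fact n" using k f(1) by (intro dvd_fact) auto
    then obtain l where l: "fact n = k * l" by (auto elim: dvdE)
    have "x [^] (fact n :: nat) \<otimes> \<pi> [^] (i * l) = (x [^] k \<otimes> \<pi> [^] i) [^] l"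
      unfolding l using x(1) \<pi>_mem(3) by (simp add: nat_pow_distrib nat_pow_pow)
    also have "\<dots> = \<pi> [^] (j * l) \<otimes> (w \<otimes> u) [^] l"
      unfolding 1 using c \<pi>_mem(3) by (simp add: nat_pow_distrib nat_pow_pow)
    finally have e: "x [^] (fact n :: nat) \<otimes> \<pi> [^] (i * l) = \<pi> [^] (j * l) \<otimes> (w \<otimes> u) [^] l" .
    have "V.unit ((w \<otimes> u) [^] m)" for m :: nat
      using V.unit_one V.unit_mult[OF _ V.unit_mult[OF w(1) k(5)]] by (induct m) auto
    thus ?thesis using e by blast
  qed
  have pL: "\<pi> \<in> local_ring P" "inv \<pi> \<notin> local_ring P" using L(2) L(4)[of \<pi>] \<pi> Q(8) \<pi>_mem(2) by auto
  obtain v t where "valued_field R v" "t \<in> carrier R" "t \<noteq> \<zero>" "v t = 1"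
    "\<forall>y\<in>carrier R. y \<noteq> \<zero> \<longrightarrow> (0 \<le> v y \<longleftrightarrow> y \<in> local_ring P)"
    using V.discrete_valuation[OF pL(1) \<pi>(2) pL(2) fact_gt_zero fin] by blast
  thus ?thesis unfolding valuation_at_def by blast
qed

lemma valuation_at_values:
  assumes P: "lies_over P" and v: "valuation_at v P" and c: "c \<in> C" "c \<noteq> \<zero>"
  shows "0 \<le> v c" "c \<in> P \<longleftrightarrow> 1 \<le> v c" "c \<notin> P \<longleftrightarrow> v c = 0"
proof -
  interpret W: valued_field R v using v unfolding valuation_at_def by simp
  note L = local_ring_valuation_ring[OF P]
  have V: "0 \<le> v y \<longleftrightarrow> y \<in> local_ring P" if "y \<in> carrier R" "y \<noteq> \<zero>" for y using v that unfolding valuation_at_def by blast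
  have cc: "c \<in> carrier R" using c Cc by auto
  show 1: "0 \<le> v c" using V[OF cc c(2)] L(2) c by auto
  have vi: "v (inv c) = - v c" "inv c \<in> carrier R" "inv c \<noteq> \<zero>" using cc c by auto
  have "c \<in> P \<Longrightarrow> v c > 0" using L(4)[of c] V[OF vi(2,3)] vi(1) c by auto
  moreover have "c \<notin> P \<Longrightarrow> v c = 0" using L(3)[of c] V[OF vi(2,3)] vi(1) c 1 by auto
  ultimately show "c \<in> P \<longleftrightarrow> 1 \<le> v c" "c \<notin> P \<longleftrightarrow> v c = 0" by fastforce+
qed

end

section \<open>Powers of primes and their intersections\<close>

context dedekind_extension begin

lemma prime_avoidance:
  assumes P: "lies_over P" and T: "finite T" "\<And>Q. Q \<in> T \<Longrightarrow> lies_over Q" "P \<notin> T"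
  shows "\<exists>x\<in>C - P. \<forall>Q\<in>T. x \<in> Q"
  using T
proof (induct T)
  case empty thus ?case using over_prime(6)[OF P] C' by auto
next
  case (insert Q T)
  then obtain x where x: "x \<in> C - P" "\<forall>Q\<in>T. x \<in> Q" by auto
  have Q: "lies_over Q" using insert by auto
  have "\<not> Q \<subseteq> P" using over_antichain[OF P Q] insert by auto
  then obtain y where y: "y \<in> Q" "y \<notin> P" by auto
  have yC: "y \<in> C - P" using y over_prime(2)[OF Q] by auto
  have "x \<otimes> y \<in> C - P" using over_den[OF P x(1) yC] .
  moreover have "x \<otimes> y \<in> Q'" if "Q' \<in> T" for Q'
  proof -
    have Q': "lies_over Q'" "x \<in> Q'" using insert that x by auto
    have "y \<otimes> x \<in> Q'" using over_prime(5)[OF Q'(1)] Q'(2) yC by auto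
    thus ?thesis using m_comm[of x y] x yC Cc by auto
  qed
  moreover have "x \<otimes> y \<in> Q" using over_prime(5)[OF Q] x y by auto
  ultimately show ?case by auto
qed

lemma combine_all_but_one:
  assumes P: "lies_over P" and "length as = length us" "set as \<subseteq> C" "set us \<subseteq> C"
    and "i < length us" "\<And>j. j < length us \<Longrightarrow> j \<noteq> i \<Longrightarrow> us ! j \<in> P"
  shows "combine as us \<ominus> as ! i \<otimes> us ! i \<in> P"
  using assms(2-6)
proof (induct as us arbitrary: i rule: list_induct2)
  case (Cons a as u us)
  note Q = over_prime[OF P]
  have allP: "combine bs ws \<in> P" if "length bs = length ws" "set bs \<subseteq> C" "set ws \<subseteq> P" for bs ws
    using that Q by (induct bs ws rule: list_induct2) auto
  have c: "a \<in> carrier R" "u \<in> carrier R" "set as \<subseteq> carrier R" "set us \<subseteq> carrier R" using Cons Cc by auto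
  have cc: "combine as us \<in> carrier R" using c by auto
  show ?case
  proof (cases i)
    case 0
    have "set us \<subseteq> P"
    proof
      fix x assume "x \<in> set us"
      then obtain j where "j < length us" "x = us ! j" by (auto simp: in_set_conv_nth)
      thus "x \<in> P" using Cons(6)[of "Suc j"] 0 by auto
    qed
    hence "combine as us \<in> P" using allP Cons by auto
    moreover have "a \<otimes> u \<oplus> combine as us \<ominus> a \<otimes> u = combine as us" using c cc by algebra
    ultimately show ?thesis using 0 by simp
  next
    case (Suc k)
    have "combine as us \<ominus> as ! k \<otimes> us ! k \<in> P"
    proof (rule Cons(2))
      fix j assume "j < length us" "j \<noteq> k" thus "us ! j \<in> P" using Cons(6)[of "Suc j"] Suc by auto
    qed (use Cons Suc in auto)
    moreover have "a \<otimes> u \<in> P" using Cons(6)[of 0] Cons(3) Q(5) Suc by auto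
    moreover have "as ! k \<in> carrier R" "us ! k \<in> carrier R" using Cons(1,5) Suc c by (auto simp: subset_iff)
    hence "a \<otimes> u \<oplus> combine as us \<ominus> as ! k \<otimes> us ! k = a \<otimes> u \<oplus> (combine as us \<ominus> as ! k \<otimes> us ! k)"
      using c cc by algebra
    ultimately show ?thesis using Suc Q(4) by simp
  qed
qed simp

text \<open>
  For \<open>n + 1\<close> primes, choose elements \<open>f P\<close> that lie in all of these primes except \<open>P\<close>. In a linear relation between
  them, all terms but the one belonging to \<open>P\<close> lie in \<open>P\<close>, so its coefficient is in \<open>P \<inter> A = \<pp>\<close>; but a
  relation with a coefficient outside \<open>\<pp>\<close> exists.
\<close>

lemma finite_over: "finite {P. lies_over P}"
proof (rule ccontr)
  assume "infinite {P. lies_over P}"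
  then obtain T where T: "T \<subseteq> {P. lies_over P}" "finite T" "card T = Suc n" using infinite_arbitrarily_large by blast
  obtain Ps where Ps: "set Ps = T" "distinct Ps" using finite_distinct_list[OF T(2)] by blast
  have len: "length Ps = Suc n" using Ps T distinct_card by metis
  have "\<exists>x\<in>C - P. \<forall>Q\<in>T - {P}. x \<in> Q" if "P \<in> T" for P
    using prime_avoidance[of P "T - {P}"] that T by auto
  then obtain f where f: "\<And>P. P \<in> T \<Longrightarrow> f P \<in> C - P" "\<And>P Q. P \<in> T \<Longrightarrow> Q \<in> T \<Longrightarrow> Q \<noteq> P \<Longrightarrow> f P \<in> Q" by (metis Diff_iff singletonD)
  let ?us = "map f Ps"
  have us: "set ?us \<subseteq> C" using f(1) Ps by auto
  hence "set ?us \<subseteq> carrier R" using Cc by auto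
  then obtain as where as: "length as = length ?us" "set as \<subseteq> A" "\<not> set as \<subseteq> \<pp>" "combine as ?us = \<zero>"
    using primitive_dependence[of ?us] len by auto
  obtain x where "x \<in> set as" "x \<notin> \<pp>" using as(3) by blast
  then obtain i where i: "i < length as" "as ! i \<notin> \<pp>" by (auto simp: in_set_conv_nth)
  define P where "P = Ps ! i"
  have iP: "P \<in> T" "i < length Ps" unfolding P_def using i as Ps by auto
  have P: "lies_over P" using iP T by auto
  note Q = over_prime[OF P]
  have "combine as ?us \<ominus> as ! i \<otimes> ?us ! i \<in> P"
  proof (rule combine_all_but_one[OF P as(1)])
    show "set as \<subseteq> C" using as A_sub_C by auto
    fix j assume "j < length ?us" "j \<noteq> i"
    hence "Ps ! j \<noteq> P" "Ps ! j \<in> T" "j < length Ps" using Ps iP unfolding P_def by (auto simp: nth_eq_iff_index_eq)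
    thus "?us ! j \<in> P" using f(2) iP by auto
  qed (use us iP in auto)
  moreover have m: "as ! i \<in> A" "f P \<in> C - P" using as(2) nth_mem[OF i(1)] f(1)[OF iP(1)] by blast+
  ultimately have "\<zero> \<ominus> as ! i \<otimes> f P \<in> P" using as(4) iP unfolding P_def by simp
  hence "\<ominus> \<one> \<otimes> (\<zero> \<ominus> as ! i \<otimes> f P) \<in> P" using Q(5) C' by auto
  moreover have "\<ominus> \<one> \<otimes> (\<zero> \<ominus> as ! i \<otimes> f P) = as ! i \<otimes> f P"
    using m Ac Cc by (simp add: a_minus_def l_minus r_minus)
  ultimately have "as ! i \<otimes> f P \<in> P" by simp
  hence "as ! i \<in> P" using Q(7)[of "as ! i" "f P"] m A_sub_C by auto
  thus False using Q(9) m i by auto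
qed

abbreviation "S \<equiv> R\<lparr>carrier := C\<rparr>"
abbreviation "IS \<equiv> ideals_set (R\<lparr>carrier := C\<rparr>)"

lemma S_cring: "cring S" by (rule subring_cring[OF C(1)])
lemma S_ring: "ring S" using S_cring by (simp add: cring_def)
lemma IS_monoid: "comm_monoid IS" by (rule cring.ideals_set_is_comm_monoid[OF S_cring])

lemma IS_simps [simp]: "carrier IS = {I. ideal I S}" "mult IS = ideal_prod S" "one IS = C"
  unfolding ideals_set_def by auto

lemma ideal_S_iff: "ideal I S \<longleftrightarrow> I \<subseteq> C \<and> \<zero> \<in> I \<and> (\<forall>x\<in>I. \<forall>y\<in>I. x \<oplus> y \<in> I) \<and> (\<forall>a\<in>C. \<forall>x\<in>I. a \<otimes> x \<in> I)"
  by (rule ideal_subring_iff[OF C(1)])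

lemma ideal_power_ideal: "ideal P S \<Longrightarrow> ideal (P [^]\<^bsub>IS\<^esub> (k::nat)) S"
  using monoid.nat_pow_closed[OF comm_monoid.axioms(1)[OF IS_monoid], of P k] by simp

lemma ideal_power_simps [simp]: "P [^]\<^bsub>IS\<^esub> (0::nat) = C" "P [^]\<^bsub>IS\<^esub> Suc k = ideal_prod S (P [^]\<^bsub>IS\<^esub> k) P"
  using monoid.nat_pow_0[OF comm_monoid.axioms(1)[OF IS_monoid], of P]
    monoid.nat_pow_Suc[OF comm_monoid.axioms(1)[OF IS_monoid], of P k] by auto

lemma ideal_prodI: "i \<in> I \<Longrightarrow> j \<in> J \<Longrightarrow> i \<otimes> j \<in> ideal_prod S I J"
  using ideal_prod.prod[of i I j J S] by simp

lemma ideal_prod_subsetI: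
  assumes "\<And>i j. i \<in> I \<Longrightarrow> j \<in> J \<Longrightarrow> i \<otimes> j \<in> W" "\<And>x y. x \<in> W \<Longrightarrow> y \<in> W \<Longrightarrow> x \<oplus> y \<in> W"
  shows "ideal_prod S I J \<subseteq> W"
proof
  fix x assume "x \<in> ideal_prod S I J"
  thus "x \<in> W" by (induct rule: ideal_prod.induct) (use assms in auto)
qed

lemma element_power_in: "a \<in> P \<Longrightarrow> P \<subseteq> C \<Longrightarrow> a [^] (k::nat) \<in> P [^]\<^bsub>IS\<^esub> k"
  by (induct k) (use C' ideal_prodI in auto)

lemma comaximal_element:
  assumes P: "lies_over P" and s: "s \<in> C - P"
  shows "\<exists>d\<in>C. \<one> \<ominus> s \<otimes> d \<in> P [^]\<^bsub>IS\<^esub> (k::nat)"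
proof -
  note Q = over_prime[OF P]
  obtain d where d: "d \<in> C" "s \<otimes> d \<ominus> \<one> \<in> P" using over_maximal[OF P s] by blast
  have c: "s \<in> carrier R" "d \<in> carrier R" "s \<in> C" using s d Cc by auto
  have "\<ominus> \<one> \<otimes> (s \<otimes> d \<ominus> \<one>) \<in> P" using Q(5) d C' by auto
  moreover have "\<ominus> \<one> \<otimes> (s \<otimes> d \<ominus> \<one>) = \<one> \<ominus> s \<otimes> d" using c by algebra
  ultimately have w: "\<one> \<ominus> s \<otimes> d \<in> P" by simp
  have wc: "\<one> \<ominus> s \<otimes> d \<in> carrier R" using c by auto
  have "\<exists>b\<in>C. (\<one> \<ominus> s \<otimes> d) [^] k = \<one> \<ominus> s \<otimes> b"
  proof (induct k)
    case 0
    have "(\<one> \<ominus> s \<otimes> d) [^] (0::nat) = \<one> \<ominus> s \<otimes> \<zero>" using c by (simp add: a_minus_def)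
    thus ?case using C' by blast
  next
    case (Suc k)
    then obtain b where b: "b \<in> C" "(\<one> \<ominus> s \<otimes> d) [^] k = \<one> \<ominus> s \<otimes> b" by auto
    have bc: "b \<in> carrier R" using b Cc by auto
    have "(\<one> \<ominus> s \<otimes> d) [^] Suc k = (\<one> \<ominus> s \<otimes> b) \<otimes> (\<one> \<ominus> s \<otimes> d)" using b by simp
    also have "\<dots> = \<one> \<ominus> s \<otimes> (b \<oplus> d \<ominus> s \<otimes> b \<otimes> d)" using c bc by algebra
    finally show ?case using b d c C' by (intro bexI[of _ "b \<oplus> d \<ominus> s \<otimes> b \<otimes> d"]) (auto simp: a_minus_def)
  qed
  thus ?thesis using element_power_in[OF w Q(2), of k] by auto
qed

text \<open>
  As \<open>P\<close> is maximal, \<open>s\<close> is invertible modulo every power of \<open>P\<close>; powers of \<open>P\<close> are primary.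
\<close>

lemma power_absorb:
  assumes P: "lies_over P" and s: "s \<in> C - P" and x: "x \<in> C" "s \<otimes> x \<in> P [^]\<^bsub>IS\<^esub> (k::nat)"
  shows "x \<in> P [^]\<^bsub>IS\<^esub> k"
proof -
  have I: "P [^]\<^bsub>IS\<^esub> k \<subseteq> C" "\<And>x y. x \<in> P [^]\<^bsub>IS\<^esub> k \<Longrightarrow> y \<in> P [^]\<^bsub>IS\<^esub> k \<Longrightarrow> x \<oplus> y \<in> P [^]\<^bsub>IS\<^esub> k"
    "\<And>a x. a \<in> C \<Longrightarrow> x \<in> P [^]\<^bsub>IS\<^esub> k \<Longrightarrow> a \<otimes> x \<in> P [^]\<^bsub>IS\<^esub> k"
    using ideal_power_ideal[OF over_prime(1)[OF P], of k] unfolding ideal_S_iff by auto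
  obtain d where d: "d \<in> C" "\<one> \<ominus> s \<otimes> d \<in> P [^]\<^bsub>IS\<^esub> k" using comaximal_element[OF P s] by blast
  have c: "s \<in> carrier R" "d \<in> carrier R" "x \<in> carrier R" using s d x Cc by auto
  have "x = x \<otimes> (\<one> \<ominus> s \<otimes> d) \<oplus> d \<otimes> (s \<otimes> x)" using c by algebra
  moreover have "\<dots> \<in> P [^]\<^bsub>IS\<^esub> k" using I d x by blast
  ultimately show ?thesis by simp
qed

text \<open>
  Elements of value at least \<open>k\<close> are divided by an element \<open>t\<close> of value one, \<open>k\<close> times. The denominators
  that arise lie outside \<open>P\<close> and are removed with \<open>power_absorb\<close>.
\<close>

lemma power_eq:
  assumes P: "lies_over P" and v: "valuation_at v P"
  shows "P [^]\<^bsub>IS\<^esub> (k::nat) = {x \<in> C. x = \<zero> \<or> int k \<le> v x}"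
proof
  interpret W: valued_field R v using v unfolding valuation_at_def by simp
  note Q = over_prime[OF P]
  note vals = valuation_at_values[OF P v]
  have BW: "x \<in> W.B m \<longleftrightarrow> x = \<zero> \<or> m \<le> v x" if "x \<in> C" for x m using that Cc unfolding W.B_def by auto
  have PC: "P [^]\<^bsub>IS\<^esub> k \<subseteq> C" for k :: nat using ideal_power_ideal[OF Q(1), of k] unfolding ideal_S_iff by auto
  have "P [^]\<^bsub>IS\<^esub> k \<subseteq> W.B (int k)"
  proof (induct k)
    case 0
    show ?case using BW vals(1) by auto
  next
    case (Suc k)
    have "ideal_prod S (P [^]\<^bsub>IS\<^esub> k) P \<subseteq> W.B (int k + 1)"
    proof (rule ideal_prod_subsetI)
      fix i j assume i: "i \<in> P [^]\<^bsub>IS\<^esub> k" and j: "j \<in> P"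
      have "j \<in> C" using j Q(2) by auto
      hence "j \<in> W.B 1" using BW[of j 1] vals(2)[of j] j by auto
      thus "i \<otimes> j \<in> W.B (int k + 1)" using W.B_mult[of i "int k" j 1] Suc i by auto
    qed auto
    thus ?case by (simp add: add.commute)
  qed
  thus "P [^]\<^bsub>IS\<^esub> k \<subseteq> {x \<in> C. x = \<zero> \<or> int k \<le> v x}" using BW[of _ "int k"] PC[of k] by blast
  have "x \<in> P [^]\<^bsub>IS\<^esub> k" if "x \<in> C" "x = \<zero> \<or> int k \<le> v x" for x
    using that
  proof (induct k arbitrary: x)
    case (Suc k)
    show ?case
    proof (cases "x = \<zero>")
      case True thus ?thesis using ideal_power_ideal[OF Q(1), of "Suc k"] unfolding ideal_S_iff by blast
    next
      case False
      have xc: "x \<in> carrier R" using Suc Cc by auto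
      obtain t where t: "t \<in> carrier R" "t \<noteq> \<zero>" "v t = 1" using v unfolding valuation_at_def by auto
      have V: "\<exists>s\<in>C - P. s \<otimes> y \<in> C" if "y \<in> carrier R" "y \<noteq> \<zero>" "0 \<le> v y" for y
        using v that unfolding valuation_at_def local_ring_def by blast
      obtain s where s: "s \<in> C - P" "s \<otimes> t \<in> C" using V[OF t(1,2)] t by auto
      have sc: "s \<in> carrier R" "s \<noteq> \<zero>" using s Cc Q(3) by auto
      have vs: "v s = 0" using vals(3)[of s] s sc by auto
      have st: "s \<otimes> t \<in> P" using vals(2)[OF s(2)] sc t vs W.v_mult by auto
      define y where "y = x \<otimes> inv t"
      have y: "y \<in> carrier R" "y \<noteq> \<zero>" "v y = v x - 1" "y \<otimes> t = x" unfolding y_def using xc False t by (auto simp: W.v_mult)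
      have vy: "int k \<le> v y" using Suc(3) False y by simp
      obtain r where r: "r \<in> C - P" "r \<otimes> y \<in> C" using V[OF y(1,2)] vy by auto
      have rc: "r \<in> carrier R" "r \<noteq> \<zero>" using r Cc Q(3) by auto
      have "v r = 0" using vals(3)[of r] r rc by auto
      hence "int k \<le> v (r \<otimes> y)" using vy W.v_mult rc y by auto
      hence "r \<otimes> y \<in> P [^]\<^bsub>IS\<^esub> k" using Suc(1)[OF r(2)] by auto
      hence "(r \<otimes> y) \<otimes> (s \<otimes> t) \<in> P [^]\<^bsub>IS\<^esub> Suc k" using ideal_prodI st by auto
      moreover have "(r \<otimes> y) \<otimes> (s \<otimes> t) = (r \<otimes> s) \<otimes> x" unfolding y(4)[symmetric] using rc(1) sc(1) y(1) t(1) by (simp add: m_ac)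
      ultimately show ?thesis using power_absorb[OF P over_den[OF P r(1) s(1)] Suc(2), of "Suc k"] by simp
    qed
  qed simp
  thus "{x \<in> C. x = \<zero> \<or> int k \<le> v x} \<subseteq> P [^]\<^bsub>IS\<^esub> k" by auto
qed

lemma valuation_\<pi>:
  assumes P: "lies_over P" and v: "valuation_at v P"
  shows "1 \<le> v \<pi>" "x \<in> \<pp> \<Longrightarrow> x \<noteq> \<zero> \<Longrightarrow> v \<pi> \<le> v x"
proof -
  interpret W: valued_field R v using v unfolding valuation_at_def by simp
  note Q = over_prime[OF P]
  note vals = valuation_at_values[OF P v]
  show 1: "1 \<le> v \<pi>" using vals(2)[OF \<pi>_mem(2) \<pi>(2)] \<pi> Q(8) by auto
  assume x: "x \<in> \<pp>" "x \<noteq> \<zero>"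
  have xA: "x \<in> A" "x \<in> carrier R" using x p(1) Ac by auto
  obtain m s u where u: "s \<in> A - \<pp>" "u \<in> A - \<pp>" "s \<otimes> x = \<pi> [^] (m::nat) \<otimes> u" using uniformizer[OF xA(1) x(2)] by blast
  have un: "v y = 0 \<and> y \<in> carrier R \<and> y \<noteq> \<zero>" if "y \<in> A - \<pp>" for y
  proof -
    have "y \<in> C" "y \<notin> P" "y \<noteq> \<zero>" using that A_sub_C Q(9) p(2) by auto
    thus ?thesis using vals(3)[of y] Cc by auto
  qed
  have "m \<noteq> 0"
  proof
    assume "m = 0"
    hence "s \<otimes> x = u" using u un[OF u(2)] by simp
    thus False using p(4)[of s x] u x by auto
  qed
  have "v x = int m * v \<pi>" using un[OF u(1)] un[OF u(2)] W.v_mult[of s x] W.v_mult[of "\<pi> [^] m" u] u(3) x(2) xA(2) \<pi>_mem(3) \<pi>(2) by simp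
  also have "\<dots> \<ge> 1 * v \<pi>" using 1 \<open>m \<noteq> 0\<close> by (intro mult_right_mono) auto
  finally show "v \<pi> \<le> v x" by simp
qed

text \<open>
  If the ideal of denominators of \<open>y\<close> did not meet \<open>A - \<pp>\<close>, it would be contained in an ideal maximal with this
  property, which is a prime over \<open>\<pp>\<close>: its intersection with \<open>A\<close> is contained in \<open>\<pp>\<close>, and nonzero
  as it contains \<open>c\<close>. This contradicts integrality of \<open>y\<close> there.
\<close>

lemma semilocal_denominator:
  assumes y: "y \<in> carrier R" and c: "c \<in> A" "c \<noteq> \<zero>" "c \<otimes> y \<in> C"
    and loc: "\<And>P. lies_over P \<Longrightarrow> y \<in> local_ring P"
  shows "\<exists>s\<in>A - \<pp>. s \<otimes> y \<in> C"
proof (rule ccontr)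
  assume neg: "\<not> ?thesis"
  define T where "T = {s \<in> C. s \<otimes> y \<in> C}"
  have T: "ideal T S" unfolding ideal_S_iff T_def using C' y Cc by (auto simp: l_distr m_assoc)
  define F where "F = {I. ideal I S \<and> T \<subseteq> I \<and> I \<inter> (A - \<pp>) = {}}"
  have TF: "T \<in> F" unfolding F_def T_def using T[unfolded T_def] neg by auto
  have "\<exists>M\<in>F. \<forall>I\<in>F. M \<subseteq> I \<longrightarrow> I = M"
  proof (rule subset_Zorn_nonempty)
    fix \<C> assume ch: "\<C> \<noteq> {}" "subset.chain F \<C>"
    have "subset.chain {I. ideal I S} \<C>" using ch(2) unfolding subset_chain_def F_def by auto
    hence "ideal (\<Union>\<C>) S" using ring.chain_Union_is_ideal[OF S_ring, of \<C>] ch(1) by simp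
    thus "\<Union>\<C> \<in> F" using ch unfolding F_def subset_chain_def by blast
  qed (use TF in auto)
  then obtain M where M: "M \<in> F" "\<And>I. I \<in> F \<Longrightarrow> M \<subseteq> I \<Longrightarrow> I = M" by blast
  have Mi: "ideal M S" "T \<subseteq> M" "M \<inter> (A - \<pp>) = {}" using M unfolding F_def by auto
  have M': "M \<subseteq> C" "\<zero> \<in> M" "\<And>x y. x \<in> M \<Longrightarrow> y \<in> M \<Longrightarrow> x \<oplus> y \<in> M" "\<And>a x. a \<in> C \<Longrightarrow> x \<in> M \<Longrightarrow> a \<otimes> x \<in> M"
    using Mi(1) unfolding ideal_S_iff by auto
  have ext: "\<exists>s\<in>A - \<pp>. \<exists>m\<in>M. \<exists>d\<in>C. s = m \<oplus> d \<otimes> a" if a: "a \<in> C" "a \<notin> M" for a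
  proof -
    define I where "I = {m \<oplus> d \<otimes> a | m d. m \<in> M \<and> d \<in> C}"
    have ac: "a \<in> carrier R" using a Cc by auto
    have "ideal I S" unfolding ideal_S_iff
    proof (intro conjI ballI)
      show "I \<subseteq> C" unfolding I_def using M' C' a by auto
      have "\<zero> = \<zero> \<oplus> \<zero> \<otimes> a" using ac by simp
      thus "\<zero> \<in> I" unfolding I_def using M'(2) C'(2) by blast
      fix x z assume "x \<in> I"
      then obtain m d where x: "x = m \<oplus> d \<otimes> a" "m \<in> M" "d \<in> C" unfolding I_def by auto
      have xc: "m \<in> carrier R" "d \<in> carrier R" using x M'(1) Cc by auto
      { assume "z \<in> I"
        then obtain k e where z: "z = k \<oplus> e \<otimes> a" "k \<in> M" "e \<in> C" unfolding I_def by auto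
        have zc: "k \<in> carrier R" "e \<in> carrier R" using z M'(1) Cc by auto
        have "x \<oplus> z = (m \<oplus> k) \<oplus> (d \<oplus> e) \<otimes> a" unfolding x z using xc zc ac by algebra
        thus "x \<oplus> z \<in> I" unfolding I_def using x z M'(3) C'(7) by blast }
      { assume z: "z \<in> C"
        have zc: "z \<in> carrier R" using z Cc by auto
        have "z \<otimes> x = z \<otimes> m \<oplus> (z \<otimes> d) \<otimes> a" unfolding x using xc zc ac by algebra
        thus "z \<otimes> x \<in> I" unfolding I_def using x z M'(4) C'(6) by blast }
    qed
    moreover have MI: "M \<subseteq> I"
    proof
      fix m assume m: "m \<in> M"
      hence "m = m \<oplus> \<zero> \<otimes> a" using ac M'(1) Cc by auto
      thus "m \<in> I" unfolding I_def using m C'(2) by blast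
    qed
    moreover have "a \<in> I"
    proof -
      have "a = \<zero> \<oplus> \<one> \<otimes> a" using ac by simp
      thus ?thesis unfolding I_def using M'(2) C'(3) by blast
    qed
    ultimately have "I \<notin> F" using M(2)[of I] a by auto
    hence "I \<inter> (A - \<pp>) \<noteq> {}" using \<open>ideal I S\<close> MI Mi(2) unfolding F_def by blast
    thus ?thesis unfolding I_def by auto
  qed
  have Mp: "primeideal M S" unfolding primeideal_subring_iff[OF C(1)]
  proof (intro conjI ballI impI Mi(1))
    show "\<one> \<notin> M" using Mi(3) den_one by auto
    fix a b assume ab: "a \<in> C" "b \<in> C" "a \<otimes> b \<in> M"
    show "a \<in> M \<or> b \<in> M"
    proof (rule ccontr)
      assume "\<not> ?thesis"
      then obtain s m d s' m' d' where s: "s \<in> A - \<pp>" "m \<in> M" "d \<in> C" "s = m \<oplus> d \<otimes> a"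
        "s' \<in> A - \<pp>" "m' \<in> M" "d' \<in> C" "s' = m' \<oplus> d' \<otimes> b" using ext ab by metis
      have c: "m \<in> carrier R" "d \<in> carrier R" "a \<in> carrier R" "m' \<in> carrier R" "d' \<in> carrier R" "b \<in> carrier R"
        using s ab M'(1) Cc by auto
      have "s \<otimes> s' = (m' \<oplus> d' \<otimes> b) \<otimes> m \<oplus> ((d \<otimes> a) \<otimes> m' \<oplus> (d \<otimes> d') \<otimes> (a \<otimes> b))"
        unfolding s(4) s(8) using c by algebra
      moreover have "m' \<oplus> d' \<otimes> b \<in> C" "d \<otimes> a \<in> C" "d \<otimes> d' \<in> C" using s ab M'(1) C' by auto
      ultimately have "s \<otimes> s' \<in> M" using M'(3,4) s(2,6) ab(3) by auto
      thus False using den_mult[OF s(1,5)] Mi(3) by auto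
    qed
  qed
  have M1: "\<one> \<notin> M" and Mm: "\<And>a b. a \<in> C \<Longrightarrow> b \<in> C \<Longrightarrow> a \<otimes> b \<in> M \<Longrightarrow> a \<in> M \<or> b \<in> M"
    using Mp unfolding primeideal_subring_iff[OF C(1)] by auto
  have AC: "a \<in> A \<Longrightarrow> a \<in> C" for a using A_sub_C by auto
  have "ideal (M \<inter> A) (R\<lparr>carrier := A\<rparr>)" unfolding ideal_subring_iff[OF A]
    using M'(2-4) A'(2,6,7) AC by (intro conjI ballI) auto
  hence "primeideal (M \<inter> A) (R\<lparr>carrier := A\<rparr>)"
    unfolding primeideal_subring_iff[OF A] using M1 Mm AC by (intro conjI ballI impI) auto
  moreover have "M \<inter> A \<subseteq> \<pp>" using Mi(3) by auto
  moreover have "c \<in> M \<inter> A" using c A_sub_C Mi(2) unfolding T_def by auto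
  ultimately have "M \<inter> A = \<pp>" using min c(2) by blast
  hence "lies_over M" unfolding lies_over_def using Mp by simp
  hence "y \<in> local_ring M" by (rule loc)
  then obtain s where "s \<in> C - M" "s \<otimes> y \<in> C" unfolding local_ring_def by auto
  thus False using Mi(2) unfolding T_def by auto
qed

lemma genideal_p: "ideal (Idl\<^bsub>S\<^esub> \<pp>) S" "\<pp> \<subseteq> Idl\<^bsub>S\<^esub> \<pp>" "ideal I S \<Longrightarrow> \<pp> \<subseteq> I \<Longrightarrow> Idl\<^bsub>S\<^esub> \<pp> \<subseteq> I"
proof -
  have s: "\<pp> \<subseteq> carrier S" using p(1) A_sub_C by auto
  show "ideal (Idl\<^bsub>S\<^esub> \<pp>) S" "\<pp> \<subseteq> Idl\<^bsub>S\<^esub> \<pp>" "ideal I S \<Longrightarrow> \<pp> \<subseteq> I \<Longrightarrow> Idl\<^bsub>S\<^esub> \<pp> \<subseteq> I"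
    using ring.genideal_ideal[OF S_ring s] ring.genideal_self[OF S_ring s] ring.genideal_minimal[OF S_ring] by auto
qed

lemma valuation_genideal:
  assumes P: "lies_over P" and v: "valuation_at v P" and x: "x \<in> Idl\<^bsub>S\<^esub> \<pp>" "x \<noteq> \<zero>"
  shows "v \<pi> \<le> v x"
proof -
  have "P [^]\<^bsub>IS\<^esub> (nat (v \<pi>)) = {x \<in> C. x = \<zero> \<or> v \<pi> \<le> v x}"
    using power_eq[OF P v, of "nat (v \<pi>)"] valuation_\<pi>(1)[OF P v] by simp
  moreover have "ideal (P [^]\<^bsub>IS\<^esub> (nat (v \<pi>))) S" by (rule ideal_power_ideal[OF over_prime(1)[OF P]])
  ultimately have "ideal {x \<in> C. x = \<zero> \<or> v \<pi> \<le> v x} S" by simp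
  moreover have "\<pp> \<subseteq> {x \<in> C. x = \<zero> \<or> v \<pi> \<le> v x}" using valuation_\<pi>(2)[OF P v] p(1) A_sub_C by blast
  ultimately have "Idl\<^bsub>S\<^esub> \<pp> \<subseteq> {x \<in> C. x = \<zero> \<or> v \<pi> \<le> v x}" by (rule genideal_p(3))
  thus ?thesis using x by blast
qed

text \<open>
  The quotient \<open>y = x / \<pi>\<close> is integral at all primes over \<open>\<pp>\<close>, so \<open>s \<otimes> y\<close> is in \<open>C\<close> for some
  \<open>s\<close> in \<open>A - \<pp>\<close>. Hence \<open>s \<otimes> x\<close> is in the ideal generated by \<open>\<pp>\<close>, and \<open>s\<close> is invertible
  modulo \<open>\<pp>\<close>.
\<close>

lemma genideal_eq_Inter:
  assumes v: "\<And>P. lies_over P \<Longrightarrow> valuation_at (v P) P" and x: "x \<in> C"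
    and "\<And>P. lies_over P \<Longrightarrow> x = \<zero> \<or> v P \<pi> \<le> v P x"
  shows "x \<in> Idl\<^bsub>S\<^esub> \<pp>"
proof (cases "x = \<zero>")
  case True thus ?thesis using genideal_p(1) unfolding ideal_S_iff by auto
next
  case False
  have I: "\<And>x y. x \<in> Idl\<^bsub>S\<^esub> \<pp> \<Longrightarrow> y \<in> Idl\<^bsub>S\<^esub> \<pp> \<Longrightarrow> x \<oplus> y \<in> Idl\<^bsub>S\<^esub> \<pp>" "\<And>a x. a \<in> C \<Longrightarrow> x \<in> Idl\<^bsub>S\<^esub> \<pp> \<Longrightarrow> a \<otimes> x \<in> Idl\<^bsub>S\<^esub> \<pp>"
    using genideal_p(1) unfolding ideal_S_iff by auto
  have xc: "x \<in> carrier R" using x Cc by auto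
  define y where "y = x \<otimes> inv \<pi>"
  have y: "y \<in> carrier R" "y \<noteq> \<zero>" "\<pi> \<otimes> y = x" unfolding y_def using xc False \<pi>_mem(3) \<pi>(2) by auto
  have "y \<in> local_ring P" if P: "lies_over P" for P
  proof -
    interpret W: valued_field R "v P" using v[OF P] unfolding valuation_at_def by simp
    have "v P y = v P x - v P \<pi>" unfolding y_def using xc False \<pi>_mem(3) \<pi>(2) by (simp add: W.v_mult)
    hence "0 \<le> v P y" using assms(3)[OF P] False by simp
    thus ?thesis using v[OF P] y unfolding valuation_at_def by blast
  qed
  then obtain s where s: "s \<in> A - \<pp>" "s \<otimes> y \<in> C" using semilocal_denominator[OF y(1) \<pi>_mem(1) \<pi>(2)] y(3) x by auto
  obtain b where b: "b \<in> A" "s \<otimes> b \<ominus> \<one> \<in> \<pp>" using inverse_modulo s by auto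
  have c: "s \<in> carrier R" "b \<in> carrier R" using s b Ac by auto
  have "b \<in> C" using b A_sub_C by auto
  hence "b \<otimes> (s \<otimes> y) \<in> C" using s(2) C'(6) by simp
  hence "(b \<otimes> (s \<otimes> y)) \<otimes> \<pi> \<in> Idl\<^bsub>S\<^esub> \<pp>" by (rule I(2)) (use genideal_p(2) \<pi>(1) in auto)
  moreover have "(\<ominus> x) \<otimes> (s \<otimes> b \<ominus> \<one>) \<in> Idl\<^bsub>S\<^esub> \<pp>" by (rule I(2)[OF C'(5)[OF x]]) (use genideal_p(2) b(2) in auto)
  ultimately have "(b \<otimes> (s \<otimes> y)) \<otimes> \<pi> \<oplus> (\<ominus> x) \<otimes> (s \<otimes> b \<ominus> \<one>) \<in> Idl\<^bsub>S\<^esub> \<pp>" by (rule I(1))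
  moreover have "(b \<otimes> (s \<otimes> y)) \<otimes> \<pi> = (b \<otimes> s) \<otimes> x" unfolding y(3)[symmetric] using c y(1) \<pi>_mem(3) by (simp add: m_ac)
  moreover have "(b \<otimes> s) \<otimes> x \<oplus> (\<ominus> x) \<otimes> (s \<otimes> b \<ominus> \<one>) = x" using c xc by algebra
  ultimately show ?thesis by simp
qed

end

section \<open>Ramification indices are values of a uniformizer\<close>

context dedekind_extension begin

lemma powers_comaximal:
  assumes P: "lies_over P" and Q: "lies_over Q" and ne: "P \<noteq> Q"
  shows "P [^]\<^bsub>IS\<^esub> (a::nat) <+>\<^bsub>S\<^esub> Q [^]\<^bsub>IS\<^esub> (b::nat) = carrier S"
proof -
  have iP: "ideal (P [^]\<^bsub>IS\<^esub> a) S" and iQ: "ideal (Q [^]\<^bsub>IS\<^esub> b) S"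
    using ideal_power_ideal over_prime(1) P Q by auto
  have "\<not> P \<subseteq> Q" using over_antichain[OF Q P] ne by auto
  then obtain x where x: "x \<in> P" "x \<notin> Q" by auto
  have xC: "x \<in> C" using x over_prime(2)[OF P] by auto
  have "x [^] a \<in> C - Q"
    by (induct a) (use over_prime(6)[OF Q] C' over_den[OF Q] x xC in auto)
  then obtain d where d: "d \<in> C" "\<one> \<ominus> x [^] a \<otimes> d \<in> Q [^]\<^bsub>IS\<^esub> b" using comaximal_element[OF Q] by blast
  have xa: "x [^] a \<in> P [^]\<^bsub>IS\<^esub> a" using element_power_in[OF x(1) over_prime(2)[OF P]] .
  have c: "x [^] a \<in> carrier R" "d \<in> carrier R" using xC d Cc by auto
  have "d \<otimes> x [^] a \<in> P [^]\<^bsub>IS\<^esub> a" using iP xa d unfolding ideal_S_iff by auto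
  moreover have "\<one> = d \<otimes> x [^] a \<oplus> (\<one> \<ominus> x [^] a \<otimes> d)" using c by (simp add: m_comm a_minus_def a_lcomm r_neg)
  ultimately have "\<one>\<^bsub>S\<^esub> \<in> P [^]\<^bsub>IS\<^esub> a <+>\<^bsub>S\<^esub> Q [^]\<^bsub>IS\<^esub> b" unfolding set_add_def' using d by auto
  thus ?thesis using ideal.one_imp_carrier[OF ring.add_ideals[OF S_ring iP iQ]] by simp
qed

text \<open>
  Powers of distinct primes are comaximal, so the product over all primes \<open>P\<close> of \<open>P\<close> to the power \<open>v P \<pi>\<close> is the
  intersection of these powers, which is described by the valuations.
\<close>

lemma factorization_exists:
  assumes q: "lies_over q"
  shows "\<exists>f. prime_ideal_factorization S (Idl\<^bsub>S\<^esub> \<pp>) f"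
proof -
  interpret IS: comm_monoid IS by (rule IS_monoid)
  define v where "v P = (SOME v. valuation_at v P)" for P
  have v: "valuation_at (v P) P" if "lies_over P" for P
    unfolding v_def using someI_ex[OF exists_valuation_at[OF that]] .
  define f where "f P = (if lies_over P then nat (v P \<pi>) else 0)" for P
  have fn: "f P \<noteq> 0 \<longleftrightarrow> lies_over P" for P
  proof (cases "lies_over P")
    case True thus ?thesis using valuation_\<pi>(1)[OF True v[OF True]] unfolding f_def by simp
  qed (simp add: f_def)
  hence T: "{P. f P \<noteq> 0} = {P. lies_over P}" by auto
  let ?T = "{P. lies_over P}"
  have "card ?T \<noteq> 0" using q finite_over by auto
  then obtain m where m: "card ?T = Suc m" by (cases "card ?T") auto
  obtain h where h: "bij_betw h {0..<Suc m} ?T" using ex_bij_betw_nat_finite[OF finite_over] m by auto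
  have hI: "{0..<Suc m} = {..m}" by auto
  have hl: "lies_over (h i)" if "i \<le> m" for i using h that unfolding bij_betw_def hI by auto
  have hinj: "inj_on h {..m}" and him: "h ` {..m} = ?T" using h unfolding bij_betw_def hI by auto
  let ?g = "\<lambda>P. P [^]\<^bsub>IS\<^esub> f P"
  have gi: "?g \<in> ?T \<rightarrow> carrier IS" using ideal_power_ideal over_prime(1) by auto
  have "finprod IS ?g ?T = finprod IS (\<lambda>k. ?g (h k)) {..m}"
    using IS.finprod_reindex[of ?g h "{..m}"] gi hinj him by simp
  also have "\<dots> = (\<Inter>k\<in>{..m}. ?g (h k))"
  proof (rule cring.ideal_prod_eq_Inter[OF S_cring])
    show "(\<lambda>k. ?g (h k)) \<in> {..m} \<rightarrow> {J. ideal J S}" using gi him by auto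
    fix i j assume "i \<in> {..m}" "j \<in> {..m}" "i \<noteq> j"
    hence "h i \<noteq> h j" "lies_over (h i)" "lies_over (h j)" using hinj hl by (auto simp: inj_on_def)
    thus "?g (h i) <+>\<^bsub>S\<^esub> ?g (h j) = carrier S" using powers_comaximal by blast
  qed
  also have "\<dots> = (\<Inter>P\<in>?T. ?g P)" unfolding him[symmetric] by simp
  also have "\<dots> = Idl\<^bsub>S\<^esub> \<pp>"
  proof
    have eq: "?g P = {x \<in> C. x = \<zero> \<or> v P \<pi> \<le> v P x}" if "lies_over P" for P
      using power_eq[OF that v[OF that], of "f P"] valuation_\<pi>(1)[OF that v[OF that]] that unfolding f_def by simp
    show "(\<Inter>P\<in>?T. ?g P) \<subseteq> Idl\<^bsub>S\<^esub> \<pp>"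
    proof
      fix x assume x: "x \<in> (\<Inter>P\<in>?T. ?g P)"
      have xx: "x \<in> C \<and> (x = \<zero> \<or> v P \<pi> \<le> v P x)" if "lies_over P" for P using x eq[OF that] that by auto
      show "x \<in> Idl\<^bsub>S\<^esub> \<pp>" by (rule genideal_eq_Inter[of v]) (use v xx q in auto)
    qed
    have "Idl\<^bsub>S\<^esub> \<pp> \<subseteq> C" using genideal_p(1) unfolding ideal_S_iff by auto
    hence "Idl\<^bsub>S\<^esub> \<pp> \<subseteq> ?g P" if "lies_over P" for P
      unfolding eq[OF that] using valuation_genideal[OF that v[OF that]] by blast
    thus "Idl\<^bsub>S\<^esub> \<pp> \<subseteq> (\<Inter>P\<in>?T. ?g P)" by blast
  qed
  finally have "prime_ideal_factorization S (Idl\<^bsub>S\<^esub> \<pp>) f"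
    unfolding prime_ideal_factorization_def T using finite_over fn unfolding lies_over_def by auto
  thus ?thesis by blast
qed

text \<open>
  In any factorization the exponent of \<open>q\<close> is at most \<open>v \<pi>\<close>, as \<open>\<pi>\<close> lies in that power of \<open>q\<close>. For the
  converse, an element of value one to the power \<open>f q\<close>, times an element of the other factors outside
  \<open>q\<close>, lies in the ideal generated by \<open>\<pp>\<close>, where all values are at least \<open>v \<pi>\<close>.
\<close>

lemma factorization_exponent:
  assumes q: "lies_over q" and v: "valuation_at v q" and f: "prime_ideal_factorization S (Idl\<^bsub>S\<^esub> \<pp>) f"
  shows "int (f q) = v \<pi>"
proof -
  interpret IS: comm_monoid IS by (rule IS_monoid)
  interpret W: valued_field R v using v unfolding valuation_at_def by simp
  let ?T = "{P. f P \<noteq> 0}" let ?g = "\<lambda>P. P [^]\<^bsub>IS\<^esub> f P"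
  have T: "finite ?T" "\<And>P. P \<in> ?T \<Longrightarrow> primeideal P S" "Idl\<^bsub>S\<^esub> \<pp> = finprod IS ?g ?T"
    using f unfolding prime_ideal_factorization_def by auto
  have id: "ideal P S" if "P \<in> ?T" for P using T(2)[OF that] by (simp add: primeideal_def)
  have gi: "?g \<in> ?T \<rightarrow> carrier IS" using ideal_power_ideal id by auto
  have split: "ideal J S \<and> finprod IS ?g ?T = ideal_prod S (?g Q) J"
    if Q: "ideal Q S" and J: "J = finprod IS ?g (?T - {Q})" for Q J
  proof -
    have gJ: "?g \<in> ?T - {Q} \<rightarrow> carrier IS" using gi by auto
    have iJ: "J \<in> carrier IS" unfolding J by (rule IS.finprod_closed[OF gJ])
    have gQ: "?g Q \<in> carrier IS" using ideal_power_ideal[OF Q] by simp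
    have "finprod IS ?g ?T = ?g Q \<otimes>\<^bsub>IS\<^esub> J"
    proof (cases "Q \<in> ?T")
      case True
      hence "?T = insert Q (?T - {Q})" by auto
      moreover have "finprod IS ?g (insert Q (?T - {Q})) = ?g Q \<otimes>\<^bsub>IS\<^esub> J"
        unfolding J using T(1) gJ gQ by (intro IS.finprod_insert) auto
      ultimately show ?thesis by simp
    next
      case False
      hence "?g Q = \<one>\<^bsub>IS\<^esub>" "?T - {Q} = ?T" by auto
      thus ?thesis using IS.l_one[OF iJ] unfolding J by simp
    qed
    thus ?thesis using iJ by simp
  qed
  have sub: "finprod IS ?g ?T \<subseteq> ?g Q" if "ideal Q S" for Q
    using split[OF that refl] ring.ideal_prod_inter[OF S_ring ideal_power_ideal[OF that]] by auto
  have TO: "lies_over Q" if Q: "Q \<in> ?T" for Q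
  proof -
    obtain k where k: "f Q = Suc k" using Q by (cases "f Q") auto
    have "?g Q \<subseteq> Q" unfolding k using ring.ideal_prod_inter[OF S_ring ideal_power_ideal[OF id[OF Q]] id[OF Q], of k] by simp
    hence pQ: "\<pp> \<subseteq> Q" using genideal_p(2) T(3) sub[OF id[OF Q]] by blast
    have Q': "\<one> \<notin> Q" "Q \<subseteq> C" "\<And>x y. x \<in> Q \<Longrightarrow> y \<in> Q \<Longrightarrow> x \<oplus> y \<in> Q" "\<And>a x. a \<in> C \<Longrightarrow> x \<in> Q \<Longrightarrow> a \<otimes> x \<in> Q"
      using T(2)[OF Q] unfolding primeideal_subring_iff[OF C(1)] ideal_S_iff by auto
    have "a \<in> \<pp>" if a: "a \<in> Q" "a \<in> A" for a
    proof (rule ccontr)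
      assume "a \<notin> \<pp>"
      then obtain b where b: "b \<in> A" "a \<otimes> b \<ominus> \<one> \<in> \<pp>" using inverse_modulo a by auto
      have c: "a \<in> carrier R" "b \<in> carrier R" using a b Ac by auto
      have bC: "b \<in> C" "\<ominus> \<one> \<in> C" using b A_sub_C C' by auto
      have "b \<otimes> a \<oplus> \<ominus> \<one> \<otimes> (a \<otimes> b \<ominus> \<one>) \<in> Q" using Q'(3,4) a(1) b(2) bC pQ by (meson subsetD)
      moreover have "b \<otimes> a \<oplus> \<ominus> \<one> \<otimes> (a \<otimes> b \<ominus> \<one>) = \<one>" using c by algebra
      ultimately show False using Q'(1) by simp
    qed
    hence "Q \<inter> A = \<pp>" using pQ p(1) by auto
    thus ?thesis unfolding lies_over_def using T(2)[OF Q] by simp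
  qed
  have vq: "?g q = {x \<in> C. x = \<zero> \<or> int (f q) \<le> v x}" by (rule power_eq[OF q v])
  have "\<pi> \<in> Idl\<^bsub>S\<^esub> \<pp>" using genideal_p(2) \<pi>(1) by auto
  hence "\<pi> \<in> ?g q" using sub[OF over_prime(1)[OF q]] T(3) by auto
  hence le: "int (f q) \<le> v \<pi>" using vq \<pi>(2) by auto
  have "\<exists>z\<in>finprod IS ?g U. z \<in> C - q" if "finite U" "U \<subseteq> ?T" "q \<notin> U" for U
    using that
  proof (induct U)
    case empty thus ?case using over_prime(6)[OF q] C' by auto
  next
    case (insert Q U)
    then obtain z where z: "z \<in> finprod IS ?g U" "z \<in> C - q" by auto
    have Q: "lies_over Q" using TO insert by auto
    have "\<not> Q \<subseteq> q" using over_antichain[OF q Q] insert by auto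
    then obtain x where x: "x \<in> Q" "x \<notin> q" by auto
    have xC: "x \<in> C - q" using x over_prime(2)[OF Q] by auto
    have xn: "x [^] k \<in> C - q" for k :: nat
      by (induct k) (use over_prime(6)[OF q] C' over_den[OF q _ xC] in auto)
    have xg: "x [^] f Q \<in> ?g Q" using element_power_in[OF x(1) over_prime(2)[OF Q]] .
    have "finprod IS ?g (insert Q U) = ideal_prod S (?g Q) (finprod IS ?g U)"
    proof -
      have "?g \<in> U \<rightarrow> carrier IS" "?g Q \<in> carrier IS" using gi insert(4) by (auto simp del: IS_simps)
      thus ?thesis using IS.finprod_insert[OF insert(1,2), of ?g] by (simp only: IS_simps)
    qed
    hence "x [^] f Q \<otimes> z \<in> finprod IS ?g (insert Q U)" using ideal_prodI[OF xg z(1)] by simp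
    thus ?case using over_den[OF q xn z(2)] by auto
  qed
  from this[of "?T - {q}"] obtain z where z: "z \<in> finprod IS ?g (?T - {q})" "z \<in> C - q" using T(1) by auto
  obtain t where t: "t \<in> carrier R" "t \<noteq> \<zero>" "v t = 1" using v unfolding valuation_at_def by auto
  have "t \<in> local_ring q" using v t unfolding valuation_at_def by auto
  then obtain s where s: "s \<in> C - q" "s \<otimes> t \<in> C" unfolding local_ring_def by auto
  have unit: "v y = 0 \<and> y \<noteq> \<zero> \<and> y \<in> carrier R" if "y \<in> C - q" for y
  proof -
    have "y \<noteq> \<zero>" using that over_prime(3)[OF q] by auto
    thus ?thesis using valuation_at_values(3)[OF q v, of y] that Cc by auto
  qed
  define c where "c = s \<otimes> t"
  have c: "c \<in> C" "c \<in> carrier R" "c \<noteq> \<zero>" "v c = 1" using s t unit[OF s(1)] unfolding c_def by (auto simp: W.v_mult)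
  have cq: "c \<in> q" using valuation_at_values(2)[OF q v c(1,3)] c by simp
  have "c [^] f q \<in> ?g q" using element_power_in[OF cq over_prime(2)[OF q]] .
  hence "c [^] f q \<otimes> z \<in> ideal_prod S (?g q) (finprod IS ?g (?T - {q}))" using z(1) by (intro ideal_prodI)
  hence "c [^] f q \<otimes> z \<in> Idl\<^bsub>S\<^esub> \<pp>" using split[OF over_prime(1)[OF q] refl] T(3) by simp
  moreover have "c [^] f q \<otimes> z \<noteq> \<zero>" "v (c [^] f q \<otimes> z) = int (f q)" using c unit[OF z(2)] by (auto simp: W.v_mult)
  ultimately have "v \<pi> \<le> int (f q)" using valuation_genideal[OF q v] by metis
  thus ?thesis using le by simp
qed

theorem ramification_index_eq:
  assumes q: "lies_over q" and v: "valuation_at v q"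
  shows "int (ramification_index S q \<pp>) = v \<pi>"
proof -
  obtain f where f: "prime_ideal_factorization S (Idl\<^bsub>S\<^esub> \<pp>) f" using factorization_exists[OF q] by blast
  have "ramification_index S q \<pp> = f q"
    unfolding ramification_index_def
  proof (rule the_equality)
    fix e assume "\<exists>g. prime_ideal_factorization S (Idl\<^bsub>S\<^esub> \<pp>) g \<and> g q = e"
    then obtain g where g: "prime_ideal_factorization S (Idl\<^bsub>S\<^esub> \<pp>) g" "g q = e" by blast
    thus "e = f q" using factorization_exponent[OF q v f] factorization_exponent[OF q v g(1)] by simp
  qed (use f in blast)
  thus ?thesis using factorization_exponent[OF q v f] by simp
qed

end

section \<open>Simple roots over a perfect residue field\<close>

context ring begin

lemma deriv_list_eq_coeffs:
  "deriv_list p = map (\<lambda>i. [Suc i] \<cdot> coeff p (Suc i)) (rev [0..<degree p])"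
proof (induct p)
  case (Cons a p)
  show ?case
  proof (cases p)
    case (Cons b q)
    hence l: "length p = Suc (length q)" by simp
    have "map (\<lambda>i. [Suc i] \<cdot> coeff p (Suc i)) (rev [0..<length q]) = map (\<lambda>i. [Suc i] \<cdot> coeff (a # p) (Suc i)) (rev [0..<length q])"
      using l by (intro map_cong) auto
    thus ?thesis using Cons.hyps l \<open>p = b # q\<close> by simp
  qed simp
qed simp

lemma formal_derivative_eq: "formal_derivative R p = normalize (deriv_list p)"
  unfolding formal_derivative_def deriv_list_eq_coeffs ..

lemma normalize_zeros: "set p \<subseteq> {\<zero>} \<Longrightarrow> normalize p = []"
  by (induct p) auto

end

lemma (in ring_hom_ring) deriv_list_hom:
  "set p \<subseteq> carrier R \<Longrightarrow> map h (R.deriv_list p) = S.deriv_list (map h p)"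
proof (induct p)
  case (Cons a p)
  have "h ([(k::nat)] \<cdot>\<^bsub>R\<^esub> a) = [k] \<cdot>\<^bsub>S\<^esub> h a" for k
    using Cons(2) by (induct k) auto
  thus ?case using Cons by auto
qed simp

lemma (in ring) deriv_list_consistent:
  assumes "subring A R" shows "ring.deriv_list (R\<lparr>carrier := A\<rparr>) = deriv_list"
proof
  fix p
  interpret S: ring "R\<lparr>carrier := A\<rparr>" by (rule subring_is_ring[OF assms])
  have "add_pow (R\<lparr>carrier := A\<rparr>) (k::nat) a = add_pow R k a" for k a
    by (simp add: add_pow_def nat_pow_def)
  thus "S.deriv_list p = deriv_list p" by (induct p) auto
qed

context valued_field begin

text \<open>
  Leading coefficients in the maximal ideal are dropped, until one that is invertible modulo it is reached.
\<close>

lemma monic_of_primitive: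
  assumes A: "subring A R" "A \<subseteq> B 0" and inv: "\<And>a. a \<in> A \<Longrightarrow> a \<notin> B 1 \<Longrightarrow> \<exists>b\<in>A. b \<otimes> a \<ominus> \<one> \<in> B 1"
    and c: "c \<in> B 0" and f: "set f \<subseteq> A" "\<not> set f \<subseteq> B 1" "eval f c \<in> B 1"
  shows "\<exists>F. set F \<subseteq> A \<and> eval (\<one> # F) c \<in> B 1"
  using f
proof (induct f)
  case (Cons a f)
  note A' = subringE[OF A(1)]
  have a: "a \<in> A" "a \<in> carrier R" and f: "set f \<subseteq> A" "set f \<subseteq> carrier R" using Cons A' by auto
  have cc: "c \<in> carrier R" "c [^] length f \<in> carrier R" "c [^] length f \<in> B 0" using c by auto
  have ec: "eval f c \<in> carrier R" using eval_in_carrier f cc by auto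
  have ev: "eval (a # f) c = a \<otimes> c [^] length f \<oplus> eval f c" by simp
  show ?case
  proof (cases "a \<in> B 1")
    case True
    have "eval f c = eval (a # f) c \<ominus> a \<otimes> c [^] length f" unfolding ev using a(2) cc(2) ec by algebra
    also have "\<dots> \<in> B 1" by (rule B_minus[OF Cons(4) B_mult0(2)[OF True cc(3)]])
    finally show ?thesis using Cons(1) f True Cons(3) by auto
  next
    case False
    then obtain b where b: "b \<in> A" "b \<otimes> a \<ominus> \<one> \<in> B 1" using inv a by blast
    have bc: "b \<in> carrier R" "b \<in> B 0" using b A A' by auto
    let ?F = "map (\<lambda>x. b \<otimes> x) f"
    have "eval (\<one> # ?F) c = b \<otimes> eval (a # f) c \<ominus> (b \<otimes> a \<ominus> \<one>) \<otimes> c [^] length f"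
      unfolding ev using a(2) bc(1) cc ec f by (simp add: eval_smult) (use cc(2) in algebra)
    also have "\<dots> \<in> B 1" by (rule B_minus[OF B_mult0(1)[OF bc(2) Cons(4)] B_mult0(2)[OF b(2) cc(3)]])
    finally show ?thesis using b f A' by (intro exI[of _ ?F]) auto
  qed
qed simp

lemma eval_cong_coeffs:
  assumes "length f = length g" "set f \<subseteq> carrier R" "set g \<subseteq> carrier R" "c \<in> B 0"
    and "\<And>i. i < length f \<Longrightarrow> f ! i \<ominus> g ! i \<in> B 1"
  shows "eval f c \<ominus> eval g c \<in> B 1"
  using assms(1-3,5)
proof (induct f g rule: list_induct2)
  case Nil show ?case by (simp add: a_minus_def)
next
  case (Cons a f b g)
  have "eval f c \<ominus> eval g c \<in> B 1"
  proof (rule Cons(2))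
    fix i assume "i < length f" thus "f ! i \<ominus> g ! i \<in> B 1" using Cons(5)[of "Suc i"] by simp
  qed (use Cons in auto)
  moreover have "a \<ominus> b \<in> B 1" using Cons(5)[of 0] by simp
  moreover have cc: "c \<in> carrier R" "c [^] length g \<in> carrier R" "c [^] length g \<in> B 0" using assms(4) by auto
  ultimately have "(a \<ominus> b) \<otimes> c [^] length g \<oplus> (eval f c \<ominus> eval g c) \<in> B 1" by blast
  moreover have "eval f c \<in> carrier R" "eval g c \<in> carrier R" "a \<in> carrier R" "b \<in> carrier R"
    using Cons cc by (auto intro!: eval_in_carrier)
  hence "eval (a # f) c \<ominus> eval (b # g) c = (a \<ominus> b) \<otimes> c [^] length g \<oplus> (eval f c \<ominus> eval g c)"
    using Cons(1) by simp (use cc(2) in algebra)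
  ultimately show ?case by simp
qed

text \<open>
  Choose a monic relation for \<open>c\<close> modulo the maximal ideal of least degree. By minimality its reduction is
  irreducible over the residue field of \<open>A\<close>: lifts of two proper factors would have a product that vanishes at \<open>c\<close>
  modulo the maximal ideal, so one of them would vanish there too. If the root were not simple, minimality would make the derivative
  of the reduction zero; but over a perfect field irreducible polynomials are separable.
\<close>

theorem simple_root_mod_maximal_ideal:
  assumes A: "subring A R" "A \<subseteq> B 0" and p: "ideal \<pp> (R\<lparr>carrier := A\<rparr>)" "\<And>a. a \<in> A \<Longrightarrow> a \<in> \<pp> \<longleftrightarrow> a \<in> B 1"
    and perf: "perfect_field (R\<lparr>carrier := A\<rparr> Quot \<pp>)"
    and inv: "\<And>a. a \<in> A \<Longrightarrow> a \<notin> B 1 \<Longrightarrow> \<exists>b\<in>A. b \<otimes> a \<ominus> \<one> \<in> B 1"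
    and c: "c \<in> B 0" and f: "set f \<subseteq> A" "\<not> set f \<subseteq> B 1" "eval f c \<in> B 1"
  shows "\<exists>F. set F \<subseteq> A \<and> eval (\<one> # F) c \<in> B 1 \<and> eval (deriv_list (\<one> # F)) c \<notin> B 1"
proof -
  note A' = subringE[OF A(1)]
  define P where "P n \<longleftrightarrow> (\<exists>F. set F \<subseteq> A \<and> eval (\<one> # F) c \<in> B 1 \<and> length F = n)" for n
  obtain F0 where "set F0 \<subseteq> A" "eval (\<one> # F0) c \<in> B 1" using monic_of_primitive[OF A inv c f] by blast
  hence "P (length F0)" unfolding P_def by auto
  hence L: "P (LEAST n. P n)" "\<And>n. P n \<Longrightarrow> (LEAST n. P n) \<le> n" by (auto intro: LeastI Least_le)
  then obtain F where F: "set F \<subseteq> A" "eval (\<one> # F) c \<in> B 1" "length F = (LEAST n. P n)" unfolding P_def by auto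
  have min: "length F \<le> length G" if "set G \<subseteq> A" "eval (\<one> # G) c \<in> B 1" for G
    using L(2)[of "length G"] that F(3) unfolding P_def by auto
  have small: "set E \<subseteq> B 1" if "set E \<subseteq> A" "length E \<le> length F" "eval E c \<in> B 1" for E
    by (rule coeffs_in_max_ideal[OF A inv c min that])
  have cc: "c \<in> carrier R" using c by auto
  have F0: "F \<noteq> []" using F(2) cc by auto
  let ?f = "\<one> # F"
  have fA: "set ?f \<subseteq> A" using F A' by auto
  have "eval (deriv_list ?f) c \<notin> B 1"
  proof
    assume "eval (deriv_list ?f) c \<in> B 1"
    hence dB: "set (deriv_list ?f) \<subseteq> B 1" using small[of "deriv_list ?f"] set_deriv_list[OF A(1) fA] by simp
    hence dp: "set (deriv_list ?f) \<subseteq> \<pp>" using p(2) set_deriv_list[OF A(1) fA] by blast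
    let ?S = "R\<lparr>carrier := A\<rparr>" let ?k = "?S Quot \<pp>"
    define h where "h = (\<lambda>a. \<pp> +>\<^bsub>?S\<^esub> a)"
    have Sring: "ring ?S" by (rule subring_is_ring[OF A(1)])
    have hom: "ring_hom_ring ?S ?k h" unfolding h_def by (rule ideal.rcos_ring_hom_ring[OF p(1)])
    have kf: "field ?k" using perf unfolding perfect_field_def by simp
    interpret k: field ?k by (rule kf)
    interpret h: ring_hom_ring ?S ?k h by (rule hom)
    have h0: "h a = \<zero>\<^bsub>?k\<^esub> \<longleftrightarrow> a \<in> \<pp>" if "a \<in> A" for a
      using that ideal.rcos_const_imp_mem[OF p(1), of a] ring.a_rcos_zero[OF Sring p(1), of a]
      unfolding h_def by (auto simp: FactRing_def)
    have hsurj: "\<exists>a\<in>A. y = h a" if "y \<in> carrier ?k" for y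
      using that unfolding h_def by (auto simp: FactRing_def A_RCOSETS_def')
    have lift: "\<exists>G. set G \<subseteq> A \<and> g = map h G" if "set g \<subseteq> carrier ?k" for g
      using that
    proof (induct g)
      case (Cons y g)
      then obtain G where "set G \<subseteq> A" "g = map h G" by auto
      moreover obtain a where "a \<in> A" "y = h a" using hsurj[of y] Cons(2) by auto
      ultimately show ?case by (intro exI[of _ "a # G"]) auto
    qed simp
    let ?F = "map h ?f"
    have Fk: "set ?F \<subseteq> carrier ?k" using fA by auto
    have hone: "h \<one> = \<one>\<^bsub>?k\<^esub>" using h.hom_one by simp
    have Fp: "?F \<in> carrier (poly_ring ?k)"
      unfolding univ_poly_carrier[symmetric] polynomial_def using Fk hone k.one_not_zero by simp
    have Fn: "?F \<noteq> []" "degree ?F = length F" by auto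
    note cs = k.carrier_is_subfield
    note units = k.univ_poly_units'[OF cs]
    have nu: "?F \<notin> Units (poly_ring ?k)" using units[of ?F] Fn F0 by auto
    have hdiff: "a \<ominus> b \<in> B 1" if "a \<in> A" "b \<in> A" "h a = h b" for a b
    proof -
      have m1: "\<ominus> \<one> \<otimes> b \<in> A" "\<ominus> \<one> \<in> A" using that A' by auto
      have hz: "h (\<ominus> \<one> \<otimes> b \<oplus> b) = \<zero>\<^bsub>?k\<^esub>"
      proof -
        have "\<ominus> \<one> \<otimes> b \<oplus> b = \<zero>" using that A'(1) by (simp add: subset_iff l_minus l_neg)
        thus ?thesis using h0[of \<zero>] A'(2) p(2)[of \<zero>] by simp
      qed
      have "h (\<ominus> \<one> \<otimes> b \<oplus> a) = h (\<ominus> \<one> \<otimes> b) \<oplus>\<^bsub>?k\<^esub> h a" using h.hom_add[of "\<ominus> \<one> \<otimes> b" a] m1 that by simp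
      also have "\<dots> = h (\<ominus> \<one> \<otimes> b) \<oplus>\<^bsub>?k\<^esub> h b" using that by simp
      also have "\<dots> = h (\<ominus> \<one> \<otimes> b \<oplus> b)" using h.hom_add[of "\<ominus> \<one> \<otimes> b" b] m1 that by simp
      finally have "\<ominus> \<one> \<otimes> b \<oplus> a \<in> \<pp>" using hz h0[of "\<ominus> \<one> \<otimes> b \<oplus> a"] m1 that A' by simp
      hence "\<ominus> \<one> \<otimes> b \<oplus> a \<in> B 1" using p(2)[of "\<ominus> \<one> \<otimes> b \<oplus> a"] m1 that A' by simp
      moreover have "a \<in> carrier R" "b \<in> carrier R" using that A' by auto
      hence "\<ominus> \<one> \<otimes> b \<oplus> a = a \<ominus> b" by algebra
      ultimately show ?thesis by simp
    qed
    have irr: "pirreducible\<^bsub>?k\<^esub> (carrier ?k) ?F"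
    proof (rule domain.ring_irreducibleI[OF k.univ_poly_is_domain[OF k.carrier_is_subring]])
      show "?F \<in> carrier (poly_ring ?k) - {\<zero>\<^bsub>poly_ring ?k\<^esub>}" using Fp by (simp add: univ_poly_zero)
      show "?F \<notin> Units (poly_ring ?k)" by (rule nu)
      fix g g' assume g: "g \<in> carrier (poly_ring ?k)" "g' \<in> carrier (poly_ring ?k)" "?F = g \<otimes>\<^bsub>poly_ring ?k\<^esub> g'"
      show "g \<in> Units (poly_ring ?k) \<or> g' \<in> Units (poly_ring ?k)"
      proof (rule ccontr)
        assume "\<not> ?thesis"
        hence nug: "g \<notin> Units (poly_ring ?k)" "g' \<notin> Units (poly_ring ?k)" by auto
        have mul: "?F = ring.poly_mult ?k g g'" using g(3) by (simp add: univ_poly_mult)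
        have gp: "polynomial\<^bsub>?k\<^esub> (carrier ?k) g" "polynomial\<^bsub>?k\<^esub> (carrier ?k) g'" using g univ_poly_carrier by blast+
        have gn: "g \<noteq> []" "g' \<noteq> []" using mul k.poly_mult_zero k.polynomial_in_carrier[OF k.carrier_is_subring] gp Fn(1) by (metis)+
        have deg: "degree ?F = degree g + degree g'"
          using k.poly_mult_degree_eq[OF k.carrier_is_subring gp] gn mul by simp
        have "degree g \<noteq> 0" "degree g' \<noteq> 0" using nug units[of g] units[of g'] g(1,2) gn by (metis, metis)
        note dn = this
        have dF: "length F = degree g + degree g'" using deg Fn(2) by metis
        have "length g > 0" "length g' > 0" using gn by blast+
        hence len: "length g \<le> length F" "length g' \<le> length F" using dF dn by linarith+
        obtain G G' where G: "set G \<subseteq> A" "g = map h G" and G': "set G' \<subseteq> A" "g' = map h G'"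
          using lift gp unfolding polynomial_def by (metis empty_subsetI list.set(1))
        have Gc: "set G \<subseteq> carrier ?S" "set G' \<subseteq> carrier ?S" "set G \<subseteq> carrier R" "set G' \<subseteq> carrier R" using G G' A' by auto
        let ?P = "poly_mult G G'"
        have pc: "ring.poly_mult ?S = poly_mult" by (rule poly_mult_consistent[OF A(1)])
        have PA: "set ?P \<subseteq> A" using ring.poly_mult_in_carrier[OF Sring Gc(1,2)] pc by simp
        \<comment> \<open>The product of the lifts reduces to the polynomial only up to leading zeros, which come from a
          part \<open>P0\<close> with coefficients in the maximal ideal.\<close>
        have norm: "k.normalize (map h ?P) = ?F" using h.poly_mult_hom'[OF Gc(1,2)] pc mul G G' by simp
        have hP: "set (map h ?P) \<subseteq> carrier ?k" using PA by auto
        have "\<exists>m. x = replicate m \<zero>\<^bsub>?k\<^esub> @ k.normalize x" for x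
          using k.normalize_def'(1)[of x] unfolding k.normalize_def'(2)[of x, symmetric] by (rule exI)
        from this[of "map h ?P"] obtain m where m: "map h ?P = replicate m \<zero>\<^bsub>?k\<^esub> @ ?F" unfolding norm by (rule exE)
        define P0 P1 where "P0 = take m ?P" and "P1 = drop m ?P"
        have P01: "?P = P0 @ P1" unfolding P0_def P1_def by simp
        have "map h P0 = replicate m \<zero>\<^bsub>?k\<^esub>" "map h P1 = ?F"
          unfolding P0_def P1_def using arg_cong[OF m, of "take m"] arg_cong[OF m, of "drop m"] by (simp_all add: take_map drop_map)
        note m' = this
        have s: "set P0 \<subseteq> A" "set P1 \<subseteq> A" using PA P01 by auto
        hence s': "set P0 \<subseteq> carrier R" "set P1 \<subseteq> carrier R" using A' by auto
        have "set P0 \<subseteq> B 1"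
        proof
          fix x assume x: "x \<in> set P0"
          hence "h x \<in> set (replicate m \<zero>\<^bsub>?k\<^esub>)" using m'(1) by (metis image_eqI list.set_map)
          hence "h x = \<zero>\<^bsub>?k\<^esub>" by (simp split: if_splits)
          thus "x \<in> B 1" using h0 p(2) s x by blast
        qed
        hence e0: "eval P0 c \<in> B 1" using c by (induct P0) (auto intro!: B_add B_mult0)
        have l1: "length P1 = length ?f" using m'(2) by (metis length_map)
        have "eval P1 c \<ominus> eval ?f c \<in> B 1"
        proof (rule eval_cong_coeffs[OF l1 s'(2) _ c])
          show "set ?f \<subseteq> carrier R" using fA A' by auto
          fix i assume i: "i < length P1"
          have "h (P1 ! i) = h (?f ! i)" using m'(2) i l1 by (metis nth_map)
          moreover have "P1 ! i \<in> A" using s i by (meson nth_mem subsetD)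
          moreover have "?f ! i \<in> A" using fA i l1 by (metis nth_mem subsetD)
          ultimately show "P1 ! i \<ominus> ?f ! i \<in> B 1" using hdiff by blast
        qed
        moreover have ec: "eval P1 c \<in> carrier R" "eval ?f c \<in> carrier R" using eval_in_carrier[OF s'(2) cc] B_carr[OF F(2)] by auto
        ultimately have "eval P1 c \<in> B 1" using B_minus_cancel F(2) by blast
        moreover have "eval ?P c = eval P0 c \<otimes> c [^] length P1 \<oplus> eval P1 c" unfolding P01 by (rule eval_append[OF s' cc])
        ultimately have "eval ?P c \<in> B 1" using e0 c by auto
        moreover have "eval ?P c = eval G c \<otimes> eval G' c" by (rule eval_poly_mult[OF Gc(3,4) cc])
        moreover have "eval G c \<in> B 0" "eval G' c \<in> B 0" using eval_in_subring[OF B_subring _ c] G(1) G'(1) A(2) by blast+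
        ultimately have "eval G c \<in> B 1 \<or> eval G' c \<in> B 1" using unit_mult by metis
        hence "set G \<subseteq> B 1 \<or> set G' \<subseteq> B 1" using small[OF G(1)] small[OF G'(1)] len G(2) G'(2) by auto
        moreover have "\<not> set H \<subseteq> B 1" if H: "set H \<subseteq> A" "map h H \<noteq> []" "polynomial\<^bsub>?k\<^esub> (carrier ?k) (map h H)" for H
        proof
          assume "set H \<subseteq> B 1"
          moreover obtain a H' where "H = a # H'" using H(2) by (cases H) auto
          ultimately have "h a = \<zero>\<^bsub>?k\<^esub>" "map h H = h a # map h H'" using h0[of a] p(2)[of a] H(1) by auto
          thus False using H(3) unfolding polynomial_def by auto
        qed
        ultimately show False using G G' gp gn by metis
      qed
    qed
    have sep: "separable_polynomial ?k (carrier ?k) ?F" using perf Fp irr unfolding perfect_field_def by blast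
    have "formal_derivative ?k ?F = k.normalize (k.deriv_list ?F)" by (rule k.formal_derivative_eq)
    also have "k.deriv_list ?F = map h (deriv_list ?f)"
      using h.deriv_list_hom[of ?f] fA deriv_list_consistent[OF A(1)] by simp
    also have "k.normalize (map h (deriv_list ?f)) = []"
    proof (rule k.normalize_zeros)
      show "set (map h (deriv_list ?f)) \<subseteq> {\<zero>\<^bsub>?k\<^esub>}"
      proof
        fix y assume "y \<in> set (map h (deriv_list ?f))"
        then obtain x where "x \<in> set (deriv_list ?f)" "y = h x" by auto
        thus "y \<in> {\<zero>\<^bsub>?k\<^esub>}" using dp h0[of x] set_deriv_list[OF A(1) fA] by blast
      qed
    qed
    finally have fd: "formal_derivative ?k ?F = []" .
    interpret PR: domain "poly_ring ?k" by (rule k.univ_poly_is_domain[OF k.carrier_is_subring])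
    \<comment> \<open>Every polynomial divides zero, so the polynomial itself is a common divisor.\<close>
    have "?F divides\<^bsub>poly_ring ?k\<^esub> ?F" using PR.divides_refl[OF Fp] .
    moreover have "?F divides\<^bsub>poly_ring ?k\<^esub> []" using PR.r_null[OF Fp] PR.zero_closed unfolding factor_def univ_poly_zero by metis
    ultimately have "?F \<in> Units (poly_ring ?k)" using sep Fp fd unfolding separable_polynomial_def by simp
    thus False using nu by simp
  qed
  thus ?thesis using F by blast
qed

end

section \<open>The ramification index of a compositum\<close>

lemma (in ring) ring_characteristic_dvd:
  fixes e :: nat
  assumes "0 < e" "add_pow R e \<one> = \<zero>"
  shows "ring_characteristic R dvd e"
proof -
  define P where "P n \<longleftrightarrow> 0 < n \<and> add_pow R n \<one> = \<zero>" for n :: nat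
  have Pe: "P e" unfolding P_def using assms by auto
  define n where "n = (LEAST n. P n)"
  have n: "P n" "\<And>m. P m \<Longrightarrow> n \<le> m" unfolding n_def using Pe by (auto intro: LeastI Least_le)
  have "\<exists>n::nat>0. add_pow R n \<one> = \<zero>" using assms by blast
  hence c: "ring_characteristic R = n" unfolding ring_characteristic_def n_def P_def by simp
  have n0: "add_pow R n \<one> = \<zero>" "0 < n" using n unfolding P_def by auto
  have "add_pow R (n * m) \<one> = \<zero>" for m
    using add.nat_pow_pow[of \<one> m n] n0(1) by simp
  hence "add_pow R (n * (e div n)) \<one> = \<zero>" .
  moreover have "add_pow R e \<one> = add_pow R (n * (e div n)) \<one> \<oplus> add_pow R (e mod n) \<one>"
    using add.nat_pow_mult[of \<one> "n * (e div n)" "e mod n"] by simp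
  ultimately have "add_pow R (e mod n) \<one> = \<zero>" using assms by simp
  hence "\<not> 0 < e mod n" using n(2)[of "e mod n"] n0(2) mod_less_divisor[of n e] unfolding P_def by linarith
  thus ?thesis unfolding c by (simp add: dvd_eq_mod_eq_0)
qed

lemma (in ring_hom_ring) hom_add_pow_one:
  fixes k :: nat
  shows "h (add_pow R k \<one>) = add_pow S k \<one>\<^bsub>S\<^esub>"
  by (induct k) simp_all

text \<open>
  Write \<open>e\<close> as \<open>lcm e1 e2\<close> times \<open>k\<close>; then \<open>k\<close> divides both cofactors.
\<close>

lemma lcm_of_coprime_cofactors:
  fixes e e1 e2 :: nat and d1 d2 :: int
  assumes "int e = int e1 * d1" "int e = int e2 * d2" "gcd d1 d2 = 1" "0 < e"
  shows "e = lcm e1 e2"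
proof -
  have "int e1 dvd int e" "int e2 dvd int e" using assms(1,2) by (metis dvd_triv_left)+
  hence "lcm e1 e2 dvd e" by simp
  then obtain k where k: "e = lcm e1 e2 * k" unfolding dvd_def by blast
  have pos: "0 < e1" "0 < e2"
    using assms(1,4) by (cases e1; simp) (use assms(2,4) in \<open>cases e2; simp\<close>)
  have *: "int k dvd d" if d: "int e = int a * d" "0 < a" "a dvd lcm e1 e2" for a d
  proof -
    obtain l where l: "lcm e1 e2 = a * l" using d(3) unfolding dvd_def by blast
    have "int a * d = int a * (int l * int k)" using d(1)[symmetric] unfolding k l by (simp only: of_nat_mult mult.assoc)
    hence "d = int l * int k" using mult_left_cancel[of "int a" d "int l * int k"] d(2) by simp
    thus ?thesis by simp
  qed
  have "int k dvd gcd d1 d2" using *[OF assms(1) pos(1)] *[OF assms(2) pos(2)] by simp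
  hence "k = 1" using assms(3) by simp
  thus ?thesis using k by simp
qed

context field begin

lemma subring_of_subfield:
  assumes E: "subfield E R" and A: "subring A R" "A \<subseteq> E"
  shows "subring A (R\<lparr>carrier := E\<rparr>)"
proof -
  interpret F: field "R\<lparr>carrier := E\<rparr>" by (rule subfield_iff(2)[OF E])
  show ?thesis using F.ring_incl_imp_subring[of A] subring_is_ring[OF A(1)] A(2) by simp
qed

lemma integral_closure_subfield:
  assumes E: "subfield E R"
  shows "integral_closure (R\<lparr>carrier := E\<rparr>) A E = integral_closure R A E"
proof -
  have "carrier (A[X]\<^bsub>R\<lparr>carrier := E\<rparr>\<^esub>) = carrier (A[X])"
    unfolding univ_poly_def polynomial_def by simp
  thus ?thesis unfolding integral_closure_def using eval_consistent[OF subfieldE(1)[OF E]] by simp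
qed

lemma combine_subfield:
  assumes E: "subfield E R"
  shows "ring.combine (R\<lparr>carrier := E\<rparr>) as us = combine as us"
proof -
  have "ring (R\<lparr>carrier := E\<rparr>)" by (rule subring_is_ring[OF subfieldE(1)[OF E]])
  thus ?thesis by (simp add: ring.combine_eq_foldr combine_eq_foldr)
qed

lemma common_denominator:
  assumes A: "subring A R" and ks: "set ks \<subseteq> fraction_field R A"
  shows "\<exists>d\<in>A. d \<noteq> \<zero> \<and> (\<forall>k\<in>set ks. d \<otimes> k \<in> A)"
  using ks
proof (induct ks)
  case Nil show ?case using subringE(3)[OF A] by (intro bexI[of _ \<one>]) auto
next
  case (Cons k ks)
  note A' = subringE[OF A]
  obtain d where d: "d \<in> A" "d \<noteq> \<zero>" "\<forall>k\<in>set ks. d \<otimes> k \<in> A" using Cons by auto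
  obtain a b where ab: "k = a \<otimes> inv b" "a \<in> A" "b \<in> A" "b \<noteq> \<zero>" using Cons(2) unfolding fraction_field_def by auto
  have c: "a \<in> carrier R" "b \<in> carrier R" "d \<in> carrier R" using ab d A' by auto
  have sub: "set ks \<subseteq> carrier R" using Cons(2) subfieldE(3)[OF fraction_field_subfield[OF A]] by auto
  have "(d \<otimes> b) \<otimes> k = d \<otimes> a" unfolding ab(1) using c ab(4) by (simp add: m_assoc)
  hence "(d \<otimes> b) \<otimes> k \<in> A" using d ab A' by simp
  moreover have "(d \<otimes> b) \<otimes> x \<in> A" if "x \<in> set ks" for x
  proof -
    have "(d \<otimes> b) \<otimes> x = b \<otimes> (d \<otimes> x)" using c that sub by (auto simp: m_ac)
    thus ?thesis using d(3) that ab(3) A' by auto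
  qed
  ultimately show ?case using d ab c A' by (intro bexI[of _ "d \<otimes> b"]) auto
qed

end

text \<open>
  Dividing \<open>x\<close> by a power of the uniformizer \<open>\<rho>\<close> leaves an element of value zero for \<open>u\<close>, and hence for \<open>v\<close>.
\<close>

lemma (in valued_field) restricted_valuation:
  assumes E: "subfield E R" and v: "valued_field (R\<lparr>carrier := E\<rparr>) u"
    and \<rho>: "\<rho> \<in> E" "\<rho> \<noteq> \<zero>" "u \<rho> = 1" and units: "\<And>y. y \<in> E \<Longrightarrow> y \<noteq> \<zero> \<Longrightarrow> u y = 0 \<Longrightarrow> v y = 0"
    and x: "x \<in> E" "x \<noteq> \<zero>"
  shows "v x = u x * v \<rho>"
proof -
  interpret F: valued_field "R\<lparr>carrier := E\<rparr>" u by fact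
  note E' = subringE[OF subfieldE(1)[OF E]]
  have c: "\<rho> \<in> carrier R" "x \<in> carrier R" using \<rho> x E' by auto
  have pE: "y [^] n \<in> E" if "y \<in> E" for y and n :: nat using that E' by (induct n) auto
  have up: "u (\<rho> [^] n) = int n" for n :: nat using F.v_pow[of \<rho> n] \<rho> by (simp add: nat_pow_consistent[symmetric])
  have pn: "\<rho> [^] n \<noteq> \<zero>" "\<rho> [^] n \<in> carrier R" for n :: nat using c \<rho> by auto
  have um: "u (y \<otimes> z) = u y + u z" if "y \<in> E" "z \<in> E" "y \<noteq> \<zero>" "z \<noteq> \<zero>" for y z
    using F.v_mult[of y z] that by simp
  show ?thesis
  proof (cases "u x")
    case (nonneg n)
    define z where "z = x \<otimes> inv (\<rho> [^] n)"
    have i: "inv (\<rho> [^] n) \<in> E" using subfield_m_inv(1)[OF E, of "\<rho> [^] n"] pE[OF \<rho>(1)] pn by auto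
    have z: "z \<in> E" "z \<noteq> \<zero>" "z \<otimes> \<rho> [^] n = x" unfolding z_def using i x E' c pn by auto
    have "u z = 0" using um[OF z(1) pE[OF \<rho>(1)] z(2) pn(1), of n] up nonneg z(3) by simp
    hence "v z = 0" using units z by blast
    moreover have "z \<in> carrier R" using z E' by auto
    hence "v x = v z + int n * v \<rho>" using v_mult[of z "\<rho> [^] n"] z pn c \<rho> by simp
    ultimately show ?thesis using nonneg by simp
  next
    case (neg n)
    define z where "z = x \<otimes> \<rho> [^] Suc n"
    have z: "z \<in> E" "z \<noteq> \<zero>" unfolding z_def using x pE[OF \<rho>(1), of "Suc n"] E' c pn[of "Suc n"] by (auto simp del: nat_pow_Suc)
    have "u z = 0" unfolding z_def using um[OF x(1) pE[OF \<rho>(1)] x(2) pn(1), of "Suc n"] up[of "Suc n"] neg by (simp del: nat_pow_Suc)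
    hence "v z = 0" using units z by blast
    moreover have "v z = v x + int (Suc n) * v \<rho>" unfolding z_def
      using v_mult[of x "\<rho> [^] Suc n"] v_pow[of \<rho> "Suc n"] x pn[of "Suc n"] c \<rho> by (simp del: nat_pow_Suc of_nat_Suc)
    ultimately have "v x = - (int (Suc n) * v \<rho>)" by linarith
    thus ?thesis using neg by (simp only: mult_minus_left)
  qed
qed

text \<open>
  What the sequel needs to know about the field \<open>R\<close>, in terms that do not involve local rings. The last part
  expresses elements of value zero as quotients of elements outside \<open>q\<close>; it allows comparing valuations of different fields.
\<close>

lemma (in dedekind_extension) ramification_via_valuation:
  assumes q: "lies_over q"
  shows "\<exists>v. valued_field R v \<and> (\<exists>t\<in>carrier R. t \<noteq> \<zero> \<and> v t = 1) \<and>
    int (ramification_index S q \<pp>) = v \<pi> \<and> 1 \<le> v \<pi> \<and> (\<forall>c\<in>C. c \<noteq> \<zero> \<longrightarrow> 0 \<le> v c \<and> (c \<in> q \<longleftrightarrow> 1 \<le> v c)) \<and>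
    (\<forall>y\<in>carrier R. y \<noteq> \<zero> \<longrightarrow> v y = 0 \<longrightarrow> (\<exists>c\<in>C - q. \<exists>s\<in>C - q. s \<otimes> y = c))"
proof -
  obtain v where v: "valuation_at v q" using exists_valuation_at[OF q] by blast
  interpret W: valued_field R v using v unfolding valuation_at_def by simp
  note vals = valuation_at_values[OF q v]
  have "\<exists>c\<in>C - q. \<exists>s\<in>C - q. s \<otimes> y = c" if y: "y \<in> carrier R" "y \<noteq> \<zero>" "v y = 0" for y
  proof -
    have "y \<in> local_ring q" using v y unfolding valuation_at_def by auto
    then obtain s where s: "s \<in> C - q" "s \<otimes> y \<in> C" unfolding local_ring_def by auto
    have sc: "s \<in> carrier R" "s \<noteq> \<zero>" using s Cc over_prime(3)[OF q] by auto
    have "v (s \<otimes> y) = 0" using W.v_mult[OF sc(1) y(1) sc(2) y(2)] vals(3)[of s] s sc y(3) by auto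
    hence "s \<otimes> y \<notin> q" using vals(3)[OF s(2)] sc y by auto
    thus ?thesis using s by blast
  qed
  thus ?thesis using v valuation_\<pi>(1)[OF q v] ramification_index_eq[OF q v] vals unfolding valuation_at_def
    by (intro exI[of _ v]) blast
qed

theorem theorem2p1:
  fixes L :: "('a, 'b) ring_scheme"
    and A K K1 K2 B B1 B2 \<pp> \<qq> \<pp>1 \<pp>2 :: "'a set"
    and p :: nat
  assumes "field L"
    and "dedekind_domain L A"
    and "K = fraction_field L A"
    and "ring.finite_dimension L K (carrier L)"
    and "separable_extension L K (carrier L)"
    and "subfield K1 L" and "K \<subseteq> K1"
    and "subfield K2 L" and "K \<subseteq> K2"
    and "carrier L = generate_field L (K1 \<union> K2)"
    and "B = integral_closure L A (carrier L)"
    and "B1 = integral_closure L A K1"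
    and "B2 = integral_closure L A K2"
    and "maximalideal \<pp> (L\<lparr>carrier := A\<rparr>)" and "\<pp> \<noteq> {\<zero>\<^bsub>L\<^esub>}"
    and "perfect_field (L\<lparr>carrier := A\<rparr> Quot \<pp>)"
    and "p = ring_characteristic (L\<lparr>carrier := A\<rparr> Quot \<pp>)"
    and "maximalideal \<qq> (L\<lparr>carrier := B\<rparr>)" and "\<qq> \<inter> A = \<pp>"
    and "\<pp>1 = \<qq> \<inter> B1" and "\<pp>2 = \<qq> \<inter> B2"
    and "\<not> p dvd ramification_index (L\<lparr>carrier := B1\<rparr>) \<pp>1 \<pp> \<or>
         \<not> p dvd ramification_index (L\<lparr>carrier := B2\<rparr>) \<pp>2 \<pp>"
  shows "ramification_index (L\<lparr>carrier := B\<rparr>) \<qq> \<pp> =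
         lcm (ramification_index (L\<lparr>carrier := B1\<rparr>) \<pp>1 \<pp>)
             (ramification_index (L\<lparr>carrier := B2\<rparr>) \<pp>2 \<pp>)"
proof -
  interpret L: field L by (rule assms(1))
  let ?SA = "L\<lparr>carrier := A\<rparr>"
  have A: "subring A L" and noeth: "noetherian_ring ?SA" and ic: "integral_closure L A (fraction_field L A) = A"
    and dim1: "\<And>P. primeideal P ?SA \<Longrightarrow> P \<noteq> {\<zero>\<^bsub>L\<^esub>} \<Longrightarrow> maximalideal P ?SA"
    using assms(2) unfolding dedekind_domain_def noetherian_domain_def by auto
  note A' = subringE[OF A]
  have cA: "cring ?SA" by (rule L.subring_cring[OF A])
  have pm: "maximalideal \<pp> ?SA" by (rule assms(14))
  have pp: "primeideal \<pp> ?SA" by (rule cring.maximalideal_prime[OF cA pm])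
  have pid: "ideal \<pp> ?SA" using pp by (simp add: primeideal_def)
  have pi: "\<pp> \<subseteq> A" "\<zero>\<^bsub>L\<^esub> \<in> \<pp>" "\<And>x y. x \<in> \<pp> \<Longrightarrow> y \<in> \<pp> \<Longrightarrow> x \<oplus>\<^bsub>L\<^esub> y \<in> \<pp>" "\<And>a x. a \<in> A \<Longrightarrow> x \<in> \<pp> \<Longrightarrow> a \<otimes>\<^bsub>L\<^esub> x \<in> \<pp>"
    using pid unfolding L.ideal_subring_iff[OF A] by auto
  note inverse_mod = L.inverse_modulo_maximal_ideal[OF A pm]
  have min: "Q = \<pp>" if Q: "primeideal Q ?SA" "Q \<subseteq> \<pp>" "Q \<noteq> {\<zero>\<^bsub>L\<^esub>}" for Q
    using maximalideal.I_maximal[OF dim1[OF Q(1,3)] pid Q(2)] maximalideal.I_notcarr[OF pm] pi(1) by auto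
  interpret D: dedekind_prime L A \<pp>
    by (intro dedekind_prime.intro noetherian_prime.intro noetherian_prime_axioms.intro dedekind_prime_axioms.intro)
      (use L.field_axioms A noeth pp inverse_mod min assms(15) ic in auto)
  obtain \<pi> where \<pi>: "\<pi> \<in> \<pp>" "\<pi> \<noteq> \<zero>\<^bsub>L\<^esub>"
    "\<And>x. x \<in> A \<Longrightarrow> x \<noteq> \<zero>\<^bsub>L\<^esub> \<Longrightarrow> \<exists>n::nat. \<exists>s\<in>A - \<pp>. \<exists>u\<in>A - \<pp>. s \<otimes>\<^bsub>L\<^esub> x = \<pi> [^]\<^bsub>L\<^esub> n \<otimes>\<^bsub>L\<^esub> u"
    using D.exists_uniformizer by blast
  have \<pi>A: "\<pi> \<in> A" using \<pi> pi by auto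
  have K: "subfield K L" unfolding assms(3) by (rule L.fraction_field_subfield[OF A])
  have AK: "A \<subseteq> K" unfolding assms(3) by (rule L.fraction_field_incl[OF A])
  obtain n where n: "L.dimension n K (carrier L)" using assms(4) by (auto simp: L.finite_dimension_def)
  have dep: "\<exists>as. length as = length us \<and> set as \<subseteq> A \<and> \<not> set as \<subseteq> {\<zero>\<^bsub>L\<^esub>} \<and> L.combine as us = \<zero>\<^bsub>L\<^esub>"
    if us: "set us \<subseteq> carrier L" "length us = Suc n" for us
  proof -
    have "L.dependent K us" using L.independent_length_le_dimension[OF K n _ us(1)] us(2) by auto
    then obtain ks where ks: "length ks = length us" "L.combine ks us = \<zero>\<^bsub>L\<^esub>" "set ks \<subseteq> K" "set ks \<noteq> {\<zero>\<^bsub>L\<^esub>}"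
      using L.dependent_imp_non_trivial_combine[OF K us(1)] by blast
    obtain d where d: "d \<in> A" "d \<noteq> \<zero>\<^bsub>L\<^esub>" "\<forall>k\<in>set ks. d \<otimes>\<^bsub>L\<^esub> k \<in> A"
      using L.common_denominator[OF A] ks(3) unfolding assms(3) by blast
    have dc: "d \<in> carrier L" using d A' by auto
    have kc: "set ks \<subseteq> carrier L" using ks(3) subfieldE(3)[OF K] by auto
    have "ks \<noteq> []" using ks(1) us(2) by auto
    then obtain k where k: "k \<in> set ks" "k \<noteq> \<zero>\<^bsub>L\<^esub>" using ks(4) by (cases ks) auto
    have "d \<otimes>\<^bsub>L\<^esub> k \<noteq> \<zero>\<^bsub>L\<^esub>" using d k dc kc by auto
    hence "\<not> set (map (\<lambda>a. d \<otimes>\<^bsub>L\<^esub> a) ks) \<subseteq> {\<zero>\<^bsub>L\<^esub>}" using k(1) by auto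
    moreover have "L.combine (map (\<lambda>a. d \<otimes>\<^bsub>L\<^esub> a) ks) us = \<zero>\<^bsub>L\<^esub>" using L.combine_smult[OF kc us(1) dc] ks(2) dc by simp
    ultimately show ?thesis using ks(1) d(3) by (intro exI[of _ "map (\<lambda>a. d \<otimes>\<^bsub>L\<^esub> a) ks"]) auto
  qed
  have "ring (L\<lparr>carrier := B\<rparr>)" using assms(18) by (simp add: maximalideal_def ideal_def)
  moreover have Bsub: "B \<subseteq> carrier L" unfolding assms(11) integral_closure_def by auto
  ultimately have B: "subring B L" using L.ring_incl_imp_subring by blast
  have AB: "A \<subseteq> B" unfolding assms(11) by (rule L.integral_closure_incl[OF A A'(1)])
  have qp: "primeideal \<qq> (L\<lparr>carrier := B\<rparr>)" by (rule cring.maximalideal_prime[OF L.subring_cring[OF B] assms(18)])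
  have q: "\<qq> \<subseteq> B" "\<zero>\<^bsub>L\<^esub> \<in> \<qq>" "\<And>x y. x \<in> \<qq> \<Longrightarrow> y \<in> \<qq> \<Longrightarrow> x \<oplus>\<^bsub>L\<^esub> y \<in> \<qq>" "\<And>a x. a \<in> B \<Longrightarrow> x \<in> \<qq> \<Longrightarrow> a \<otimes>\<^bsub>L\<^esub> x \<in> \<qq>"
    "\<one>\<^bsub>L\<^esub> \<notin> \<qq>" "\<And>a b. a \<in> B \<Longrightarrow> b \<in> B \<Longrightarrow> a \<otimes>\<^bsub>L\<^esub> b \<in> \<qq> \<Longrightarrow> a \<in> \<qq> \<or> b \<in> \<qq>"
    using qp unfolding L.primeideal_subring_iff[OF B] L.ideal_subring_iff[OF B] by auto
  \<comment> \<open>The local theory is applied to three fields: \<open>L\<close>, \<open>K1\<close> and \<open>K2\<close>.\<close>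
  define C where "C E = integral_closure L A E" for E
  have CE: "C E = B \<inter> E" if "E \<subseteq> carrier L" for E unfolding C_def assms(11) using that by (auto simp: integral_closure_def)
  have ext: "dedekind_extension (L\<lparr>carrier := E\<rparr>) A \<pp> \<pi> n (C E) \<and>
      dedekind_extension.lies_over (L\<lparr>carrier := E\<rparr>) A \<pp> (C E) (\<qq> \<inter> E)"
    if E: "subfield E L" "K \<subseteq> E" for E
  proof -
    let ?F = "L\<lparr>carrier := E\<rparr>"
    have Ec: "E \<subseteq> carrier L" using subfieldE(3)[OF E(1)] .
    have AE: "A \<subseteq> E" using AK E(2) by auto
    have C: "subring (C E) L" unfolding CE[OF Ec] by (rule L.subring_inter[OF B subfieldE(1)[OF E(1)]])
    have CsE: "C E \<subseteq> E" unfolding CE[OF Ec] by auto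
    have "noetherian_prime ?F A \<pp>"
    proof (intro noetherian_prime.intro noetherian_prime_axioms.intro)
      show "field ?F" by (rule L.subfield_iff(2)[OF E(1)])
      show "subring A ?F" by (rule L.subring_of_subfield[OF E(1) A AE])
    qed (use noeth pp inverse_mod min assms(15) in auto)
    moreover have "dedekind_extension_axioms ?F A \<pp> \<pi> n (C E)"
    proof (intro dedekind_extension_axioms.intro)
      show "subring (C E) ?F" by (rule L.subring_of_subfield[OF E(1) C CsE])
      show "C E = integral_closure ?F A (carrier ?F)" using L.integral_closure_subfield[OF E(1)] unfolding C_def by simp
      fix us assume "set us \<subseteq> carrier ?F" "length us = Suc n"
      thus "\<exists>as. length as = length us \<and> set as \<subseteq> A \<and> \<not> set as \<subseteq> {\<zero>\<^bsub>?F\<^esub>} \<and> ring.combine ?F as us = \<zero>\<^bsub>?F\<^esub>"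
        using dep[of us] Ec L.combine_subfield[OF E(1)] by auto
    qed (use \<pi> in \<open>auto simp: nat_pow_def\<close>)
    ultimately have DE: "dedekind_extension ?F A \<pp> \<pi> n (C E)" by (rule dedekind_extension.intro)
    have "primeideal (\<qq> \<inter> E) (L\<lparr>carrier := C E\<rparr>)"
      unfolding L.primeideal_subring_iff[OF C] L.ideal_subring_iff[OF C] unfolding CE[OF Ec]
      using q subringE[OF subfieldE(1)[OF E(1)]] by (intro conjI ballI impI) auto
    moreover have "\<qq> \<inter> E \<inter> A = \<pp>" using assms(19) AE by auto
    ultimately show ?thesis using DE dedekind_extension.lies_over_def[OF DE] by simp
  qed
  have data: "\<exists>v. valued_field (L\<lparr>carrier := E\<rparr>) v \<and> (\<exists>t\<in>E. t \<noteq> \<zero>\<^bsub>L\<^esub> \<and> v t = 1) \<and>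
    int (ramification_index (L\<lparr>carrier := C E\<rparr>) (\<qq> \<inter> E) \<pp>) = v \<pi> \<and> 1 \<le> v \<pi> \<and>
    (\<forall>c\<in>C E. c \<noteq> \<zero>\<^bsub>L\<^esub> \<longrightarrow> 0 \<le> v c \<and> (c \<in> \<qq> \<inter> E \<longleftrightarrow> 1 \<le> v c)) \<and>
    (\<forall>y\<in>E. y \<noteq> \<zero>\<^bsub>L\<^esub> \<longrightarrow> v y = 0 \<longrightarrow> (\<exists>c\<in>C E - (\<qq> \<inter> E). \<exists>s\<in>C E - (\<qq> \<inter> E). s \<otimes>\<^bsub>L\<^esub> y = c))"
    if E: "subfield E L" "K \<subseteq> E" for E
    using dedekind_extension.ramification_via_valuation[OF conjunct1[OF ext[OF E]] conjunct2[OF ext[OF E]]] by simp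
  have Lc: "L\<lparr>carrier := carrier L\<rparr> = L" by simp
  have Kc: "K \<subseteq> carrier L" using subfieldE(3)[OF K] .
  have qc: "\<qq> \<inter> carrier L = \<qq>" using q(1) Bsub by auto
  have CL: "C (carrier L) = B" unfolding C_def assms(11) ..
  obtain w t where w: "valued_field L w" "t \<in> carrier L" "t \<noteq> \<zero>\<^bsub>L\<^esub>" "w t = 1"
    "int (ramification_index (L\<lparr>carrier := B\<rparr>) \<qq> \<pp>) = w \<pi>" "1 \<le> w \<pi>"
    and wB: "\<And>c. c \<in> B \<Longrightarrow> c \<noteq> \<zero>\<^bsub>L\<^esub> \<Longrightarrow> 0 \<le> w c \<and> (c \<in> \<qq> \<longleftrightarrow> 1 \<le> w c)"
    using data[OF L.carrier_is_subfield Kc] unfolding Lc qc CL by blast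
  interpret W: valued_field L w by (rule w(1))
  have BW: "B \<subseteq> W.B 0" using wB Bsub unfolding W.B_def by auto
  have qW: "c \<in> \<qq> \<longleftrightarrow> c \<in> W.B 1" if "c \<in> B" for c using wB[OF that] q(2) that Bsub unfolding W.B_def by auto
  have sub: "\<exists>\<rho>\<in>E. \<rho> \<noteq> \<zero>\<^bsub>L\<^esub> \<and> 1 \<le> w \<rho> \<and> (\<forall>x\<in>E. x \<noteq> \<zero>\<^bsub>L\<^esub> \<longrightarrow> w \<rho> dvd w x) \<and>
      w \<pi> = int (ramification_index (L\<lparr>carrier := C E\<rparr>) (\<qq> \<inter> E) \<pp>) * w \<rho>"
    if E: "subfield E L" "K \<subseteq> E" for E
  proof -
    obtain v \<rho> where v: "valued_field (L\<lparr>carrier := E\<rparr>) v" "\<rho> \<in> E" "\<rho> \<noteq> \<zero>\<^bsub>L\<^esub>" "v \<rho> = 1"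
      "int (ramification_index (L\<lparr>carrier := C E\<rparr>) (\<qq> \<inter> E) \<pp>) = v \<pi>" "1 \<le> v \<pi>"
      and vu: "\<And>y. y \<in> E \<Longrightarrow> y \<noteq> \<zero>\<^bsub>L\<^esub> \<Longrightarrow> v y = 0 \<Longrightarrow> \<exists>c\<in>C E - (\<qq> \<inter> E). \<exists>s\<in>C E - (\<qq> \<inter> E). s \<otimes>\<^bsub>L\<^esub> y = c"
      using data[OF E] by blast
    have Ec: "E \<subseteq> carrier L" using subfieldE(3)[OF E(1)] .
    have u: "w y = 0" if y: "y \<in> E" "y \<noteq> \<zero>\<^bsub>L\<^esub>" "v y = 0" for y
    proof -
      obtain c s where cs: "c \<in> C E - (\<qq> \<inter> E)" "s \<in> C E - (\<qq> \<inter> E)" "s \<otimes>\<^bsub>L\<^esub> y = c" using vu[OF y] by blast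
      have c: "c \<in> B" "c \<notin> \<qq>" "s \<in> B" "s \<notin> \<qq>" using cs(1,2) unfolding CE[OF Ec] by auto
      hence "c \<noteq> \<zero>\<^bsub>L\<^esub>" "s \<noteq> \<zero>\<^bsub>L\<^esub>" using q(2) by auto
      moreover from this have "w c = 0" "w s = 0" using wB[of c] wB[of s] c by auto
      moreover have "s \<in> carrier L" "y \<in> carrier L" using c Bsub y Ec by auto
      ultimately show ?thesis using W.v_mult[of s y] cs(3) y(2) by simp
    qed
    have r: "w x = v x * w \<rho>" if x: "x \<in> E" "x \<noteq> \<zero>\<^bsub>L\<^esub>" for x
      by (rule W.restricted_valuation[OF E(1) v(1-4) _ x]) (rule u)
    have \<pi>E: "\<pi> \<in> E" using \<pi>A AK E(2) by auto
    have e: "w \<pi> = v \<pi> * w \<rho>" using r[OF \<pi>E] \<pi>(2) by simp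
    hence "0 < v \<pi> * w \<rho>" using w(6) by simp
    hence "1 \<le> w \<rho>" using zero_less_mult_pos[of "v \<pi>" "w \<rho>"] v(6) by simp
    thus ?thesis using r v(3,5) e by (intro bexI[OF _ v(2)] conjI) simp_all
  qed
  \<comment> \<open>The two subfields play different roles in the tame case, so the argument is stated for a pair in
    which the second one is tame.\<close>
  have coprime_values: "gcd (w \<rho>) (w \<theta>) = 1"
    if E: "subfield E L" "K \<subseteq> E" and F: "subfield F L" "K \<subseteq> F" and gen: "carrier L = generate_field L (E \<union> F)"
      and \<rho>: "\<rho> \<in> E" "\<rho> \<noteq> \<zero>\<^bsub>L\<^esub>" "1 \<le> w \<rho>" "\<forall>x\<in>E. x \<noteq> \<zero>\<^bsub>L\<^esub> \<longrightarrow> w \<rho> dvd w x"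
      and \<theta>: "\<theta> \<in> F" "\<theta> \<noteq> \<zero>\<^bsub>L\<^esub>" "1 \<le> w \<theta>" "\<forall>x\<in>F. x \<noteq> \<zero>\<^bsub>L\<^esub> \<longrightarrow> w \<theta> dvd w x"
      and e: "w \<pi> = int e * w \<theta>" "\<not> p dvd e" for E F \<rho> \<theta> e
  proof -
    have AE: "A \<subseteq> E" "A \<subseteq> F" using AK E F by auto
    have A0: "A \<subseteq> W.B 0" using AB BW by auto
    have pA: "a \<in> \<pp> \<longleftrightarrow> a \<in> W.B 1" if "a \<in> A" for a using qW[of a] that AB assms(19) by auto
    have e0: "0 < e" using e(1) w(6) by (cases e) auto
    \<comment> \<open>An integer prime to the residue characteristic is not in the maximal ideal.\<close>
    have eu: "[e] \<cdot>\<^bsub>L\<^esub> \<one>\<^bsub>L\<^esub> \<notin> W.B 1"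
    proof
      assume *: "[e] \<cdot>\<^bsub>L\<^esub> \<one>\<^bsub>L\<^esub> \<in> W.B 1"
      have eA: "[e] \<cdot>\<^bsub>L\<^esub> \<one>\<^bsub>L\<^esub> \<in> A" using L.add_pow_in_subring[OF A] A' by auto
      hence ep: "[e] \<cdot>\<^bsub>L\<^esub> \<one>\<^bsub>L\<^esub> \<in> \<pp>" using pA * by simp
      have rA: "ring ?SA" by (rule L.subring_is_ring[OF A])
      interpret h: ring_hom_ring ?SA "?SA Quot \<pp>" "\<lambda>a. \<pp> +>\<^bsub>?SA\<^esub> a" by (rule ideal.rcos_ring_hom_ring[OF pid])
      have "\<pp> +>\<^bsub>?SA\<^esub> ([k] \<cdot>\<^bsub>?SA\<^esub> \<one>\<^bsub>?SA\<^esub>) = [k] \<cdot>\<^bsub>?SA Quot \<pp>\<^esub> \<one>\<^bsub>?SA Quot \<pp>\<^esub>" for k :: nat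
        using h.hom_add_pow_one[of k] by simp
      moreover have "[e] \<cdot>\<^bsub>?SA\<^esub> \<one>\<^bsub>?SA\<^esub> = [e] \<cdot>\<^bsub>L\<^esub> \<one>\<^bsub>L\<^esub>" by (simp add: add_pow_def nat_pow_def)
      moreover have "\<pp> +>\<^bsub>?SA\<^esub> ([e] \<cdot>\<^bsub>L\<^esub> \<one>\<^bsub>L\<^esub>) = \<zero>\<^bsub>?SA Quot \<pp>\<^esub>" using ring.a_rcos_zero[OF rA pid ep] by (simp add: FactRing_def)
      ultimately have "[e] \<cdot>\<^bsub>?SA Quot \<pp>\<^esub> \<one>\<^bsub>?SA Quot \<pp>\<^esub> = \<zero>\<^bsub>?SA Quot \<pp>\<^esub>" by metis
      hence "p dvd e" unfolding assms(17) using ring.ring_characteristic_dvd[OF ideal.quotient_is_ring[OF pid] e0] by blast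
      thus False using e(2) by simp
    qed
    have res: "\<exists>G. set G \<subseteq> A \<and> L.eval (\<one>\<^bsub>L\<^esub> # G) c \<in> W.B 1 \<and> L.eval (L.deriv_list (\<one>\<^bsub>L\<^esub> # G)) c \<notin> W.B 1"
      if c: "c \<in> W.B 0" for c
    proof -
      have DL: "dedekind_extension L A \<pp> \<pi> n B" using conjunct1[OF ext[OF L.carrier_is_subfield Kc]] unfolding Lc CL .
      have cc: "c \<in> carrier L" using c by auto
      obtain f where f: "set f \<subseteq> A" "\<not> set f \<subseteq> \<pp>" "L.eval f c = \<zero>\<^bsub>L\<^esub>"
        using dedekind_extension.primitive_relation[OF DL cc] by blast
      have f2: "\<not> set f \<subseteq> W.B 1" using f(1,2) pA by blast
      have f3: "L.eval f c \<in> W.B 1" using f(3) by simp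
      have inv: "\<exists>b\<in>A. b \<otimes>\<^bsub>L\<^esub> a \<ominus>\<^bsub>L\<^esub> \<one>\<^bsub>L\<^esub> \<in> W.B 1" if a: "a \<in> A" "a \<notin> W.B 1" for a
      proof -
        obtain b where b: "b \<in> A" "a \<otimes>\<^bsub>L\<^esub> b \<ominus>\<^bsub>L\<^esub> \<one>\<^bsub>L\<^esub> \<in> \<pp>" using D.inverse_modulo[of a] a pA by auto
        have "a \<otimes>\<^bsub>L\<^esub> b = b \<otimes>\<^bsub>L\<^esub> a" using a b A' by (intro L.m_comm) auto
        thus ?thesis using b pA[of "a \<otimes>\<^bsub>L\<^esub> b \<ominus>\<^bsub>L\<^esub> \<one>\<^bsub>L\<^esub>"] pi(1) by auto
      qed
      show ?thesis by (rule W.simple_root_mod_maximal_ideal[OF A A0 pid pA assms(16) inv c f(1) f2 f3])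
    qed
    have "tame_compositum L w t \<pi> \<rho> \<theta> A E F e"
    proof (intro tame_compositum.intro tame_compositum_axioms.intro)
      show "carrier L = generate_field L (E \<union> F)" by (rule gen)
      show "w \<rho> dvd w x" if "x \<in> E" "x \<noteq> \<zero>\<^bsub>L\<^esub>" for x using \<rho>(4) that by blast
      show "w \<theta> dvd w x" if "x \<in> F" "x \<noteq> \<zero>\<^bsub>L\<^esub>" for x using \<theta>(4) that by blast
    qed (use w(1-4) E(1) F(1) AE A0 \<pi>A \<pi>(2) \<rho>(1-3) \<theta>(1-3) e(1) e0 eu res in auto)
    hence "gcd (w \<rho>) (w \<theta>) dvd w t" by (rule tame_compositum.value_group_compositum[OF _ w(2,3)])
    thus ?thesis using w(4) by simp
  qed
  obtain \<rho>1 where r1: "\<rho>1 \<in> K1" "\<rho>1 \<noteq> \<zero>\<^bsub>L\<^esub>" "1 \<le> w \<rho>1" "\<forall>x\<in>K1. x \<noteq> \<zero>\<^bsub>L\<^esub> \<longrightarrow> w \<rho>1 dvd w x"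
    "w \<pi> = int (ramification_index (L\<lparr>carrier := C K1\<rparr>) (\<qq> \<inter> K1) \<pp>) * w \<rho>1"
    using sub[OF assms(6,7)] by blast
  obtain \<rho>2 where r2: "\<rho>2 \<in> K2" "\<rho>2 \<noteq> \<zero>\<^bsub>L\<^esub>" "1 \<le> w \<rho>2" "\<forall>x\<in>K2. x \<noteq> \<zero>\<^bsub>L\<^esub> \<longrightarrow> w \<rho>2 dvd w x"
    "w \<pi> = int (ramification_index (L\<lparr>carrier := C K2\<rparr>) (\<qq> \<inter> K2) \<pp>) * w \<rho>2"
    using sub[OF assms(8,9)] by blast
  have c12: "C K1 = B1" "C K2 = B2" unfolding C_def assms(12,13) by auto
  have "B1 = B \<inter> K1" "B2 = B \<inter> K2" using CE[OF subfieldE(3)[OF assms(6)]] CE[OF subfieldE(3)[OF assms(8)]] c12 by auto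
  hence q12: "\<qq> \<inter> K1 = \<pp>1" "\<qq> \<inter> K2 = \<pp>2" unfolding assms(20,21) using q(1) by auto
  note r1' = r1(5)[unfolded c12 q12] and r2' = r2(5)[unfolded c12 q12]
  have "gcd (w \<rho>1) (w \<rho>2) = 1"
  proof (cases "p dvd ramification_index (L\<lparr>carrier := B2\<rparr>) \<pp>2 \<pp>")
    case False
    show ?thesis by (rule coprime_values[OF assms(6-10) r1(1-4) r2(1-4) r2' False])
  next
    case True
    hence "\<not> p dvd ramification_index (L\<lparr>carrier := B1\<rparr>) \<pp>1 \<pp>" using assms(22) by simp
    moreover have "carrier L = generate_field L (K2 \<union> K1)" using assms(10) by (simp add: Un_commute)
    ultimately have "gcd (w \<rho>2) (w \<rho>1) = 1" using coprime_values[OF assms(8,9,6,7) _ r2(1-4) r1(1-4) r1'] by blast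
    thus ?thesis by (simp add: gcd.commute)
  qed
  moreover have "0 < ramification_index (L\<lparr>carrier := B\<rparr>) \<qq> \<pp>" using w(5,6) by linarith
  ultimately show ?thesis using lcm_of_coprime_cofactors r1' r2' w(5) by metis
qed

end
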